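(* Consider the model $Y=X\beta+\mu+\epsilon$, $X=\nu+\eta$ described in the context, under assumptions (A1), (A2* ), (A3). Then the estimator $$\hat\beta=\frac{(X-Z\hat\delta)^\top(Y-Z\hat\theta)}{\|X-Z\hat\delta\|^2}$$ satisfies $\sqrt n(\hat\beta-\beta)\xrightarrow{d}\mathcal N\big(0,\bar d/\sigma_\eta^2\big)$.
   Context: Asymptotics are as $n\to\infty$; $p=p_n$ and other quantities may depend on $n$. Notation: for $u\in\mathbb N$, $\mathcal M_u=\{m\subseteq\{1,\dots,p\}:|m|=u\}$; $Z_m$ is the submatrix of $Z\in\mathbb R^{n\times p}$ with columns in $m$, $P_m$ the orthogonal projection onto its column space, $P_m^\perp=I_n-P_m$. A (possibly random) sequence $v\in\mathbb R^n$ is weakly sparse relative to $Z$ (in probability) with sparsity $s$ at rate $k$ if there are sets $S\in\mathcal M_s$ with $\|P_S^\perp v\|^2=o_p(k)$. Exponential weights: $w_m(V;u,\alpha)=\exp(-\|P_m^\perp V\|^2/\alpha)/\sum_{k\in\mathcal M_u}\exp(-\|P_k^\perp V\|^2/\alpha)$ and $\hat f(V;u,\alpha)=\sum_{m\in\mathcal M_u}w_m(V;u,\alpha)P_mV$. Model: $Y,X,\mu,\nu,\eta,\epsilon\in\mathbb R^n$, $\beta\in\mathbb R$ fixed; $(Y,X,Z)$ observed. (A1) $\|\mu\|^2=O_p(n)$ and $\|\nu\|^2=O_p(n)$. (A2* ) $\eta\sim\mathcal N_n(0,\sigma_\eta^2I_n)$ with $\sigma_\eta^2>0$ fixed, independent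 of $(Z,\mu,\nu,\epsilon)$; $\epsilon\sim\mathcal N_n(0,\Sigma_\epsilon)$ independent of $(Z,\mu,\nu)$, with $\|\Sigma_\epsilon\|=\mathcal O(1)$ (operator norm) and $\mathrm{Tr}(\Sigma_\epsilon)/n\to\bar d>0$. (A3) $\mu$, $\nu$ and $\nu\beta+\mu$ are weakly sparse relative to $Z$ at rate $\sqrt n$ with sparsities $s_\gamma,s_\delta,s_\theta$; the chosen integers satisfy $u_\gamma\ge s_\gamma$, $u_\delta\ge s_\delta$, $u_\theta\ge s_\theta$ for all large $n$ and $\max(u_\gamma,u_\delta,u_\theta)=o(\sqrt n/\log p)$. Estimators: $Z\hat\theta=\hat f(Y;u_\theta,\alpha_Y)$ with fixed $\alpha_Y>4(\beta^2\sigma_\eta^2+\sup_n\|\Sigma_\epsilon\|)$; $Z\hat\delta=\hat f(X;u_\delta,\alpha_X)$ with fixed $\alpha_X>4\sigma_\eta^2$. *)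

theory Defs
  imports "HOL-Probability.Probability" "HOL-Library.Landau_Symbols"
begin

(* Vectors in R^n are functions nat => real, only coordinates i < n matter.
   Matrices Z in R^{n x p} are functions nat => nat => real (row i < n, column j < p).
   Columns are indexed 0..p-1 (instead of 1..p). *)

definition sqnorm :: "nat \<Rightarrow> (nat \<Rightarrow> real) \<Rightarrow> real" where
  "sqnorm n v = (\<Sum>i<n. (v i)\<^sup>2)"

definition innern :: "nat \<Rightarrow> (nat \<Rightarrow> real) \<Rightarrow> (nat \<Rightarrow> real) \<Rightarrow> real" where
  "innern n u v = (\<Sum>i<n. u i * v i)"

definition colspace :: "nat \<Rightarrow> (nat \<Rightarrow> nat \<Rightarrow> real) \<Rightarrow> nat set \<Rightarrow> (nat \<Rightarrow> real) set" where
  "colspace n Z m = {w. (\<exists>c. \<forall>i<n. w i = (\<Sum>j\<in>m. Z i j * c j)) \<and> (\<forall>i\<ge>n. w i = 0)}"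

definition proj :: "nat \<Rightarrow> (nat \<Rightarrow> nat \<Rightarrow> real) \<Rightarrow> nat set \<Rightarrow> (nat \<Rightarrow> real) \<Rightarrow> (nat \<Rightarrow> real)" where
  "proj n Z m v = (THE w. w \<in> colspace n Z m \<and>
      (\<forall>u\<in>colspace n Z m. innern n (\<lambda>i. v i - w i) u = 0))"

definition resid :: "nat \<Rightarrow> (nat \<Rightarrow> nat \<Rightarrow> real) \<Rightarrow> nat set \<Rightarrow> (nat \<Rightarrow> real) \<Rightarrow> (nat \<Rightarrow> real)" where
  "resid n Z m v = (\<lambda>i. v i - proj n Z m v i)"

definition subsets :: "nat \<Rightarrow> nat \<Rightarrow> nat set set" where
  "subsets p u = {m. m \<subseteq> {..<p} \<and> card m = u}"

definition expweight :: "nat \<Rightarrow> nat \<Rightarrow> (nat \<Rightarrow> nat \<Rightarrow> real) \<Rightarrow> nat \<Rightarrow> real \<Rightarrow> (nat \<Rightarrow> real) \<Rightarrow> nat set \<Rightarrow> real" where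
  "expweight n p Z u \<alpha> V m =
     exp (- sqnorm n (resid n Z m V) / \<alpha>) /
     (\<Sum>k\<in>subsets p u. exp (- sqnorm n (resid n Z k V) / \<alpha>))"

definition fhat :: "nat \<Rightarrow> nat \<Rightarrow> (nat \<Rightarrow> nat \<Rightarrow> real) \<Rightarrow> nat \<Rightarrow> real \<Rightarrow> (nat \<Rightarrow> real) \<Rightarrow> (nat \<Rightarrow> real)" where
  "fhat n p Z u \<alpha> V = (\<lambda>i. \<Sum>m\<in>subsets p u. expweight n p Z u \<alpha> V m * proj n Z m V i)"

definition bigOp :: "(nat \<Rightarrow> 'a measure) \<Rightarrow> (nat \<Rightarrow> 'a \<Rightarrow> real) \<Rightarrow> (nat \<Rightarrow> real) \<Rightarrow> bool" where
  "bigOp M T k \<longleftrightarrow> (\<forall>e>0. \<exists>C. \<exists>N. \<forall>n\<ge>N.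
      measure (M n) {\<omega>\<in>space (M n). \<bar>T n \<omega>\<bar> > C * k n} < e)"

definition smallOp :: "(nat \<Rightarrow> 'a measure) \<Rightarrow> (nat \<Rightarrow> 'a \<Rightarrow> real) \<Rightarrow> (nat \<Rightarrow> real) \<Rightarrow> bool" where
  "smallOp M T k \<longleftrightarrow> (\<forall>e>0.
      (\<lambda>n. measure (M n) {\<omega>\<in>space (M n). \<bar>T n \<omega>\<bar> > e * k n}) \<longlonglongrightarrow> 0)"

definition weakly_sparse ::
  "(nat \<Rightarrow> 'a measure) \<Rightarrow> (nat \<Rightarrow> nat) \<Rightarrow> (nat \<Rightarrow> 'a \<Rightarrow> nat \<Rightarrow> nat \<Rightarrow> real) \<Rightarrow>
   (nat \<Rightarrow> 'a \<Rightarrow> nat \<Rightarrow> real) \<Rightarrow> (nat \<Rightarrow> nat) \<Rightarrow> (nat \<Rightarrow> real) \<Rightarrow> bool" where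
  "weakly_sparse M p Z v s k \<longleftrightarrow>
     (\<exists>S :: nat \<Rightarrow> nat set. (\<forall>\<^sub>F n in sequentially. S n \<in> subsets (p n) (s n)) \<and>
        smallOp M (\<lambda>n \<omega>. sqnorm n (resid n (Z n \<omega>) (S n) (v n \<omega>))) k)"

definition normal_law :: "real \<Rightarrow> real measure" where
  "normal_law v = (if v = 0 then return borel 0 else density lborel (normal_density 0 (sqrt v)))"

definition gaussian_vec :: "'a measure \<Rightarrow> nat \<Rightarrow> (nat \<Rightarrow> nat \<Rightarrow> real) \<Rightarrow> ('a \<Rightarrow> nat \<Rightarrow> real) \<Rightarrow> bool" where
  "gaussian_vec M n Sig X \<longleftrightarrow>
     (\<forall>a :: nat \<Rightarrow> real. distr M borel (\<lambda>\<omega>. \<Sum>i<n. a i * X \<omega> i) =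
        normal_law (\<Sum>i<n. \<Sum>j<n. a i * Sig i j * a j))"

definition opnorm :: "nat \<Rightarrow> (nat \<Rightarrow> nat \<Rightarrow> real) \<Rightarrow> real" where
  "opnorm n A = (SUP a\<in>{a. sqnorm n a \<le> 1}. sqrt (sqnorm n (\<lambda>i. \<Sum>j<n. A i j * a j)))"

definition trace_n :: "nat \<Rightarrow> (nat \<Rightarrow> nat \<Rightarrow> real) \<Rightarrow> real" where
  "trace_n n A = (\<Sum>i<n. A i i)"

abbreviation vecM :: "nat \<Rightarrow> (nat \<Rightarrow> real) measure" where
  "vecM n \<equiv> Pi\<^sub>M {..<n} (\<lambda>_. borel)"

abbreviation matM :: "nat \<Rightarrow> nat \<Rightarrow> (nat \<times> nat \<Rightarrow> real) measure" where
  "matM n q \<equiv> Pi\<^sub>M ({..<n} \<times> {..<q}) (\<lambda>_. borel)"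

definition vecRV :: "nat \<Rightarrow> (nat \<Rightarrow> real) \<Rightarrow> (nat \<Rightarrow> real)" where
  "vecRV n v = restrict v {..<n}"

definition matRV :: "nat \<Rightarrow> nat \<Rightarrow> (nat \<Rightarrow> nat \<Rightarrow> real) \<Rightarrow> (nat \<times> nat \<Rightarrow> real)" where
  "matRV n q A = restrict (case_prod A) ({..<n} \<times> {..<q})"

definition indep_rv :: "'a measure \<Rightarrow> 'b measure \<Rightarrow> ('a \<Rightarrow> 'b) \<Rightarrow> 'c measure \<Rightarrow> ('a \<Rightarrow> 'c) \<Rightarrow> bool" where
  "indep_rv M N1 f N2 g \<longleftrightarrow> f \<in> measurable M N1 \<and> g \<in> measurable M N2 \<and>
     prob_space.indep_set M (sets (vimage_algebra (space M) f N1)) (sets (vimage_algebra (space M) g N2))"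

end

theory Submission
  imports Defs "HOL-Real_Asymp.Real_Asymp"
begin

text \<open>
  Write \<open>Y = \<theta> + \<xi>\<close> with \<open>\<theta> = \<nu> \<beta> + \<mu>\<close> and \<open>\<xi> = \<beta> \<eta> + \<epsilon>\<close>. By the Gibbs variational principle, exponential
  weights have average residual sum of squares at most that of the best model plus \<open>\<alpha> ln |M\<^sub>u|\<close>. Since
  \<open>\<parallel>P\<^sub>m v\<parallel>\<^sup>2\<close> and \<open>\<langle>v, P\<^sub>m\<^sup>\<bottom> f\<rangle>\<^sup>2 / \<parallel>P\<^sub>m\<^sup>\<bottom> f\<parallel>\<^sup>2\<close> are bounded uniformly over the models \<open>m\<close> by \<open>o\<^sub>p(\<surd>n)\<close> for both noise
  vectors \<open>v\<close>, the estimation errors of \<open>\<nu>\<close> and \<open>\<theta>\<close> have squared norm \<open>o\<^sub>p(\<surd>n)\<close> and inner product \<open>o\<^sub>p(\<surd>n)\<close> with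
  the noise. Hence \<open>\<surd>n (\<beta>' - \<beta>)\<close>, where \<open>\<beta>'\<close> is the estimator, differs from
  \<open>\<langle>\<epsilon>, \<eta>\<rangle> / (\<surd>n \<sigma>\<^sup>2)\<close> by \<open>o\<^sub>p(1)\<close>, and conditionally on \<open>\<epsilon>\<close> the latter is centred Gaussian
  with variance \<open>\<parallel>\<epsilon>\<parallel>\<^sup>2 / (n \<sigma>\<^sup>2)\<close>, which converges to the limit variance in probability.

  The uniform bound is a union bound based on \<open>E exp (\<parallel>P\<^sub>m v\<parallel>\<^sup>2 / 4 K) \<le> 2\<^bsup>|m|/2\<^esup>\<close>, proved by adding the columns of
  \<open>m\<close> one at a time and linearising each new square by an independent standard Gaussian variable.
\<close>

subsection \<open>Inner products\<close>

text \<open>The obstacle is that the weights depend on the same noise whose inner product with the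
  estimation errors must be negligible at rate sqrt n. Cauchy-Schwarz yields only sqrt n times
  o(n^(1/4)), so these inner products are bounded model by model and then averaged. The signal
  \<open>f\<close> is itself random, but it is a function of variables independent of the noise;
  after conditioning it is one more column of a fixed matrix, and each model is handled with u + 1
  columns. The entropy term, the union bound over models and the factor \<open>sqrt 2\<close> per
  column are, on the logarithmic scale, at most a multiple of u ln p plus a constant, which the
  sparsity rate makes o(sqrt n).

  The noise of Y contains beta eta, whose main contribution cancels against beta times the
  denominator. The denominator fluctuates by o(n^(3/4)), and <eps, eta> is bounded by O(n^(3/4)).
  This scale is deliberately crude: the product of the two, divided by n^(3/2), is still o(1), and
  both bounds come from estimates that are available anyway.\<close>

lemma innern_commute: "innern n u v = innern n v u"
  by (simp add: innern_def mult.commute)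

lemma innern_self: "innern n v v = sqnorm n v"
  by (simp add: innern_def sqnorm_def power2_eq_square)

lemma innern_add_left: "innern n (\<lambda>i. u i + v i) w = innern n u w + innern n v w"
  by (simp add: innern_def sum.distrib algebra_simps)

lemma innern_diff_left: "innern n (\<lambda>i. u i - v i) w = innern n u w - innern n v w"
  by (simp add: innern_def sum_subtractf algebra_simps)

lemma innern_scale_left: "innern n (\<lambda>i. c * u i) w = c * innern n u w"
  by (simp add: innern_def sum_distrib_left algebra_simps)

lemma innern_add_right: "innern n w (\<lambda>i. u i + v i) = innern n w u + innern n w v"
  by (simp add: innern_def sum.distrib algebra_simps)

lemma innern_diff_right: "innern n w (\<lambda>i. u i - v i) = innern n w u - innern n w v"
  by (simp add: innern_def sum_subtractf algebra_simps)

lemma innern_scale_right: "innern n w (\<lambda>i. c * u i) = c * innern n w u"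
  by (simp add: innern_def sum_distrib_left algebra_simps)

lemmas innern_linear = innern_add_left innern_diff_left innern_scale_left
  innern_add_right innern_diff_right innern_scale_right

lemma innern_cong:
  "(\<And>i. i < n \<Longrightarrow> u i = u' i) \<Longrightarrow> (\<And>i. i < n \<Longrightarrow> v i = v' i) \<Longrightarrow> innern n u v = innern n u' v'"
  by (simp add: innern_def)

lemma sqnorm_cong: "(\<And>i. i < n \<Longrightarrow> u i = u' i) \<Longrightarrow> sqnorm n u = sqnorm n u'"
  by (simp add: sqnorm_def)

lemma sqnorm_nonneg [simp]: "0 \<le> sqnorm n v"
  by (simp add: sqnorm_def sum_nonneg)

lemma sqnorm_eq_0_iff: "sqnorm n v = 0 \<longleftrightarrow> (\<forall>i<n. v i = 0)"
  by (auto simp: sqnorm_def sum_nonneg_eq_0_iff)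

lemma sqnorm_add: "sqnorm n (\<lambda>i. u i + v i) = sqnorm n u + 2 * innern n u v + sqnorm n v"
  by (simp add: innern_self[symmetric] innern_linear innern_commute)

lemma sqnorm_diff: "sqnorm n (\<lambda>i. u i - v i) = sqnorm n u - 2 * innern n u v + sqnorm n v"
  by (simp add: innern_self[symmetric] innern_linear innern_commute)

lemma sqnorm_scale: "sqnorm n (\<lambda>i. c * u i) = c\<^sup>2 * sqnorm n u"
  by (simp add: innern_self[symmetric] innern_linear power2_eq_square)

lemma innern_le_sqnorm: "2 * \<bar>innern n u v\<bar> \<le> sqnorm n u + sqnorm n v"
  using sqnorm_nonneg[of n "\<lambda>i. u i + v i"] sqnorm_nonneg[of n "\<lambda>i. u i - v i"]
  by (simp add: sqnorm_add sqnorm_diff)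

lemma innern_Cauchy_Schwarz: "(innern n u v)\<^sup>2 \<le> sqnorm n u * sqnorm n v"
proof (cases "sqnorm n v = 0")
  case True
  then have "innern n u v = 0" by (simp add: sqnorm_eq_0_iff innern_def)
  then show ?thesis using True by simp
next
  case False
  then have pos: "sqnorm n v > 0" by (metis sqnorm_nonneg less_eq_real_def)
  define k where "k = innern n u v / sqnorm n v"
  have "0 \<le> sqnorm n (\<lambda>i. u i - k * v i)" by simp
  also have "\<dots> = sqnorm n u - 2 * k * innern n u v + k\<^sup>2 * sqnorm n v"
    by (simp add: sqnorm_diff innern_linear sqnorm_scale)
  also have "\<dots> = sqnorm n u - (innern n u v)\<^sup>2 / sqnorm n v"
    using pos by (simp add: k_def field_simps power2_eq_square)
  finally show ?thesis using pos by (simp add: field_simps)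
qed

lemma innern_zero_right: "(\<And>i. i < n \<Longrightarrow> v i = 0) \<Longrightarrow> innern n u v = 0"
  by (simp add: innern_def)

subsection \<open>Orthogonal projections\<close>

text \<open>The condition under the \<open>THE\<close> in \<open>proj\<close>, isolated so that a
  candidate can be checked before existence and uniqueness are known.\<close>

definition is_proj :: "nat \<Rightarrow> (nat \<Rightarrow> nat \<Rightarrow> real) \<Rightarrow> nat set \<Rightarrow> (nat \<Rightarrow> real) \<Rightarrow> (nat \<Rightarrow> real) \<Rightarrow> bool" where
  "is_proj n Z m v w \<longleftrightarrow> w \<in> colspace n Z m \<and>
     (\<forall>u\<in>colspace n Z m. innern n (\<lambda>i. v i - w i) u = 0)"

text \<open>Cut off at \<open>n\<close> because members of \<open>colspace\<close> vanish from
  \<open>n\<close> on.\<close>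

definition zcol :: "nat \<Rightarrow> (nat \<Rightarrow> nat \<Rightarrow> real) \<Rightarrow> nat \<Rightarrow> nat \<Rightarrow> real" where
  "zcol n Z j = (\<lambda>i. if i < n then Z i j else 0)"

lemma colspace_add:
  assumes "u \<in> colspace n Z m" "v \<in> colspace n Z m"
  shows "(\<lambda>i. u i + v i) \<in> colspace n Z m"
proof -
  obtain c d where "\<forall>i<n. u i = (\<Sum>j\<in>m. Z i j * c j)" "\<forall>i<n. v i = (\<Sum>j\<in>m. Z i j * d j)"
    using assms by (auto simp: colspace_def)
  then have "\<forall>i<n. u i + v i = (\<Sum>j\<in>m. Z i j * (c j + d j))"
    by (simp add: sum.distrib algebra_simps)
  then show ?thesis using assms by (auto simp: colspace_def)
qed

lemma colspace_scale:
  assumes "u \<in> colspace n Z m"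
  shows "(\<lambda>i. k * u i) \<in> colspace n Z m"
proof -
  obtain c where "\<forall>i<n. u i = (\<Sum>j\<in>m. Z i j * c j)"
    using assms by (auto simp: colspace_def)
  then have "\<forall>i<n. k * u i = (\<Sum>j\<in>m. Z i j * (k * c j))"
    by (simp add: sum_distrib_left algebra_simps)
  then show ?thesis using assms by (auto simp: colspace_def)
qed

lemma colspace_diff:
  assumes "u \<in> colspace n Z m" "v \<in> colspace n Z m"
  shows "(\<lambda>i. u i - v i) \<in> colspace n Z m"
  using colspace_add[OF assms(1) colspace_scale[OF assms(2), of "-1"]] by simp

lemma colspace_mono:
  assumes "finite m'" "m \<subseteq> m'"
  shows "colspace n Z m \<subseteq> colspace n Z m'"
proof
  fix u assume u: "u \<in> colspace n Z m"
  then obtain c where c: "\<forall>i<n. u i = (\<Sum>j\<in>m. Z i j * c j)"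
    by (auto simp: colspace_def)
  have "(\<Sum>j\<in>m. Z i j * c j) = (\<Sum>j\<in>m'. Z i j * (if j \<in> m then c j else 0))" for i
    using assms by (intro sum.mono_neutral_cong_left) auto
  then show "u \<in> colspace n Z m'"
    using u c by (auto simp: colspace_def intro!: exI[of _ "\<lambda>j. if j \<in> m then c j else 0"])
qed

lemma colspace_insert_decomp:
  assumes "finite m" "j \<notin> m" "u \<in> colspace n Z (insert j m)"
  obtains u0 a where "u0 \<in> colspace n Z m" "u = (\<lambda>i. u0 i + a * zcol n Z j i)"
proof -
  obtain c where c: "\<forall>i<n. u i = (\<Sum>j\<in>insert j m. Z i j * c j)" "\<forall>i\<ge>n. u i = 0"
    using assms by (auto simp: colspace_def)
  define u0 where "u0 = (\<lambda>i. if i < n then (\<Sum>j\<in>m. Z i j * c j) else 0)"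
  have "u0 \<in> colspace n Z m" by (auto simp: colspace_def u0_def)
  moreover have "u = (\<lambda>i. u0 i + c j * zcol n Z j i)"
    using c assms(1,2) by (auto simp: u0_def zcol_def fun_eq_iff)
  ultimately show ?thesis by (rule that)
qed

lemma zcol_mem_colspace:
  assumes "finite m" "j \<in> m"
  shows "zcol n Z j \<in> colspace n Z m"
proof -
  have "zcol n Z j \<in> colspace n Z {j}"
    by (auto simp: colspace_def zcol_def intro!: exI[of _ "\<lambda>_. 1"])
  then show ?thesis using colspace_mono[of m "{j}"] assms by blast
qed

text \<open>Equality holds as functions on all of \<open>nat\<close>, since members of
  \<open>colspace\<close> vanish beyond the first \<open>n\<close> coordinates; this makes the
  \<open>THE\<close> in \<open>proj\<close> well defined.\<close>

lemma is_proj_unique: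
  assumes "is_proj n Z m v w" "is_proj n Z m v w'"
  shows "w = w'"
proof -
  define d where "d = (\<lambda>i. w i - w' i)"
  have d: "d \<in> colspace n Z m" using assms colspace_diff by (auto simp: is_proj_def d_def)
  then have "innern n (\<lambda>i. v i - w' i) d - innern n (\<lambda>i. v i - w i) d = 0"
    using assms by (auto simp: is_proj_def)
  then have "innern n d d = 0"
    by (simp add: innern_linear d_def)
  then have "\<forall>i<n. d i = 0" by (simp add: innern_self sqnorm_eq_0_iff)
  moreover have "\<forall>i\<ge>n. d i = 0" using d by (auto simp: colspace_def)
  ultimately show ?thesis by (metis d_def eq_iff_diff_eq_0 ext linorder_not_less)
qed

lemma proj_eqI: "is_proj n Z m v w \<Longrightarrow> proj n Z m v = w"
  unfolding proj_def by (rule the_equality) (auto simp: is_proj_def intro: is_proj_unique)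

text \<open>One Gram-Schmidt step: the new column is replaced by its residual \<open>r\<close>,
  which spans the same extension and is orthogonal to the old column space. A linearly dependent
  column gives \<open>r\<close> = 0 and leaves the projection unchanged.\<close>

lemma is_proj_insert:
  assumes m: "finite m" "j \<notin> m" and w: "is_proj n Z m v w" and c: "is_proj n Z m (zcol n Z j) c"
    and r: "r = (\<lambda>i. zcol n Z j i - c i)"
  shows "is_proj n Z (insert j m) v (\<lambda>i. w i + innern n r v / sqnorm n r * r i)"
proof -
  define k where "k = innern n r v / sqnorm n r"
  have sub: "colspace n Z m \<subseteq> colspace n Z (insert j m)"
    using m by (intro colspace_mono) auto
  have rmem: "r \<in> colspace n Z (insert j m)"
    unfolding r using m c sub by (intro colspace_diff zcol_mem_colspace) (auto simp: is_proj_def)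
  have mem: "(\<lambda>i. w i + k * r i) \<in> colspace n Z (insert j m)"
    using rmem w sub by (intro colspace_add colspace_scale) (auto simp: is_proj_def)
  have r0: "innern n r u = 0" if "u \<in> colspace n Z m" for u
    using c that by (auto simp: is_proj_def r)
  have "innern n (\<lambda>i. v i - (w i + k * r i)) u = 0" if u: "u \<in> colspace n Z (insert j m)" for u
  proof -
    obtain u0 a where u0: "u0 \<in> colspace n Z m" and ue: "u = (\<lambda>i. u0 i + a * zcol n Z j i)"
      using colspace_insert_decomp[OF m u] .
    \<comment> \<open>Regrouping along \<open>r\<close> instead of the raw column splits the test
      vector into two orthogonal pieces, each tested separately.\<close>
    define u1 where "u1 = (\<lambda>i. u0 i + a * c i)"
    have u1: "u1 \<in> colspace n Z m"
      unfolding u1_def using u0 c by (intro colspace_add colspace_scale) (auto simp: is_proj_def)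
    have ue': "u = (\<lambda>i. u1 i + a * r i)"
      by (auto simp: ue u1_def r algebra_simps)
    \<comment> \<open>For \<open>r\<close> = 0 both sides vanish, whatever value the division in
      \<open>k\<close> has.\<close>
    have kr: "k * sqnorm n r = innern n v r"
    proof (cases "sqnorm n r = 0")
      case True
      then have "innern n v r = 0" by (intro innern_zero_right) (simp add: sqnorm_eq_0_iff)
      then show ?thesis using True by simp
    qed (simp add: k_def innern_commute)
    have "innern n (\<lambda>i. v i - w i) u1 = 0" using w u1 by (auto simp: is_proj_def)
    moreover have "innern n w r = 0" using r0 w by (auto simp: is_proj_def innern_commute[of n w])
    ultimately show ?thesis using r0[OF u1] kr
      by (simp add: ue' innern_linear innern_self innern_commute[of n r] algebra_simps)
  qed
  then show ?thesis using mem by (auto simp: is_proj_def k_def)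
qed

lemma ex_is_proj: "finite m \<Longrightarrow> \<exists>w. is_proj n Z m v w"
\<comment> \<open>The vector is kept general because the step projects both \<open>v\<close> and the
  new column onto the old span.\<close>
proof (induction m arbitrary: v rule: finite_induct)
  case empty
  have "is_proj n Z {} v (\<lambda>_. 0)"
    by (auto simp: is_proj_def colspace_def innern_def)
  then show ?case by blast
next
  case (insert j m)
  then show ?case using is_proj_insert[of m j] by meson
qed

lemma is_proj_proj: "finite m \<Longrightarrow> is_proj n Z m v (proj n Z m v)"
  using ex_is_proj proj_eqI by metis

lemma proj_mem: "finite m \<Longrightarrow> proj n Z m v \<in> colspace n Z m"
  using is_proj_proj by (auto simp: is_proj_def)

lemma resid_orthogonal: "finite m \<Longrightarrow> u \<in> colspace n Z m \<Longrightarrow> innern n (resid n Z m v) u = 0"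
  using is_proj_proj by (auto simp: is_proj_def resid_def)

lemma proj_insert:
  assumes "finite m" "j \<notin> m" and r: "r = resid n Z m (zcol n Z j)"
  shows "proj n Z (insert j m) v = (\<lambda>i. proj n Z m v i + innern n r v / sqnorm n r * r i)"
  by (rule proj_eqI, rule is_proj_insert[OF assms(1,2) is_proj_proj is_proj_proj])
    (use assms in \<open>auto simp: resid_def\<close>)

lemma proj_empty: "proj n Z {} v = (\<lambda>_. 0)"
  by (rule proj_eqI) (auto simp: is_proj_def colspace_def innern_def)

lemma colspace_cong:
  "(\<And>i j. i < n \<Longrightarrow> j \<in> m \<Longrightarrow> Z i j = Z' i j) \<Longrightarrow> colspace n Z m = colspace n Z' m"
  by (simp add: colspace_def)

text \<open>The projection sees only entries with row index below \<open>n\<close> and column index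
  in \<open>m\<close>. Hence restricting the data by \<open>vecRV\<close> and \<open>matRV\<close>,
  on which independence is stated, or appending a further column does not change it.\<close>

lemma proj_cong:
  assumes "\<And>i j. i < n \<Longrightarrow> j \<in> m \<Longrightarrow> Z i j = Z' i j" "\<And>i. i < n \<Longrightarrow> v i = v' i"
  shows "proj n Z m v = proj n Z' m v'"
proof -
  have "innern n (\<lambda>i. v i - w i) u = innern n (\<lambda>i. v' i - w i) u" for w u
    using assms(2) by (intro innern_cong) auto
  then show ?thesis
    using colspace_cong[OF assms(1)] unfolding proj_def by simp
qed

lemma proj_linear:
  assumes "finite m"
  shows "proj n Z m (\<lambda>i. a * v i + b * w i) = (\<lambda>i. a * proj n Z m v i + b * proj n Z m w i)"
proof (rule proj_eqI)
  have "innern n (\<lambda>i. a * v i + b * w i - (a * proj n Z m v i + b * proj n Z m w i)) u = 0"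
    if "u \<in> colspace n Z m" for u
  proof -
    have "a * innern n (resid n Z m v) u + b * innern n (resid n Z m w) u = 0"
      using assms that by (simp add: resid_orthogonal)
    then show ?thesis by (simp add: resid_def innern_linear algebra_simps)
  qed
  then show "is_proj n Z m (\<lambda>i. a * v i + b * w i) (\<lambda>i. a * proj n Z m v i + b * proj n Z m w i)"
    using assms proj_mem by (auto simp: is_proj_def intro!: colspace_add colspace_scale)
qed

lemma proj_add:
  "finite m \<Longrightarrow> proj n Z m (\<lambda>i. v i + w i) = (\<lambda>i. proj n Z m v i + proj n Z m w i)"
  using proj_linear[of m n Z 1 v 1 w] by simp

lemma innern_proj_right:
  assumes "finite m"
  shows "innern n v (proj n Z m w) = innern n (proj n Z m v) (proj n Z m w)"
  using resid_orthogonal[OF assms proj_mem[OF assms, of n Z w], of v]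
  by (simp add: resid_def innern_linear)

lemma sqnorm_resid:
  assumes "finite m"
  shows "sqnorm n (resid n Z m v) = sqnorm n v - sqnorm n (proj n Z m v)"
  using innern_proj_right[OF assms, of n v Z v] by (simp add: resid_def sqnorm_diff innern_self)

lemma sqnorm_resid_le:
  assumes "finite m" "u \<in> colspace n Z m"
  shows "sqnorm n (resid n Z m v) \<le> sqnorm n (\<lambda>i. v i - u i)"
proof -
  define d where "d = (\<lambda>i. proj n Z m v i - u i)"
  have "d \<in> colspace n Z m" unfolding d_def using assms proj_mem by (intro colspace_diff) auto
  then have "innern n (resid n Z m v) d = 0" using assms resid_orthogonal by simp
  moreover have "(\<lambda>i. v i - u i) = (\<lambda>i. resid n Z m v i + d i)"
    by (auto simp: resid_def d_def)
  ultimately show ?thesis by (simp add: sqnorm_add)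
qed

text \<open>Allows a sparse set of size s to be enlarged to the model size u of the estimator
  without loss of approximation.\<close>

lemma sqnorm_resid_antimono:
  assumes "finite m'" "m \<subseteq> m'"
  shows "sqnorm n (resid n Z m' v) \<le> sqnorm n (resid n Z m v)"
proof -
  have "finite m" using assms finite_subset by blast
  then have "proj n Z m v \<in> colspace n Z m'" using proj_mem colspace_mono[OF assms] by blast
  from sqnorm_resid_le[OF assms(1) this] show ?thesis by (simp add: resid_def)
qed

text \<open>Pythagoras for the Gram-Schmidt step: adding a column adds the square of one linear
  functional. For a dependent column the quotient is 0 / 0 = 0.\<close>

lemma sqnorm_proj_insert:
  assumes "finite m" "j \<notin> m" and r: "r = resid n Z m (zcol n Z j)"
  shows "sqnorm n (proj n Z (insert j m) v) = sqnorm n (proj n Z m v) + (innern n r v)\<^sup>2 / sqnorm n r"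
proof -
  have "innern n r (proj n Z m v) = 0" unfolding r using assms resid_orthogonal proj_mem by simp
  then show ?thesis
    unfolding proj_insert[OF assms] sqnorm_add innern_linear innern_commute[of n _ r] sqnorm_scale
    by (simp add: power2_eq_square)
qed

text \<open>The \<open>THE\<close> in \<open>proj\<close> says nothing about measurability, but the
  Gram-Schmidt recursion builds each coordinate from the entries by sums, products and quotients.
  Division is Borel on all reals, so rank changes between sample points are harmless.\<close>

lemma borel_measurable_proj:
  assumes "finite m"
    and "\<And>i j. i < n \<Longrightarrow> j \<in> m \<Longrightarrow> (\<lambda>x. Z x i j) \<in> borel_measurable M"
    and "\<And>i. i < n \<Longrightarrow> (\<lambda>x. v x i) \<in> borel_measurable M"
  shows "(\<lambda>x. proj n (Z x) m (v x) i) \<in> borel_measurable M"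
  using assms
proof (induction m arbitrary: v i rule: finite_induct)
  case empty
  then show ?case by (simp add: proj_empty)
next
  case (insert j m)
  have IH: "(\<lambda>x. proj n (Z x) m (v x) i) \<in> borel_measurable M"
    if "\<And>i. i < n \<Longrightarrow> (\<lambda>x. v x i) \<in> borel_measurable M" for v i
    using insert that by auto
  have zc: "(\<lambda>x. zcol n (Z x) j i) \<in> borel_measurable M" for i
    using insert.prems by (cases "i < n") (simp_all add: zcol_def)
  have r: "(\<lambda>x. resid n (Z x) m (zcol n (Z x) j) i) \<in> borel_measurable M" for i
    unfolding resid_def using zc IH by (intro borel_measurable_diff) auto
  show ?case
    unfolding proj_insert[OF insert.hyps refl] innern_def sqnorm_def
    by (intro borel_measurable_add borel_measurable_times borel_measurable_divide
        borel_measurable_sum borel_measurable_power r IH) (use insert.prems in auto)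
qed

subsection \<open>Exponential weights\<close>

text \<open>The weights form a Gibbs distribution, so \<open>E m\<close> equals -\<alpha> ln
  \<open>D\<close> - \<alpha> ln (\<open>w m\<close>). Its average is the free energy -\<alpha> ln
  \<open>D\<close>, at most \<open>E S\<close>, plus \<alpha> times the entropy of the weights, at
  most that of the uniform distribution.\<close>

lemma gibbs_average_le:
  fixes E :: "'b \<Rightarrow> real"
  assumes fin: "finite I" and S: "S \<in> I" and \<alpha>: "\<alpha> > 0"
    and w: "\<And>m. w m = exp (- E m / \<alpha>) / (\<Sum>k\<in>I. exp (- E k / \<alpha>))"
  shows "(\<Sum>m\<in>I. w m * E m) \<le> E S + \<alpha> * ln (card I)"
proof -
  define D where "D = (\<Sum>k\<in>I. exp (- E k / \<alpha>))"
  have SD: "exp (- E S / \<alpha>) \<le> D"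
    unfolding D_def using fin S by (intro member_le_sum) auto
  then have D: "D > 0" by (meson exp_gt_zero less_le_trans)
  have "ln (exp (- E S / \<alpha>)) \<le> ln D" using SD D by (subst ln_le_cancel_iff) auto
  then have lnD: "- \<alpha> * ln D \<le> E S" using \<alpha> by (simp add: field_simps)
  have N: "real (card I) > 0" using fin S by (auto simp: card_gt_0_iff)
  have wpos: "w m > 0" for m using D by (simp add: w D_def)
  have wsum: "(\<Sum>m\<in>I. w m) = 1" using D by (simp add: w D_def flip: sum_divide_distrib)
  have w': "w m = exp (- E m / \<alpha>) / D" for m by (simp add: w D_def)
  have E: "E m = - \<alpha> * ln D - \<alpha> * ln (w m)" for m
    using D \<alpha> by (simp add: w' ln_div field_simps)
  \<comment> \<open>From ln x <= x - 1 at x = 1 / (w N), with N the number of models; the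
    corrections 1 / N - w cancel in the sum.\<close>
  have le: "- w m * ln (w m) \<le> w m * ln (card I) + (1 / card I - w m)" for m
  proof -
    have "ln (1 / (w m * card I)) \<le> 1 / (w m * card I) - 1"
      using wpos N by (intro ln_le_minus_one) simp
    then have "w m * (- ln (w m) - ln (card I)) \<le> w m * (1 / (w m * card I) - 1)"
      using wpos[of m] N by (intro mult_left_mono) (auto simp: ln_div ln_mult)
    then show ?thesis using wpos[of m] by (simp add: field_simps)
  qed
  have "(\<Sum>m\<in>I. - w m * ln (w m)) \<le> (\<Sum>m\<in>I. w m * ln (card I) + (1 / card I - w m))"
    by (intro sum_mono le)
  also have "\<dots> = ln (card I)"
    using N by (simp add: sum.distrib sum_subtractf wsum flip: sum_distrib_right)
  finally have ent: "(\<Sum>m\<in>I. - w m * ln (w m)) \<le> ln (card I)" .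
  have "(\<Sum>m\<in>I. w m * E m) = (\<Sum>m\<in>I. w m * (- \<alpha> * ln D) + \<alpha> * (- w m * ln (w m)))"
    by (intro sum.cong refl) (subst E, simp add: algebra_simps)
  also have "\<dots> = - \<alpha> * ln D + \<alpha> * (\<Sum>m\<in>I. - w m * ln (w m))"
    by (simp only: sum.distrib wsum sum_distrib_left[symmetric] sum_distrib_right[symmetric])
  finally show ?thesis using lnD mult_left_mono[OF ent, of \<alpha>] \<alpha> by linarith
qed

text \<open>Jensen's inequality for the square: the difference of the two sides is the weighted
  variance.\<close>

lemma square_average_le:
  fixes x :: "'b \<Rightarrow> real"
  assumes "\<And>m. m \<in> I \<Longrightarrow> w m \<ge> 0" "(\<Sum>m\<in>I. w m) = 1"
  shows "(\<Sum>m\<in>I. w m * x m)\<^sup>2 \<le> (\<Sum>m\<in>I. w m * (x m)\<^sup>2)"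
proof -
  define a where "a = (\<Sum>m\<in>I. w m * x m)"
  have "0 \<le> (\<Sum>m\<in>I. w m * (x m - a)\<^sup>2)" using assms by (intro sum_nonneg) auto
  also have "\<dots> = (\<Sum>m\<in>I. w m * (x m)\<^sup>2 - 2 * a * (w m * x m) + a\<^sup>2 * w m)"
    by (intro sum.cong) (auto simp: power2_eq_square algebra_simps)
  also have "\<dots> = (\<Sum>m\<in>I. w m * (x m)\<^sup>2) - 2 * a * a + a\<^sup>2"
    by (simp add: sum.distrib sum_subtractf sum_distrib_left[symmetric] assms(2) flip: a_def)
  finally show ?thesis by (simp add: a_def power2_eq_square)
qed

lemma finite_subsets: "finite (subsets p u)"
  by (rule finite_subset[of _ "Pow {..<p}"]) (auto simp: subsets_def)

lemma finite_of_subsets: "m \<in> subsets p u \<Longrightarrow> finite m"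
  by (auto simp: subsets_def intro: finite_subset)

lemma card_subsets: "card (subsets p u) = p choose u"
  using n_subsets[of "{..<p}" u] by (simp add: subsets_def)

text \<open>Adjoining \<open>f\<close> to the design matrix as column \<open>p\<close> lets one projection control both \<open>P\<^sub>m v\<close> and
  the component of \<open>v\<close> along \<open>P\<^sub>m\<^sup>\<bottom> f\<close>.\<close>

definition augment :: "nat \<Rightarrow> (nat \<Rightarrow> nat \<Rightarrow> real) \<Rightarrow> (nat \<Rightarrow> real) \<Rightarrow> nat \<Rightarrow> nat \<Rightarrow> real" where
  "augment p Z f = (\<lambda>i j. if j = p then f i else Z i j)"

definition augproj :: "nat \<Rightarrow> nat \<Rightarrow> (nat \<Rightarrow> nat \<Rightarrow> real) \<Rightarrow> (nat \<Rightarrow> real) \<Rightarrow> nat set \<Rightarrow> (nat \<Rightarrow> real) \<Rightarrow> real" where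
  "augproj n p Z f m v = sqnorm n (proj n (augment p Z f) (insert p m) v)"

text \<open>Index \<open>p\<close> lies outside every \<open>m\<close> in
  \<open>subsets p u\<close>, so the column \<open>f\<close> is appended by one Gram-Schmidt step,
  whose direction is the residual of \<open>f\<close>.\<close>

lemma augproj_eq:
  assumes m: "m \<in> subsets p u"
  shows "augproj n p Z f m v = sqnorm n (proj n Z m v)
           + (innern n v (resid n Z m f))\<^sup>2 / sqnorm n (resid n Z m f)"
proof -
  let ?W = "augment p Z f"
  have fin: "finite m" using m by (rule finite_of_subsets)
  have p: "p \<notin> m" using m by (auto simp: subsets_def)
  define r where "r = resid n ?W m (zcol n ?W p)"
  have 1: "proj n ?W m v = proj n Z m v" for v
    using p by (intro proj_cong) (auto simp: augment_def)
  have 2: "proj n Z m (zcol n ?W p) = proj n Z m f"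
    by (intro proj_cong) (auto simp: zcol_def augment_def)
  have r: "r i = resid n Z m f i" if "i < n" for i
    using that by (simp add: r_def resid_def 1 2) (simp add: zcol_def augment_def)
  show ?thesis
    unfolding augproj_def sqnorm_proj_insert[OF fin p r_def] 1
    using sqnorm_cong[of n r, OF r] innern_cong[of n r _ v v, OF r] by (simp add: innern_commute)
qed

lemma sqnorm_proj_le_augproj:
  "m \<in> subsets p u \<Longrightarrow> sqnorm n (proj n Z m v) \<le> augproj n p Z f m v"
  by (simp add: augproj_eq)

lemma innern_resid_le_augproj:
  assumes m: "m \<in> subsets p u"
  shows "(innern n v (resid n Z m f))\<^sup>2 \<le> sqnorm n (resid n Z m f) * augproj n p Z f m v"
\<comment> \<open>If \<open>f\<close> lies in the span of \<open>m\<close>, the quotient in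
  \<open>augproj_eq\<close> is 0 and carries no information; the left side is then 0 by
  Cauchy-Schwarz.\<close>
proof (cases "sqnorm n (resid n Z m f) = 0")
  case True
  then show ?thesis using innern_Cauchy_Schwarz[of n v "resid n Z m f"] by simp
next
  case False
  then have "sqnorm n (resid n Z m f) > 0" using sqnorm_nonneg by (metis less_eq_real_def)
  then show ?thesis by (simp add: augproj_eq[OF m] field_simps)
qed

text \<open>The arithmetic-geometric mean with a weight: \<open>c\<close> decides how much of the
  bias \<open>y\<close> is spent, 1/2 where the bias must absorb the cross term and 1
  elsewhere.\<close>

lemma abs_mult_le_of_square_le:
  fixes x y b c :: real
  assumes "x\<^sup>2 \<le> y * b" "0 \<le> y" "0 \<le> b" "0 < c"
  shows "2 * \<bar>x\<bar> \<le> c * y + b / c"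
proof -
  have "\<bar>x\<bar> \<le> sqrt (y * b)" using assms by (simp add: real_le_rsqrt)
  also have "sqrt (y * b) = sqrt ((c * y) * (b / c))" using assms by simp
  also have "\<dots> \<le> (c * y + b / c) / 2" using assms by (intro arith_geo_mean_sqrt) auto
  finally show ?thesis by simp
qed

lemma augproj_nonneg [simp]: "0 \<le> augproj n p Z f m v"
  by (simp add: augproj_def)

lemma innern_sum_right: "innern n v (\<lambda>i. \<Sum>m\<in>I. g m i) = (\<Sum>m\<in>I. innern n v (g m))"
  unfolding innern_def sum_distrib_left by (rule sum.swap)

section \<open>Deterministic error bounds under uniform control of the noise\<close>

context
  fixes n p u :: nat and Z :: "nat \<Rightarrow> nat \<Rightarrow> real" and f \<xi> V :: "nat \<Rightarrow> real"
    and \<alpha> B D :: real and S :: "nat set"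
  assumes V: "V = (\<lambda>i. f i + \<xi> i)"
    and \<alpha>: "\<alpha> > 0"
    and S: "S \<in> subsets p u" and D: "sqnorm n (resid n Z S f) \<le> D"
    and B: "\<And>m. m \<in> subsets p u \<Longrightarrow> augproj n p Z f m \<xi> \<le> B"
begin

private abbreviation (input) "w \<equiv> expweight n p Z u \<alpha> V"
private abbreviation (input) "F \<equiv> (\<lambda>m. sqnorm n (resid n Z m f))"

private lemma w_nonneg: "w m \<ge> 0"
  by (simp add: expweight_def sum_nonneg)

private lemma w_sum: "(\<Sum>m\<in>subsets p u. w m) = 1"
proof -
  have "(\<Sum>m\<in>subsets p u. exp (- sqnorm n (resid n Z m V) / \<alpha>)) > 0"
    using S finite_subsets by (intro sum_pos) auto
  then show ?thesis unfolding expweight_def sum_divide_distrib[symmetric] by simp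
qed

text \<open>The large term \<open>sqnorm n \<xi>\<close> is common to all models and cancels when
  two of them are compared; the cross term and the projected noise are controlled through
  \<open>B\<close>.\<close>

private lemma sqnorm_resid_V:
  assumes m: "m \<in> subsets p u"
  shows "sqnorm n (resid n Z m V) =
    F m + 2 * innern n \<xi> (resid n Z m f) + sqnorm n \<xi> - sqnorm n (proj n Z m \<xi>)"
proof -
  have fin: "finite m" using m finite_of_subsets by blast
  have "innern n (resid n Z m f) (proj n Z m \<xi>) = 0"
    using fin resid_orthogonal proj_mem by blast
  moreover have "resid n Z m V = (\<lambda>i. resid n Z m f i + resid n Z m \<xi> i)"
    by (simp add: V resid_def proj_add[OF fin] fun_eq_iff)
  moreover have "innern n (resid n Z m f) (resid n Z m \<xi>) =
      innern n (resid n Z m f) \<xi> - innern n (resid n Z m f) (proj n Z m \<xi>)"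
    by (simp add: resid_def[of n Z m \<xi>] innern_linear)
  ultimately show ?thesis
    by (simp add: sqnorm_add sqnorm_resid[OF fin, of _ _ \<xi>] innern_commute)
qed

text \<open>Half of the bias \<open>F m\<close> absorbs the cross term, so the residual of each
  model is at least \<open>F m / 2\<close> - 3 \<open>B\<close> + |\<xi>|^2, while that of
  \<open>S\<close> is at most 3/2 \<open>D\<close> + 2 \<open>B\<close> + |\<xi>|^2. The Gibbs
  inequality compares the two; doubling, to solve for \<open>F m\<close>, gives the
  constants.\<close>

private lemma average_resid_le:
  "(\<Sum>m\<in>subsets p u. w m * F m) \<le> 3 * D + 10 * B + 2 * \<alpha> * ln (card (subsets p u))"
proof -
  let ?E = "\<lambda>m. sqnorm n (resid n Z m V)"
  have cross: "2 * \<bar>innern n \<xi> (resid n Z m f)\<bar> \<le> F m / 2 + 2 * B" if m: "m \<in> subsets p u" for m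
  proof -
    have "2 * \<bar>innern n \<xi> (resid n Z m f)\<bar> \<le> 1/2 * F m + augproj n p Z f m \<xi> / (1/2)"
      by (rule abs_mult_le_of_square_le[OF innern_resid_le_augproj[OF m]]) auto
    then show ?thesis using B[OF m] by simp
  qed
  have lower: "F m / 2 \<le> ?E m + (3 * B - sqnorm n \<xi>)" if m: "m \<in> subsets p u" for m
    using cross[OF m] sqnorm_resid_V[OF m] B[OF m] sqnorm_proj_le_augproj[OF m, of n Z \<xi> f] by linarith
  have upper: "?E S \<le> 3/2 * D + 2 * B + sqnorm n \<xi>"
    using cross[OF S] sqnorm_resid_V[OF S] D sqnorm_nonneg[of n "proj n Z S \<xi>"] by linarith
  have "(\<Sum>m\<in>subsets p u. w m * (F m / 2)) \<le> (\<Sum>m\<in>subsets p u. w m * (?E m + (3 * B - sqnorm n \<xi>)))"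
    using lower w_nonneg by (intro sum_mono mult_left_mono) auto
  also have "\<dots> = (\<Sum>m\<in>subsets p u. w m * ?E m) + (3 * B - sqnorm n \<xi>)"
    by (simp add: distrib_left sum.distrib w_sum flip: sum_distrib_right)
  also have "(\<Sum>m\<in>subsets p u. w m * ?E m) \<le> ?E S + \<alpha> * ln (card (subsets p u))"
    by (rule gibbs_average_le[OF finite_subsets S \<alpha>]) (simp add: expweight_def)
  finally have "(\<Sum>m\<in>subsets p u. w m * (F m / 2)) \<le> 3/2 * D + 5 * B + \<alpha> * ln (card (subsets p u))"
    using upper by linarith
  moreover have "(\<Sum>m\<in>subsets p u. w m * (F m / 2)) = (\<Sum>m\<in>subsets p u. w m * F m) / 2"
    by (simp add: sum_divide_distrib)
  ultimately show ?thesis by simp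
qed

text \<open>Because the weights sum to 1, the error is an average over models of bias minus
  projected noise.\<close>

private lemma diff_fhat:
  "f i - fhat n p Z u \<alpha> V i = (\<Sum>m\<in>subsets p u. w m * (resid n Z m f i - proj n Z m \<xi> i))"
proof -
  have "f i - fhat n p Z u \<alpha> V i = (\<Sum>m\<in>subsets p u. w m * f i) - fhat n p Z u \<alpha> V i"
    by (simp add: w_sum flip: sum_distrib_right)
  also have "\<dots> = (\<Sum>m\<in>subsets p u. w m * f i - w m * proj n Z m V i)"
    unfolding fhat_def sum_subtractf ..
  also have "\<dots> = (\<Sum>m\<in>subsets p u. w m * (resid n Z m f i - proj n Z m \<xi> i))"
    by (intro sum.cong refl) (simp add: V resid_def proj_add finite_of_subsets algebra_simps)
  finally show ?thesis .
qed

text \<open>By Jensen the squared error is at most the averaged squared error of the single models,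
  in which bias and projected noise are orthogonal; the latter adds one \<open>B\<close> to the 10
  of the averaged bias.\<close>

lemma sqnorm_diff_fhat_le:
  "sqnorm n (\<lambda>i. f i - fhat n p Z u \<alpha> V i) \<le> 3 * D + 11 * B + 2 * \<alpha> * ln (card (subsets p u))"
proof -
  have "sqnorm n (\<lambda>i. f i - fhat n p Z u \<alpha> V i)
      \<le> (\<Sum>i<n. \<Sum>m\<in>subsets p u. w m * (resid n Z m f i - proj n Z m \<xi> i)\<^sup>2)"
    unfolding sqnorm_def diff_fhat using w_nonneg w_sum by (intro sum_mono square_average_le) auto
  also have "\<dots> = (\<Sum>m\<in>subsets p u. w m * sqnorm n (\<lambda>i. resid n Z m f i - proj n Z m \<xi> i))"
    unfolding sqnorm_def sum_distrib_left by (rule sum.swap)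
  also have "\<dots> \<le> (\<Sum>m\<in>subsets p u. w m * F m + w m * B)"
  proof (intro sum_mono)
    fix m assume m: "m \<in> subsets p u"
    then have "innern n (resid n Z m f) (proj n Z m \<xi>) = 0"
      using finite_of_subsets resid_orthogonal proj_mem by blast
    then have "sqnorm n (\<lambda>i. resid n Z m f i - proj n Z m \<xi> i) \<le> F m + B"
      using B[OF m] sqnorm_proj_le_augproj[OF m, of n Z \<xi> f] by (simp add: sqnorm_diff)
    from mult_left_mono[OF this w_nonneg[of m]]
    show "w m * sqnorm n (\<lambda>i. resid n Z m f i - proj n Z m \<xi> i) \<le> w m * F m + w m * B"
      by (simp add: distrib_left)
  qed
  also have "\<dots> = (\<Sum>m\<in>subsets p u. w m * F m) + B"
    by (simp add: sum.distrib w_sum flip: sum_distrib_right)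
  finally show ?thesis using average_resid_le by linarith
qed

text \<open>Cauchy-Schwarz would bring in the full norm of \<open>\<zeta>\<close>. Instead each
  model contributes a bias term, controlled by the augmented column, and an inner product of two
  projections, controlled by their squared norms; this adds 3 \<open>B\<close>. The vector
  \<open>\<zeta>\<close> may differ from the noise \<open>\<xi>\<close> in \<open>V\<close>, since
  an error is tested against both noises of the model.\<close>

lemma innern_diff_fhat_le:
  assumes \<zeta>: "\<And>m. m \<in> subsets p u \<Longrightarrow> augproj n p Z f m \<zeta> \<le> B"
  shows "2 * \<bar>innern n \<zeta> (\<lambda>i. f i - fhat n p Z u \<alpha> V i)\<bar>
    \<le> 3 * D + 13 * B + 2 * \<alpha> * ln (card (subsets p u))"
proof -
  have "innern n \<zeta> (\<lambda>i. f i - fhat n p Z u \<alpha> V i) =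
      (\<Sum>m\<in>subsets p u. w m * innern n \<zeta> (\<lambda>i. resid n Z m f i - proj n Z m \<xi> i))"
    unfolding diff_fhat innern_sum_right innern_scale_right ..
  then have "2 * \<bar>innern n \<zeta> (\<lambda>i. f i - fhat n p Z u \<alpha> V i)\<bar> \<le>
      2 * (\<Sum>m\<in>subsets p u. w m * \<bar>innern n \<zeta> (\<lambda>i. resid n Z m f i - proj n Z m \<xi> i)\<bar>)"
    using sum_abs[of "\<lambda>m. w m * innern n \<zeta> (\<lambda>i. resid n Z m f i - proj n Z m \<xi> i)" "subsets p u"]
    by (simp add: abs_mult w_nonneg)
  also have "\<dots> = (\<Sum>m\<in>subsets p u. w m * (2 * \<bar>innern n \<zeta> (\<lambda>i. resid n Z m f i - proj n Z m \<xi> i)\<bar>))"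
    by (simp add: sum_distrib_left algebra_simps)
  also have "\<dots> \<le> (\<Sum>m\<in>subsets p u. w m * (F m + 3 * B))"
  proof (intro sum_mono mult_left_mono w_nonneg)
    fix m assume m: "m \<in> subsets p u"
    then have fin: "finite m" using finite_of_subsets by blast
    have "2 * \<bar>innern n \<zeta> (resid n Z m f)\<bar> \<le> 1 * F m + augproj n p Z f m \<zeta> / 1"
      by (rule abs_mult_le_of_square_le[OF innern_resid_le_augproj[OF m]]) auto
    moreover have "2 * \<bar>innern n \<zeta> (proj n Z m \<xi>)\<bar> \<le> sqnorm n (proj n Z m \<zeta>) + sqnorm n (proj n Z m \<xi>)"
      using innern_proj_right[OF fin, of n \<zeta> Z \<xi>] innern_le_sqnorm by metis
    moreover have "\<bar>innern n \<zeta> (\<lambda>i. resid n Z m f i - proj n Z m \<xi> i)\<bar> \<le>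
        \<bar>innern n \<zeta> (resid n Z m f)\<bar> + \<bar>innern n \<zeta> (proj n Z m \<xi>)\<bar>"
      unfolding innern_diff_right by (rule abs_triangle_ineq4)
    ultimately show "2 * \<bar>innern n \<zeta> (\<lambda>i. resid n Z m f i - proj n Z m \<xi> i)\<bar> \<le> F m + 3 * B"
      using B[OF m] \<zeta>[OF m] sqnorm_proj_le_augproj[OF m, of n Z \<xi> f]
        sqnorm_proj_le_augproj[OF m, of n Z \<zeta> f]
      by linarith
  qed
  also have "\<dots> = (\<Sum>m\<in>subsets p u. w m * F m) + 3 * B"
    by (simp add: distrib_left sum.distrib w_sum flip: sum_distrib_right)
  finally show ?thesis using average_resid_le by linarith
qed

end

subsection \<open>Exponential moments of projected sub-Gaussian vectors\<close>

lemma nn_integral_normal_density: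
  assumes "\<sigma> > 0"
  shows "(\<integral>\<^sup>+x. ennreal (normal_density \<mu> \<sigma> x) \<partial>lborel) = 1"
  using assms by (subst nn_integral_eq_integral) auto

lemma nn_integral_std_normal_exp_linear:
  "(\<integral>\<^sup>+x. ennreal (std_normal_density x * exp (t * x)) \<partial>lborel) = ennreal (exp (t\<^sup>2 / 2))"
proof -
  have "std_normal_density x * exp (t * x) = exp (t\<^sup>2 / 2) * normal_density t 1 x" for x
    by (simp add: normal_density_def flip: exp_add) (simp add: power2_eq_square field_simps)
  then show ?thesis
    by (simp add: ennreal_mult nn_integral_cmult nn_integral_normal_density)
qed

text \<open>The coefficient 1/4 halves the 1/2 of the Gaussian exponent and leaves a normal density
  of variance 2: hence the factor \<open>sqrt 2\<close>, incurred once per column below.\<close>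

lemma nn_integral_std_normal_exp_quadratic:
  "(\<integral>\<^sup>+x. ennreal (std_normal_density x * exp (c * x + x\<^sup>2 / 4)) \<partial>lborel) = ennreal (sqrt 2 * exp (c\<^sup>2))"
proof -
  have "std_normal_density x * exp (c * x + x\<^sup>2 / 4) = sqrt 2 * exp (c\<^sup>2) * normal_density (2 * c) (sqrt 2) x" for x
  proof -
    have "c * x + x\<^sup>2 / 4 + - (x\<^sup>2 / 2) = c\<^sup>2 + - ((x - 2 * c)\<^sup>2 / 4)"
      by (simp add: power2_eq_square field_simps)
    then have "exp (- (x\<^sup>2 / 2)) * exp (c * x + x\<^sup>2 / 4) = exp (c\<^sup>2) * exp (- ((x - 2 * c)\<^sup>2 / 4))"
      by (simp flip: exp_add add: add.commute)
    moreover have "1 / sqrt (2 * pi) = sqrt 2 / sqrt (2 * pi * 2)"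
      by (simp add: real_sqrt_mult field_simps)
    ultimately show ?thesis
      by (simp add: normal_density_def)
  qed
  then show ?thesis
    by (simp add: ennreal_mult nn_integral_cmult nn_integral_normal_density)
qed

text \<open>Only exponential moments of linear functionals are assumed, so the coordinates of the
  projection may be dependent and non-Gaussian. The linear term with \<open>b\<close> strengthens
  the induction, because linearising the square of the new coordinate tilts \<open>b\<close>. The
  right side is the exact value for N(0, K I) and linearly independent columns: along each projected
  direction the quadratic term doubles the variance \<open>K\<close> and costs
  \<open>sqrt 2\<close>.\<close>

lemma nn_integral_exp_proj_le:
  fixes \<zeta> :: "'a \<Rightarrow> nat \<Rightarrow> real"
  assumes M: "prob_space M"
    and meas [measurable]: "\<And>i. i < n \<Longrightarrow> (\<lambda>\<omega>. \<zeta> \<omega> i) \<in> borel_measurable M"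
    and K: "K > 0"
    and mgf: "\<And>a. (\<integral>\<^sup>+\<omega>. ennreal (exp (innern n a (\<zeta> \<omega>))) \<partial>M) \<le> ennreal (exp (K / 2 * sqnorm n a))"
    and fin: "finite m"
  shows "(\<integral>\<^sup>+\<omega>. ennreal (exp (innern n b (\<zeta> \<omega>) + sqnorm n (proj n Z m (\<zeta> \<omega>)) / (4 * K))) \<partial>M)
     \<le> ennreal (sqrt 2 ^ card m * exp (K / 2 * sqnorm n (resid n Z m b) + K * sqnorm n (proj n Z m b)))"
  using fin
proof (induction m arbitrary: b rule: finite_induct)
  case empty
  show ?case using mgf[of b] by (simp add: proj_empty resid_def) (simp add: sqnorm_def)
next
  case (insert j m)
  interpret prob_space M by fact
  interpret P: pair_sigma_finite M "lborel :: real measure" ..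
  define r where "r = resid n Z m (zcol n Z j)"
  \<comment> \<open>A unit vector, or 0 if the new column depends on the old ones; hence only
    \<open>sqnorm n q \<le> 1\<close> below.\<close>
  define q where "q = (\<lambda>i. 1 / sqrt (sqnorm n r) * r i)"
  \<comment> \<open>Chosen so that (s x)^2 / 2 = x^2 / (4 K), the exponent that averaging over
    \<open>g\<close> has to reproduce.\<close>
  define s where "s = sqrt (1 / (2 * K))"
  have s2: "s\<^sup>2 = 1 / (2 * K)" using K by (simp add: s_def)
  have q_orth: "innern n q u = 0" if "u \<in> colspace n Z m" for u
    using that insert.hyps unfolding q_def innern_scale_left r_def by (simp add: resid_orthogonal)
  have q_le: "sqnorm n q \<le> 1"
    unfolding q_def sqnorm_scale by (simp add: power_divide)
  have proj_q: "proj n Z m q = (\<lambda>_. 0)"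
  proof (rule proj_eqI)
    have "(\<lambda>_. 0) \<in> colspace n Z m"
      by (auto simp: colspace_def intro!: exI[of _ "\<lambda>_. 0"])
    then show "is_proj n Z m q (\<lambda>_. 0)" by (simp add: is_proj_def q_orth)
  qed
  have step: "sqnorm n (proj n Z (insert j m) v) = sqnorm n (proj n Z m v) + (innern n q v)\<^sup>2" for v
    unfolding sqnorm_proj_insert[OF insert.hyps r_def] q_def innern_scale_left
    by (simp add: power_mult_distrib power_divide)
  have shift: "sqnorm n (proj n Z m (\<lambda>i. b i + s * g * q i)) = sqnorm n (proj n Z m b)"
    "sqnorm n (resid n Z m (\<lambda>i. b i + s * g * q i)) \<le>
      sqnorm n (resid n Z m b) + 2 * s * g * innern n q b + g\<^sup>2 / (2 * K)" for g
  proof -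
    have pr: "proj n Z m (\<lambda>i. b i + s * g * q i) = proj n Z m b"
      using proj_linear[OF insert.hyps(1), of n Z 1 b "s * g" q] by (simp add: proj_q)
    then show "sqnorm n (proj n Z m (\<lambda>i. b i + s * g * q i)) = sqnorm n (proj n Z m b)" by simp
    have "innern n (resid n Z m b) q = innern n q b - innern n q (proj n Z m b)"
      unfolding resid_def innern_diff_left by (simp add: innern_commute)
    then have rq: "innern n (resid n Z m b) q = innern n q b"
      using q_orth proj_mem[OF insert.hyps(1)] by simp
    have "resid n Z m (\<lambda>i. b i + s * g * q i) = (\<lambda>i. resid n Z m b i + s * g * q i)"
      by (simp add: resid_def pr fun_eq_iff)
    then have "sqnorm n (resid n Z m (\<lambda>i. b i + s * g * q i)) =
        sqnorm n (resid n Z m b) + 2 * (s * g * innern n q b) + (s * g)\<^sup>2 * sqnorm n q"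
      by (simp add: sqnorm_add innern_scale_right rq sqnorm_scale)
    also have "(s * g)\<^sup>2 * sqnorm n q \<le> (s * g)\<^sup>2 * 1" using q_le by (intro mult_left_mono) auto
    finally show "sqnorm n (resid n Z m (\<lambda>i. b i + s * g * q i)) \<le>
      sqnorm n (resid n Z m b) + 2 * s * g * innern n q b + g\<^sup>2 / (2 * K)"
      by (simp add: power_mult_distrib s2)
  qed
  have [measurable]: "(\<lambda>\<omega>. innern n v (\<zeta> \<omega>)) \<in> borel_measurable M" for v
    unfolding innern_def by (intro borel_measurable_sum borel_measurable_times) auto
  have [measurable]: "(\<lambda>\<omega>. sqnorm n (proj n Z m (\<zeta> \<omega>))) \<in> borel_measurable M"
    unfolding sqnorm_def
    by (intro borel_measurable_sum borel_measurable_power borel_measurable_proj insert.hyps) auto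
  let ?T = "\<lambda>\<omega>. sqnorm n (proj n Z m (\<zeta> \<omega>)) / (4 * K)"
  let ?A = "K / 2 * sqnorm n (resid n Z m b) + K * sqnorm n (proj n Z m b)"
  let ?C = "sqrt 2 ^ card m"
  \<comment> \<open>The square of the new coordinate becomes an average, over an auxiliary standard
    Gaussian \<open>g\<close>, of exponentials that are linear in it.\<close>
  have "(\<integral>\<^sup>+\<omega>. ennreal (exp (innern n b (\<zeta> \<omega>) + sqnorm n (proj n Z (insert j m) (\<zeta> \<omega>)) / (4 * K))) \<partial>M)
    = (\<integral>\<^sup>+\<omega>. \<integral>\<^sup>+g. ennreal (std_normal_density g * exp (s * innern n q (\<zeta> \<omega>) * g))
          * ennreal (exp (innern n b (\<zeta> \<omega>) + ?T \<omega>)) \<partial>lborel \<partial>M)"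
  proof (intro nn_integral_cong)
    fix \<omega>
    have "(s * innern n q (\<zeta> \<omega>))\<^sup>2 / 2 = (innern n q (\<zeta> \<omega>))\<^sup>2 / (4 * K)"
      by (simp add: power_mult_distrib s2)
    moreover have "(\<integral>\<^sup>+g. ennreal (std_normal_density g * exp (s * innern n q (\<zeta> \<omega>) * g))
          * ennreal (exp (innern n b (\<zeta> \<omega>) + ?T \<omega>)) \<partial>lborel)
        = ennreal (exp ((s * innern n q (\<zeta> \<omega>))\<^sup>2 / 2)) * ennreal (exp (innern n b (\<zeta> \<omega>) + ?T \<omega>))"
      by (subst nn_integral_multc) (simp_all only: nn_integral_std_normal_exp_linear, measurable)
    ultimately show "ennreal (exp (innern n b (\<zeta> \<omega>) + sqnorm n (proj n Z (insert j m) (\<zeta> \<omega>)) / (4 * K)))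
      = (\<integral>\<^sup>+g. ennreal (std_normal_density g * exp (s * innern n q (\<zeta> \<omega>) * g))
          * ennreal (exp (innern n b (\<zeta> \<omega>) + ?T \<omega>)) \<partial>lborel)"
      by (simp add: step add_divide_distrib algebra_simps flip: ennreal_mult exp_add)
  qed
  \<comment> \<open>For fixed \<open>g\<close> the tilt joins \<open>b\<close>, so after exchanging
    the integrals the induction hypothesis applies with \<open>b\<close> replaced by b + s g
    q.\<close>
  also have "\<dots> = (\<integral>\<^sup>+g. \<integral>\<^sup>+\<omega>. ennreal (std_normal_density g * exp (s * innern n q (\<zeta> \<omega>) * g))
          * ennreal (exp (innern n b (\<zeta> \<omega>) + ?T \<omega>)) \<partial>M \<partial>lborel)"
    by (rule P.Fubini'[symmetric]) measurable
  also have "\<dots> = (\<integral>\<^sup>+g. ennreal (std_normal_density g) *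
      (\<integral>\<^sup>+\<omega>. ennreal (exp (innern n (\<lambda>i. b i + s * g * q i) (\<zeta> \<omega>) + ?T \<omega>)) \<partial>M) \<partial>lborel)"
  proof (intro nn_integral_cong)
    fix g
    have "ennreal (std_normal_density g * exp (s * innern n q (\<zeta> \<omega>) * g)) * ennreal (exp (innern n b (\<zeta> \<omega>) + ?T \<omega>))
      = ennreal (std_normal_density g) * ennreal (exp (innern n (\<lambda>i. b i + s * g * q i) (\<zeta> \<omega>) + ?T \<omega>))" for \<omega>
      by (simp add: innern_add_left innern_scale_left exp_add algebra_simps flip: ennreal_mult)
    then show "(\<integral>\<^sup>+\<omega>. ennreal (std_normal_density g * exp (s * innern n q (\<zeta> \<omega>) * g))
          * ennreal (exp (innern n b (\<zeta> \<omega>) + ?T \<omega>)) \<partial>M) = ennreal (std_normal_density g) *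
      (\<integral>\<^sup>+\<omega>. ennreal (exp (innern n (\<lambda>i. b i + s * g * q i) (\<zeta> \<omega>) + ?T \<omega>)) \<partial>M)"
      by (simp add: nn_integral_cmult)
  qed
  also have "\<dots> \<le> (\<integral>\<^sup>+g. ennreal (std_normal_density g) * ennreal (?C *
      exp (?A + (K * s * innern n q b) * g + g\<^sup>2 / 4)) \<partial>lborel)"
  proof (intro nn_integral_mono mult_left_mono)
    fix g
    have "(\<integral>\<^sup>+\<omega>. ennreal (exp (innern n (\<lambda>i. b i + s * g * q i) (\<zeta> \<omega>) + ?T \<omega>)) \<partial>M)
      \<le> ennreal (?C * exp (K / 2 * sqnorm n (resid n Z m (\<lambda>i. b i + s * g * q i)) +
            K * sqnorm n (proj n Z m (\<lambda>i. b i + s * g * q i))))"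
      by (rule insert.IH)
    also have "\<dots> \<le> ennreal (?C * exp (?A + (K * s * innern n q b) * g + g\<^sup>2 / 4))"
    proof (intro ennreal_leI mult_left_mono, simp only: exp_le_cancel_iff)
      have "K / 2 * sqnorm n (resid n Z m (\<lambda>i. b i + s * g * q i)) \<le>
        K / 2 * (sqnorm n (resid n Z m b) + 2 * s * g * innern n q b + g\<^sup>2 / (2 * K))"
        using K shift(2)[of g] by (intro mult_left_mono) auto
      also have "\<dots> = K / 2 * sqnorm n (resid n Z m b) + (K * s * innern n q b) * g + g\<^sup>2 / 4"
        using K by (simp add: field_simps)
      finally show "K / 2 * sqnorm n (resid n Z m (\<lambda>i. b i + s * g * q i)) +
            K * sqnorm n (proj n Z m (\<lambda>i. b i + s * g * q i))
          \<le> ?A + (K * s * innern n q b) * g + g\<^sup>2 / 4"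
        unfolding shift(1) by linarith
    qed simp
    finally show "(\<integral>\<^sup>+\<omega>. ennreal (exp (innern n (\<lambda>i. b i + s * g * q i) (\<zeta> \<omega>) + ?T \<omega>)) \<partial>M)
      \<le> ennreal (?C * exp (?A + (K * s * innern n q b) * g + g\<^sup>2 / 4))" .
  qed simp
  also have "\<dots> = (\<integral>\<^sup>+g. ennreal (?C * exp ?A) *
      ennreal (std_normal_density g * exp ((K * s * innern n q b) * g + g\<^sup>2 / 4)) \<partial>lborel)"
    by (intro nn_integral_cong) (simp add: exp_add algebra_simps flip: ennreal_mult)
  also have "\<dots> = ennreal (?C * exp ?A) * ennreal (sqrt 2 * exp ((K * s * innern n q b)\<^sup>2))"
    by (subst nn_integral_cmult) (simp_all add: nn_integral_std_normal_exp_quadratic)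
  also have "\<dots> = ennreal (sqrt 2 ^ Suc (card m) * exp (?A + (K * s * innern n q b)\<^sup>2))"
    by (simp add: exp_add flip: ennreal_mult)
  \<comment> \<open>Integrating over \<open>g\<close> yields exactly what raises the weight of
    \<open>(innern n q b)\<^sup>2\<close> from \<open>K / 2\<close> in the residual part to
    \<open>K\<close> in the projected part.\<close>
  also have "?A + (K * s * innern n q b)\<^sup>2 = K / 2 * sqnorm n (resid n Z (insert j m) b)
      + K * sqnorm n (proj n Z (insert j m) b)"
  proof -
    have "(K * s * innern n q b)\<^sup>2 = K / 2 * (innern n q b)\<^sup>2"
      using K unfolding power_mult_distrib s2 by (simp add: field_simps power2_eq_square)
    moreover have "sqnorm n (resid n Z (insert j m) b) = sqnorm n (resid n Z m b) - (innern n q b)\<^sup>2"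
      using insert.hyps by (simp add: sqnorm_resid step)
    ultimately show ?thesis unfolding step by (simp only: right_diff_distrib distrib_left)
  qed
  finally show ?case using insert.hyps by simp
qed

subsection \<open>Gaussian vectors\<close>

text \<open>Valid for every real \<open>v\<close>: if \<open>v\<close> is negative,
  \<open>sqrt v\<close> is minus \<open>sqrt \<bar>v\<bar>\<close>, and the density depends only on
  its square. The facts on \<open>normal_law\<close> below are thereby reduced to the standard
  normal.\<close>

lemma normal_law_conv_std_normal:
  "normal_law v = distr std_normal_distribution borel (\<lambda>x. sqrt \<bar>v\<bar> * x)"
proof -
  interpret S: prob_space std_normal_distribution
    using prob_space_normal_density[of 1 0] by simp
  show ?thesis
  proof (cases "v = 0")
    case True
    have "distr std_normal_distribution borel (\<lambda>x. 0 :: real) = return borel 0"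
      by (rule S.distr_const) auto
    then show ?thesis using True by (simp add: normal_law_def)
  next
    case False
    have "distributed std_normal_distribution lborel (\<lambda>x. x) (normal_density 0 1)"
      by (auto simp: distributed_def distr_id2)
    then have "distributed std_normal_distribution lborel (\<lambda>x. 0 + sqrt \<bar>v\<bar> * x)
        (normal_density (0 + sqrt \<bar>v\<bar> * 0) (\<bar>sqrt \<bar>v\<bar>\<bar> * 1))"
      using False by (intro S.normal_density_affine) auto
    then have "distr std_normal_distribution lborel (\<lambda>x. sqrt \<bar>v\<bar> * x) =
        density lborel (normal_density 0 (sqrt \<bar>v\<bar>))"
      by (simp add: distributed_def)
    moreover have "distr std_normal_distribution lborel (\<lambda>x. sqrt \<bar>v\<bar> * x) =
        distr std_normal_distribution borel (\<lambda>x. sqrt \<bar>v\<bar> * x)"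
      by (rule distr_cong) auto
    moreover have "(sqrt v)\<^sup>2 = \<bar>v\<bar>" by (simp add: real_sqrt_abs2 power2_eq_square flip: real_sqrt_mult)
    then have "normal_density 0 (sqrt \<bar>v\<bar>) = normal_density 0 (sqrt v)"
      by (simp add: normal_density_def fun_eq_iff)
    ultimately show ?thesis using False by (simp add: normal_law_def)
  qed
qed

section \<open>Exponential moments, characteristic function and even moments\<close>

context
  fixes M :: "'a measure" and X :: "'a \<Rightarrow> real" and v :: real
  assumes X [measurable]: "X \<in> borel_measurable M" and law: "distr M borel X = normal_law v"
begin

lemma normal_law_mgf: "(\<integral>\<^sup>+\<omega>. ennreal (exp (X \<omega>)) \<partial>M) = ennreal (exp (\<bar>v\<bar> / 2))"
proof -
  have "(\<integral>\<^sup>+\<omega>. ennreal (exp (X \<omega>)) \<partial>M) = (\<integral>\<^sup>+x. ennreal (exp x) \<partial>distr M borel X)"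
    by (simp add: nn_integral_distr)
  also have "\<dots> = (\<integral>\<^sup>+x. ennreal (std_normal_density x * exp (sqrt \<bar>v\<bar> * x)) \<partial>lborel)"
    unfolding law normal_law_conv_std_normal
    by (simp add: nn_integral_distr nn_integral_density ennreal_mult)
  finally show ?thesis by (simp add: nn_integral_std_normal_exp_linear)
qed

lemma normal_law_char: "(\<integral>\<omega>. iexp (X \<omega>) \<partial>M) = complex_of_real (exp (- \<bar>v\<bar> / 2))"
proof -
  have "(\<integral>\<omega>. iexp (X \<omega>) \<partial>M) = (\<integral>x. iexp x \<partial>distr M borel X)"
    by (simp add: integral_distr)
  also have "\<dots> = char std_normal_distribution (sqrt \<bar>v\<bar>)"
    unfolding law normal_law_conv_std_normal by (simp add: integral_distr char_def)
  finally show ?thesis by (simp add: char_std_normal_distribution)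
qed

lemma normal_law_even_moment:
  "integrable M (\<lambda>\<omega>. X \<omega> ^ (2 * k))"
  "(\<integral>\<omega>. X \<omega> ^ (2 * k) \<partial>M) = \<bar>v\<bar> ^ k * (fact (2 * k) / (2 ^ k * fact k))"
proof -
  have e: "(sqrt \<bar>v\<bar> * x) ^ (2 * k) = \<bar>v\<bar> ^ k * x ^ (2 * k)" for x
    by (simp add: power_mult_distrib power_mult)
  have "integrable (distr M borel X) (\<lambda>x. x ^ (2 * k))"
    unfolding law normal_law_conv_std_normal
    by (simp add: integrable_distr_eq e std_normal_distribution_even_moments del: mult_2)
  then show "integrable M (\<lambda>\<omega>. X \<omega> ^ (2 * k))" by (simp add: integrable_distr_eq)
  have "(\<integral>\<omega>. X \<omega> ^ (2 * k) \<partial>M) = (\<integral>x. x ^ (2 * k) \<partial>distr M borel X)"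
    by (simp add: integral_distr)
  also have "\<dots> = \<bar>v\<bar> ^ k * (fact (2 * k) / (2 ^ k * fact k))"
    unfolding law normal_law_conv_std_normal
    by (simp add: integral_distr e std_normal_distribution_even_moments)
  finally show "(\<integral>\<omega>. X \<omega> ^ (2 * k) \<partial>M) = \<bar>v\<bar> ^ k * (fact (2 * k) / (2 ^ k * fact k))" .
qed

lemma normal_law_moment2: "integrable M (\<lambda>\<omega>. (X \<omega>)\<^sup>2)" "(\<integral>\<omega>. (X \<omega>)\<^sup>2 \<partial>M) = \<bar>v\<bar>"
  using normal_law_even_moment[of 1] by (simp_all add: fact_numeral)

lemma normal_law_moment4: "integrable M (\<lambda>\<omega>. X \<omega> ^ 4)" "(\<integral>\<omega>. X \<omega> ^ 4 \<partial>M) = 3 * v\<^sup>2"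
  using normal_law_even_moment[of 2] by (simp_all add: fact_numeral)

end

section \<open>Coordinates and squared norm of a Gaussian vector\<close>

lemma sum_two_coordinates:
  fixes f :: "nat \<Rightarrow> real"
  assumes "i < n" "j < n"
  shows "(\<Sum>k<n. (of_bool (k = i) + c * of_bool (k = j)) * f k) = f i + c * f j"
  using assms by (simp add: distrib_right sum.distrib mult.assoc of_bool_def if_distrib[of "\<lambda>x. x * _"]
      sum.delta flip: sum_distrib_left cong: if_cong)

context
  fixes M :: "'a measure" and n :: nat and X :: "'a \<Rightarrow> nat \<Rightarrow> real" and Sig :: "nat \<Rightarrow> nat \<Rightarrow> real"
  assumes M: "prob_space M"
    and X [measurable]: "\<And>i. i < n \<Longrightarrow> (\<lambda>\<omega>. X \<omega> i) \<in> borel_measurable M"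
    and gauss: "gaussian_vec M n Sig X"
begin

lemma gaussian_vec_law:
  "distr M borel (\<lambda>\<omega>. innern n a (X \<omega>)) = normal_law (innern n a (\<lambda>i. \<Sum>j<n. Sig i j * a j))"
  using gauss by (simp add: gaussian_vec_def innern_def sum_distrib_left mult.assoc)

lemma borel_measurable_innern_gaussian [measurable]: "(\<lambda>\<omega>. innern n a (X \<omega>)) \<in> borel_measurable M"
  unfolding innern_def by (intro borel_measurable_sum borel_measurable_times) auto

lemma gaussian_pair_law:
  assumes i: "i < n" and j: "j < n"
  shows "distr M borel (\<lambda>\<omega>. X \<omega> i + c * X \<omega> j) =
    normal_law (Sig i i + c * Sig i j + c * Sig j i + c\<^sup>2 * Sig j j)"
proof -
  \<comment> \<open>Written with two indicators so that \<open>i = j\<close> is covered: the entries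
    then add up.\<close>
  define a where "a = (\<lambda>k. of_bool (k = i) + c * of_bool (k = j) :: real)"
  have *: "innern n a f = f i + c * f j" for f
    unfolding innern_def a_def by (rule sum_two_coordinates[OF i j])
  have "(\<Sum>l<n. Sig k l * a l) = Sig k i + c * Sig k j" for k
    using *[of "Sig k"] by (simp add: innern_def mult.commute)
  then show ?thesis using gaussian_vec_law[of a] by (simp add: * power2_eq_square algebra_simps)
qed

text \<open>\<open>gaussian_vec\<close> speaks only of linear combinations, so the mixed moment is
  obtained from their fourth moments by polarisation: 12 x^2 y^2 = (x + y)^4 + (x - y)^4 - 2 x^4 - 2
  y^4.\<close>

lemma gaussian_square_product:
  assumes i: "i < n" and j: "j < n" and sym: "Sig i j = Sig j i"
  shows "integrable M (\<lambda>\<omega>. (X \<omega> i)\<^sup>2 * (X \<omega> j)\<^sup>2)"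
    and "(\<integral>\<omega>. (X \<omega> i)\<^sup>2 * (X \<omega> j)\<^sup>2 \<partial>M) = Sig i i * Sig j j + 2 * (Sig i j)\<^sup>2"
proof -
  let ?h = "\<lambda>c \<omega>. X \<omega> i + c * X \<omega> j"
  have meas: "?h c \<in> borel_measurable M" "(\<lambda>\<omega>. X \<omega> j + 0 * X \<omega> i) \<in> borel_measurable M" for c
    using i j by (auto intro!: borel_measurable_add borel_measurable_times)
  have p: "integrable M (\<lambda>\<omega>. ?h c \<omega> ^ 4)"
      "(\<integral>\<omega>. ?h c \<omega> ^ 4 \<partial>M) = 3 * (Sig i i + c * Sig i j + c * Sig j i + c\<^sup>2 * Sig j j)\<^sup>2" for c
    using normal_law_moment4[OF meas(1) gaussian_pair_law[OF i j]] by auto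
  have q: "integrable M (\<lambda>\<omega>. X \<omega> j ^ 4)" "(\<integral>\<omega>. X \<omega> j ^ 4 \<partial>M) = 3 * (Sig j j)\<^sup>2"
    using normal_law_moment4[OF meas(2) gaussian_pair_law[OF j i]] by auto
  have poly: "(X \<omega> i)\<^sup>2 * (X \<omega> j)\<^sup>2 =
      (?h 1 \<omega> ^ 4 + ?h (-1) \<omega> ^ 4 - 2 * ?h 0 \<omega> ^ 4 - 2 * X \<omega> j ^ 4) / 12" for \<omega>
    by (simp add: power4_eq_xxxx power2_eq_square algebra_simps)
  show "integrable M (\<lambda>\<omega>. (X \<omega> i)\<^sup>2 * (X \<omega> j)\<^sup>2)"
    unfolding poly using p(1)[of 1] p(1)[of "-1"] p(1)[of 0] q(1)
    by (intro integrable_divide Bochner_Integration.integrable_add Bochner_Integration.integrable_diff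
        integrable_mult_right)
  have "(\<integral>\<omega>. (X \<omega> i)\<^sup>2 * (X \<omega> j)\<^sup>2 \<partial>M) =
      ((\<integral>\<omega>. ?h 1 \<omega> ^ 4 \<partial>M) + (\<integral>\<omega>. ?h (-1) \<omega> ^ 4 \<partial>M) - 2 * (\<integral>\<omega>. ?h 0 \<omega> ^ 4 \<partial>M) - 2 * (\<integral>\<omega>. X \<omega> j ^ 4 \<partial>M)) / 12"
    unfolding poly using p(1)[of 1] p(1)[of "-1"] p(1)[of 0] q(1) by simp
  also have "\<dots> = Sig i i * Sig j j + 2 * (Sig i j)\<^sup>2"
    unfolding p(2) q(2) sym by (simp add: power2_eq_square algebra_simps)
  finally show "(\<integral>\<omega>. (X \<omega> i)\<^sup>2 * (X \<omega> j)\<^sup>2 \<partial>M) = Sig i i * Sig j j + 2 * (Sig i j)\<^sup>2" .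
qed

text \<open>\<^const>\<open>normal_law\<close> maps a negative \<open>v\<close> to the law with variance \<open>\<bar>v\<bar>\<close>, so
  \<^const>\<open>gaussian_vec\<close> alone does not make \<open>Sig\<close> positive semidefinite. A nonnegative trace is enough
  for the concentration bound.\<close>

lemma gaussian_sqnorm_concentration:
  assumes sym: "\<And>i j. i < n \<Longrightarrow> j < n \<Longrightarrow> Sig i j = Sig j i" and tr: "trace_n n Sig \<ge> 0" and e: "e > 0"
  shows "measure M {\<omega>\<in>space M. \<bar>sqnorm n (X \<omega>) - trace_n n Sig\<bar> \<ge> e} \<le> 2 * (\<Sum>i<n. \<Sum>j<n. (Sig i j)\<^sup>2) / e\<^sup>2"
proof -
  interpret prob_space M by (rule M)
  define T where "T = trace_n n Sig"
  have sq: "integrable M (\<lambda>\<omega>. (X \<omega> i)\<^sup>2)" "(\<integral>\<omega>. (X \<omega> i)\<^sup>2 \<partial>M) = \<bar>Sig i i\<bar>" if "i < n" for i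
    using normal_law_moment2[OF _ gaussian_pair_law[OF that that, of 0]] that by simp_all
  have int1: "integrable M (\<lambda>\<omega>. sqnorm n (X \<omega>))"
    unfolding sqnorm_def by (intro Bochner_Integration.integrable_sum sq) auto
  have e1: "(\<integral>\<omega>. sqnorm n (X \<omega>) \<partial>M) = (\<Sum>i<n. \<bar>Sig i i\<bar>)"
    unfolding sqnorm_def by (subst Bochner_Integration.integral_sum) (auto simp: sq)
  have sq2: "(sqnorm n (X \<omega>))\<^sup>2 = (\<Sum>i<n. \<Sum>j<n. (X \<omega> i)\<^sup>2 * (X \<omega> j)\<^sup>2)" for \<omega>
    by (simp add: sqnorm_def power2_eq_square[of "sum _ _"] sum_product)
  have int2: "integrable M (\<lambda>\<omega>. (sqnorm n (X \<omega>))\<^sup>2)"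
    unfolding sq2 using sym by (intro Bochner_Integration.integrable_sum gaussian_square_product) auto
  have "(\<integral>\<omega>. (sqnorm n (X \<omega>))\<^sup>2 \<partial>M) = (\<Sum>i<n. \<Sum>j<n. Sig i i * Sig j j + 2 * (Sig i j)\<^sup>2)"
  proof -
    have "(\<integral>\<omega>. (sqnorm n (X \<omega>))\<^sup>2 \<partial>M) = (\<Sum>i<n. \<integral>\<omega>. (\<Sum>j<n. (X \<omega> i)\<^sup>2 * (X \<omega> j)\<^sup>2) \<partial>M)"
      unfolding sq2 using sym
      by (intro Bochner_Integration.integral_sum Bochner_Integration.integrable_sum gaussian_square_product) auto
    also have "\<dots> = (\<Sum>i<n. \<Sum>j<n. \<integral>\<omega>. (X \<omega> i)\<^sup>2 * (X \<omega> j)\<^sup>2 \<partial>M)"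
      using sym by (intro sum.cong refl Bochner_Integration.integral_sum gaussian_square_product) auto
    also have "\<dots> = (\<Sum>i<n. \<Sum>j<n. Sig i i * Sig j j + 2 * (Sig i j)\<^sup>2)"
      using sym by (intro sum.cong refl gaussian_square_product) auto
    finally show ?thesis .
  qed
  also have "\<dots> = T\<^sup>2 + 2 * (\<Sum>i<n. \<Sum>j<n. (Sig i j)\<^sup>2)"
    using sum_product[of "\<lambda>i. Sig i i" "{..<n}" "\<lambda>i. Sig i i" "{..<n}"]
    by (simp add: T_def trace_n_def power2_eq_square[of "sum _ _"] sum.distrib flip: sum_distrib_left)
  finally have e2: "(\<integral>\<omega>. (sqnorm n (X \<omega>))\<^sup>2 \<partial>M) = T\<^sup>2 + 2 * (\<Sum>i<n. \<Sum>j<n. (Sig i j)\<^sup>2)" .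
  have exp: "(sqnorm n (X \<omega>) - T)\<^sup>2 = (sqnorm n (X \<omega>))\<^sup>2 - 2 * T * sqnorm n (X \<omega>) + T\<^sup>2" for \<omega>
    by (simp add: power2_eq_square algebra_simps)
  have int3: "integrable M (\<lambda>\<omega>. (sqnorm n (X \<omega>) - T)\<^sup>2)"
    unfolding exp using int1 int2 by auto
  have "(\<integral>\<omega>. (sqnorm n (X \<omega>) - T)\<^sup>2 \<partial>M) =
      T\<^sup>2 + 2 * (\<Sum>i<n. \<Sum>j<n. (Sig i j)\<^sup>2) - 2 * T * (\<Sum>i<n. \<bar>Sig i i\<bar>) + T\<^sup>2"
    unfolding exp using int1 int2 by (simp add: e1 e2 prob_space)
  \<comment> \<open>The mean is the sum of the \<open>\<bar>Sig i i\<bar>\<close>, which is at least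
    \<open>T\<close>; multiplying by \<open>T \<ge> 0\<close> shows that the cross term is at most
    -2 T^2.\<close>
  also have "\<dots> \<le> 2 * (\<Sum>i<n. \<Sum>j<n. (Sig i j)\<^sup>2)"
  proof -
    have "T \<le> (\<Sum>i<n. \<bar>Sig i i\<bar>)" unfolding T_def trace_n_def by (intro sum_mono) auto
    then have "T * T \<le> T * (\<Sum>i<n. \<bar>Sig i i\<bar>)" using tr by (intro mult_left_mono) (auto simp: T_def)
    then show ?thesis by (simp add: power2_eq_square)
  qed
  finally have var: "(\<integral>\<omega>. (sqnorm n (X \<omega>) - T)\<^sup>2 \<partial>M) \<le> 2 * (\<Sum>i<n. \<Sum>j<n. (Sig i j)\<^sup>2)" .
  have "e \<le> \<bar>y\<bar> \<longleftrightarrow> e\<^sup>2 \<le> y\<^sup>2" for y using e by (simp add: abs_le_square_iff[of e y, symmetric])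
  then have "measure M {\<omega>\<in>space M. \<bar>sqnorm n (X \<omega>) - T\<bar> \<ge> e} = measure M {\<omega>\<in>space M. (sqnorm n (X \<omega>) - T)\<^sup>2 \<ge> e\<^sup>2}"
    by simp
  also have "\<dots> \<le> (\<integral>\<omega>. (sqnorm n (X \<omega>) - T)\<^sup>2 \<partial>M) / e\<^sup>2"
    using e int3 by (intro integral_Markov_inequality_measure[where A = "{}"]) auto
  also have "\<dots> \<le> 2 * (\<Sum>i<n. \<Sum>j<n. (Sig i j)\<^sup>2) / e\<^sup>2"
    using var by (intro divide_right_mono) auto
  finally show ?thesis by (simp add: T_def)
qed

end

subsection \<open>The operator norm\<close>

text \<open>A real \<open>SUP\<close> is informative only for a set bounded above. Cauchy-Schwarz on
  each row bounds the image of the unit ball by the Frobenius norm.\<close>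

lemma opnorm_upper:
  assumes "sqnorm n a \<le> 1"
  shows "sqrt (sqnorm n (\<lambda>i. \<Sum>j<n. A i j * a j)) \<le> opnorm n A"
  unfolding opnorm_def
proof (rule cSUP_upper)
  show "bdd_above ((\<lambda>a. sqrt (sqnorm n (\<lambda>i. \<Sum>j<n. A i j * a j))) ` {a. sqnorm n a \<le> 1})"
  proof (rule bdd_aboveI2)
    fix a assume "a \<in> {a. sqnorm n a \<le> 1}"
    then have a: "sqnorm n a \<le> 1" by simp
    have "(\<Sum>j<n. A i j * a j)\<^sup>2 \<le> sqnorm n (A i)" for i
    proof -
      have "(\<Sum>j<n. A i j * a j)\<^sup>2 \<le> sqnorm n (A i) * sqnorm n a"
        using innern_Cauchy_Schwarz[of n "A i" a] by (simp add: innern_def)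
      also have "\<dots> \<le> sqnorm n (A i) * 1" using a by (intro mult_left_mono) auto
      finally show ?thesis by simp
    qed
    then show "sqrt (sqnorm n (\<lambda>i. \<Sum>j<n. A i j * a j)) \<le> sqrt (\<Sum>i<n. sqnorm n (A i))"
      unfolding sqnorm_def[of n "\<lambda>i. \<Sum>j<n. A i j * a j"] by (intro real_sqrt_le_mono sum_mono)
  qed
qed (use assms in auto)

lemma opnorm_nonneg: "0 \<le> opnorm n A"
proof -
  have "0 \<le> sqrt (sqnorm n (\<lambda>i. \<Sum>j<n. A i j * 0))" by simp
  also have "\<dots> \<le> opnorm n A" by (rule opnorm_upper) (simp add: sqnorm_def)
  finally show ?thesis .
qed

lemma sqnorm_matvec_le: "sqnorm n (\<lambda>i. \<Sum>j<n. A i j * a j) \<le> (opnorm n A)\<^sup>2 * sqnorm n a"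
proof (cases "sqnorm n a = 0")
  case True
  then have "\<And>i. (\<Sum>j<n. A i j * a j) = 0" by (simp add: sqnorm_eq_0_iff)
  then show ?thesis by (simp add: True) (simp add: sqnorm_def)
next
  case False
  then have pos: "sqnorm n a > 0" by (metis sqnorm_nonneg less_eq_real_def)
  define t where "t = 1 / sqrt (sqnorm n a)"
  have t2: "t\<^sup>2 = 1 / sqnorm n a" using pos by (simp add: t_def power_divide)
  have "sqnorm n (\<lambda>j. t * a j) \<le> 1" using pos by (simp add: sqnorm_scale t2)
  from opnorm_upper[OF this, of A] have "sqrt (sqnorm n (\<lambda>i. t * (\<Sum>j<n. A i j * a j))) \<le> opnorm n A"
    by (simp add: sum_distrib_left mult.left_commute)
  then have "sqnorm n (\<lambda>i. t * (\<Sum>j<n. A i j * a j)) \<le> (opnorm n A)\<^sup>2"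
    by (rule sqrt_le_D)
  then show ?thesis using pos by (simp add: sqnorm_scale t2 field_simps)
qed

lemma quadratic_form_le_opnorm:
  "\<bar>innern n a (\<lambda>i. \<Sum>j<n. A i j * a j)\<bar> \<le> opnorm n A * sqnorm n a"
proof -
  have "(innern n a (\<lambda>i. \<Sum>j<n. A i j * a j))\<^sup>2 \<le> sqnorm n a * ((opnorm n A)\<^sup>2 * sqnorm n a)"
    by (rule order_trans[OF innern_Cauchy_Schwarz]) (intro mult_left_mono sqnorm_matvec_le sqnorm_nonneg)
  also have "\<dots> = (opnorm n A * sqnorm n a)\<^sup>2" by (simp add: power2_eq_square)
  finally show ?thesis
    using opnorm_nonneg[of n A] by (simp add: abs_le_square_iff[symmetric])
qed

text \<open>Each of the \<open>n\<close> columns is the image of a unit vector. The left side is the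
  squared Frobenius norm, half the variance of the squared norm of a Gaussian vector with covariance
  \<open>A\<close>.\<close>

lemma sum_squares_le_opnorm: "(\<Sum>i<n. \<Sum>j<n. (A i j)\<^sup>2) \<le> real n * (opnorm n A)\<^sup>2"
proof -
  have "(\<Sum>i<n. \<Sum>j<n. (A i j)\<^sup>2) = (\<Sum>j<n. \<Sum>i<n. (A i j)\<^sup>2)" by (rule sum.swap)
  also have "\<dots> \<le> (\<Sum>j<n. (opnorm n A)\<^sup>2)"
  proof (intro sum_mono)
    fix j assume j: "j \<in> {..<n}"
    have "(\<Sum>k<n. A i k * of_bool (k = j)) = A i j" for i
      using j by (simp add: of_bool_def if_distrib[of "\<lambda>x. _ * x"] cong: if_cong)
    moreover have "sqnorm n (\<lambda>k. of_bool (k = j)) = 1"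
      using j by (simp add: sqnorm_def of_bool_def if_distrib[of "\<lambda>x. x\<^sup>2"] cong: if_cong)
    ultimately show "(\<Sum>i<n. (A i j)\<^sup>2) \<le> (opnorm n A)\<^sup>2"
      using sqnorm_matvec_le[of n A "\<lambda>k. of_bool (k = j)"] by (simp add: sqnorm_def)
  qed
  finally show ?thesis by simp
qed

text \<open>\<open>normal_law\<close> turns a negative quadratic form into its absolute value; the
  bound by the operator norm is two-sided and covers this.\<close>

lemma gaussian_vec_mgf_le:
  assumes "prob_space M" "\<And>i. i < n \<Longrightarrow> (\<lambda>\<omega>. X \<omega> i) \<in> borel_measurable M"
    and "gaussian_vec M n Sig X" and K: "opnorm n Sig \<le> K"
  shows "(\<integral>\<^sup>+\<omega>. ennreal (exp (innern n a (X \<omega>))) \<partial>M) \<le> ennreal (exp (K / 2 * sqnorm n a))"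
proof -
  have "opnorm n Sig * sqnorm n a \<le> K * sqnorm n a"
    using K by (intro mult_right_mono) auto
  then have "\<bar>innern n a (\<lambda>i. \<Sum>j<n. Sig i j * a j)\<bar> \<le> K * sqnorm n a"
    using quadratic_form_le_opnorm[of n a Sig] by linarith
  then show ?thesis
    by (subst normal_law_mgf[OF borel_measurable_innern_gaussian gaussian_vec_law])
      (use assms in \<open>auto intro!: ennreal_leI\<close>)
qed

subsection \<open>Events of probability tending to one\<close>

text \<open>Exceptional sets rather than events, so that \<open>P n\<close> itself need not be measurable.\<close>

definition whp :: "(nat \<Rightarrow> 'a measure) \<Rightarrow> (nat \<Rightarrow> 'a \<Rightarrow> bool) \<Rightarrow> bool" where
  "whp M P \<longleftrightarrow> (\<exists>A. (\<forall>n. A n \<in> sets (M n)) \<and> (\<lambda>n. measure (M n) (A n)) \<longlonglongrightarrow> 0 \<and>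
     (\<forall>\<^sub>F n in sequentially. \<forall>\<omega>\<in>space (M n) - A n. P n \<omega>))"

text \<open>Negligibility in probability at rate \<open>k\<close>, phrased through
  \<open>whp\<close>. For measurable \<open>T\<close> it agrees with \<open>smallOp\<close>, and
  bounds between random quantities can be passed on without proving each of them measurable.\<close>

definition negl :: "(nat \<Rightarrow> 'a measure) \<Rightarrow> (nat \<Rightarrow> 'a \<Rightarrow> real) \<Rightarrow> (nat \<Rightarrow> real) \<Rightarrow> bool" where
  "negl M T k \<longleftrightarrow> (\<forall>e>0. whp M (\<lambda>n \<omega>. \<bar>T n \<omega>\<bar> \<le> e * k n))"

lemma whp_mono:
  assumes "whp M P" "\<forall>\<^sub>F n in sequentially. \<forall>\<omega>\<in>space (M n). P n \<omega> \<longrightarrow> Q n \<omega>"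
  shows "whp M Q"
proof -
  obtain A where A: "\<forall>n. A n \<in> sets (M n)" "(\<lambda>n. measure (M n) (A n)) \<longlonglongrightarrow> 0"
    "\<forall>\<^sub>F n in sequentially. \<forall>\<omega>\<in>space (M n) - A n. P n \<omega>"
    using assms(1) by (auto simp: whp_def)
  from A(3) assms(2) have "\<forall>\<^sub>F n in sequentially. \<forall>\<omega>\<in>space (M n) - A n. Q n \<omega>"
    by eventually_elim auto
  with A show ?thesis by (auto simp: whp_def)
qed

lemma whp_conj:
  assumes "\<And>n. prob_space (M n)" "whp M P" "whp M Q"
  shows "whp M (\<lambda>n \<omega>. P n \<omega> \<and> Q n \<omega>)"
proof -
  obtain A where A: "\<forall>n. A n \<in> sets (M n)" "(\<lambda>n. measure (M n) (A n)) \<longlonglongrightarrow> 0"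
    "\<forall>\<^sub>F n in sequentially. \<forall>\<omega>\<in>space (M n) - A n. P n \<omega>"
    using assms(2) by (auto simp: whp_def)
  obtain B where B: "\<forall>n. B n \<in> sets (M n)" "(\<lambda>n. measure (M n) (B n)) \<longlonglongrightarrow> 0"
    "\<forall>\<^sub>F n in sequentially. \<forall>\<omega>\<in>space (M n) - B n. Q n \<omega>"
    using assms(3) by (auto simp: whp_def)
  have "(\<lambda>n. measure (M n) (A n \<union> B n)) \<longlonglongrightarrow> 0"
  proof (rule tendsto_sandwich[of "\<lambda>_. 0"])
    show "(\<lambda>n. measure (M n) (A n) + measure (M n) (B n)) \<longlonglongrightarrow> 0"
      using tendsto_add[OF A(2) B(2)] by simp
    show "\<forall>\<^sub>F n in sequentially. measure (M n) (A n \<union> B n) \<le> measure (M n) (A n) + measure (M n) (B n)"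
      using A(1) B(1) by (intro always_eventually allI measure_Un_le) auto
  qed auto
  moreover have "\<forall>\<^sub>F n in sequentially. \<forall>\<omega>\<in>space (M n) - (A n \<union> B n). P n \<omega> \<and> Q n \<omega>"
    using A(3) B(3) by eventually_elim auto
  ultimately show ?thesis
    using A(1) B(1) unfolding whp_def by (intro exI[of _ "\<lambda>n. A n \<union> B n"]) auto
qed

lemma whpI:
  assumes "\<forall>\<^sub>F n in sequentially. {\<omega>\<in>space (M n). \<not> P n \<omega>} \<in> sets (M n)"
    and "(\<lambda>n. measure (M n) {\<omega>\<in>space (M n). \<not> P n \<omega>}) \<longlonglongrightarrow> 0"
  shows "whp M P"
proof -
  \<comment> \<open>\<open>whp\<close> asks for measurable exceptional sets at every
    \<open>n\<close>, not only eventually; the default {} covers the finitely many others.\<close>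
  define A where "A = (\<lambda>n. if {\<omega>\<in>space (M n). \<not> P n \<omega>} \<in> sets (M n) then {\<omega>\<in>space (M n). \<not> P n \<omega>} else {})"
  have "\<forall>\<^sub>F n in sequentially. measure (M n) (A n) = measure (M n) {\<omega>\<in>space (M n). \<not> P n \<omega>}"
    using assms(1) by eventually_elim (simp add: A_def)
  then have "(\<lambda>n. measure (M n) (A n)) \<longlonglongrightarrow> 0"
    using assms(2) by (simp add: tendsto_cong)
  moreover have "\<forall>\<^sub>F n in sequentially. \<forall>\<omega>\<in>space (M n) - A n. P n \<omega>"
    using assms(1) by eventually_elim (simp add: A_def)
  ultimately show ?thesis unfolding whp_def by (intro exI[of _ A]) (auto simp: A_def)
qed

lemma whp_eventually: "\<forall>\<^sub>F n in sequentially. \<forall>\<omega>\<in>space (M n). P n \<omega> \<Longrightarrow> whp M P"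
  unfolding whp_def by (intro exI[of _ "\<lambda>_. {}"]) auto

lemma neglD: "negl M T k \<Longrightarrow> e > 0 \<Longrightarrow> whp M (\<lambda>n \<omega>. \<bar>T n \<omega>\<bar> \<le> e * k n)"
  by (simp add: negl_def)

lemma negl_mono:
  assumes "negl M T k" "\<forall>\<^sub>F n in sequentially. \<forall>\<omega>\<in>space (M n). \<bar>T' n \<omega>\<bar> \<le> T n \<omega>"
  shows "negl M T' k"
  unfolding negl_def
proof (intro allI impI)
  fix e :: real assume "e > 0"
  from neglD[OF assms(1) this] show "whp M (\<lambda>n \<omega>. \<bar>T' n \<omega>\<bar> \<le> e * k n)"
    by (rule whp_mono) (use assms(2) in eventually_elim, force)
qed

lemma negl_add:
  assumes "\<And>n. prob_space (M n)" "negl M S k" "negl M T k"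
  shows "negl M (\<lambda>n \<omega>. S n \<omega> + T n \<omega>) k"
  unfolding negl_def
proof (intro allI impI)
  fix e :: real assume "e > 0"
  then have "whp M (\<lambda>n \<omega>. \<bar>S n \<omega>\<bar> \<le> e / 2 * k n \<and> \<bar>T n \<omega>\<bar> \<le> e / 2 * k n)"
    using assms by (intro whp_conj neglD) auto
  then show "whp M (\<lambda>n \<omega>. \<bar>S n \<omega> + T n \<omega>\<bar> \<le> e * k n)"
    by (rule whp_mono) (rule always_eventually, auto)
qed

lemma negl_cmult:
  assumes "negl M T k"
  shows "negl M (\<lambda>n \<omega>. c * T n \<omega>) k"
  unfolding negl_def
proof (intro allI impI)
  fix e :: real assume "e > 0"
  \<comment> \<open>Dividing by \<open>\<bar>c\<bar> + 1\<close> instead of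
    \<open>\<bar>c\<bar>\<close> covers \<open>c = 0\<close>.\<close>
  then have "whp M (\<lambda>n \<omega>. \<bar>T n \<omega>\<bar> \<le> e / (\<bar>c\<bar> + 1) * k n)"
    using assms by (intro neglD) auto
  then show "whp M (\<lambda>n \<omega>. \<bar>c * T n \<omega>\<bar> \<le> e * k n)"
  proof (rule whp_mono, intro always_eventually allI ballI impI)
    fix n \<omega> assume T: "\<bar>T n \<omega>\<bar> \<le> e / (\<bar>c\<bar> + 1) * k n"
    have "\<bar>c * T n \<omega>\<bar> \<le> (\<bar>c\<bar> + 1) * \<bar>T n \<omega>\<bar>" by (simp add: abs_mult algebra_simps)
    also have "\<dots> \<le> (\<bar>c\<bar> + 1) * (e / (\<bar>c\<bar> + 1) * k n)" using T by (intro mult_left_mono) auto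
    also have "\<dots> = e * k n" by (simp add: add_nonneg_eq_0_iff)
    finally show "\<bar>c * T n \<omega>\<bar> \<le> e * k n" .
  qed
qed

lemma negl_of_smallo:
  assumes "a \<in> o(k)" "\<And>n. k n \<ge> 0"
  shows "negl M (\<lambda>n \<omega>. a n) k"
  unfolding negl_def
proof (intro allI impI whp_eventually)
  fix e :: real assume "e > 0"
  from landau_o.smallD[OF assms(1) this] show "\<forall>\<^sub>F n in sequentially. \<forall>\<omega>\<in>space (M n). \<bar>a n\<bar> \<le> e * k n"
    using assms(2) by (simp add: eventually_mono)
qed

lemma negl_of_smallOp:
  assumes "smallOp M T k" "\<forall>\<^sub>F n in sequentially. T n \<in> borel_measurable (M n)"
  shows "negl M T k"
  unfolding negl_def
proof (intro allI impI whpI)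
  fix e :: real assume "e > 0"
  then show "(\<lambda>n. measure (M n) {\<omega>\<in>space (M n). \<not> \<bar>T n \<omega>\<bar> \<le> e * k n}) \<longlonglongrightarrow> 0"
    using assms(1) by (simp add: smallOp_def not_le)
  show "\<forall>\<^sub>F n in sequentially. {\<omega>\<in>space (M n). \<not> \<bar>T n \<omega>\<bar> \<le> e * k n} \<in> sets (M n)"
    using assms(2) by eventually_elim measurable
qed

text \<open>Bounded convergence in probability when the probability space changes with
  \<open>n\<close>: the integrand is at most \<open>e / 2\<close> off the exceptional set and at
  most \<open>C\<close> on it.\<close>

lemma whp_integral_tendsto_0:
  fixes f :: "nat \<Rightarrow> 'a \<Rightarrow> complex"
  assumes M: "\<And>n. prob_space (M n)" and meas: "\<And>n. f n \<in> borel_measurable (M n)"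
    and bound: "\<And>n \<omega>. norm (f n \<omega>) \<le> C"
    and small: "\<And>e. e > 0 \<Longrightarrow> whp M (\<lambda>n \<omega>. norm (f n \<omega>) \<le> e)"
  shows "(\<lambda>n. \<integral>\<omega>. f n \<omega> \<partial>M n) \<longlonglongrightarrow> 0"
proof (rule LIMSEQ_I)
  fix e :: real assume e: "e > 0"
  obtain A where A: "\<forall>n. A n \<in> sets (M n)" "(\<lambda>n. measure (M n) (A n)) \<longlonglongrightarrow> 0"
    "\<forall>\<^sub>F n in sequentially. \<forall>\<omega>\<in>space (M n) - A n. norm (f n \<omega>) \<le> e / 2"
    using small[of "e / 2"] e by (auto simp: whp_def)
  have C: "C \<ge> 0" using bound order_trans[OF norm_ge_zero] by blast
  have "(\<lambda>n. C * measure (M n) (A n)) \<longlonglongrightarrow> C * 0" by (intro tendsto_intros A)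
  then have "\<forall>\<^sub>F n in sequentially. C * measure (M n) (A n) < e / 2"
    using e by (intro order_tendstoD(2)) auto
  with A(3) have "\<forall>\<^sub>F n in sequentially. norm (\<integral>\<omega>. f n \<omega> \<partial>M n) < e"
  proof eventually_elim
    case (elim n)
    interpret prob_space "M n" by (rule M)
    have An [measurable]: "A n \<in> sets (M n)" using A by blast
    have "norm (\<integral>\<omega>. f n \<omega> \<partial>M n) \<le> (\<integral>\<omega>. norm (f n \<omega>) \<partial>M n)"
      by (rule integral_norm_bound)
    also have "\<dots> \<le> (\<integral>\<omega>. e / 2 + C * indicator (A n) \<omega> \<partial>M n)"
    proof (rule integral_mono)
      show "integrable (M n) (\<lambda>\<omega>. norm (f n \<omega>))"
        using meas[of n] bound by (intro integrable_norm integrable_const_bound[of _ C]) auto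
      show "integrable (M n) (\<lambda>\<omega>. e / 2 + C * indicator (A n) \<omega>)"
        by (intro Bochner_Integration.integrable_add integrable_mult_right) (auto simp: emeasure_eq_measure)
      show "norm (f n \<omega>) \<le> e / 2 + C * indicator (A n) \<omega>" if "\<omega> \<in> space (M n)" for \<omega>
        using elim(1) bound[of n \<omega>] e that by (auto simp: indicator_def)
    qed
    also have "\<dots> = e / 2 + C * measure (M n) (A n)"
      by (subst Bochner_Integration.integral_add) (auto simp: prob_space emeasure_eq_measure)
    also have "\<dots> < e" using elim(2) by simp
    finally show ?case .
  qed
  then show "\<exists>no. \<forall>n\<ge>no. norm ((\<integral>\<omega>. f n \<omega> \<partial>M n) - 0) < e"
    by (simp add: eventually_sequentially)
qed

subsection \<open>Independence\<close>

lemma indep_rv_measurable: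
  assumes "indep_rv M N1 f N2 g"
  shows "f \<in> measurable M N1" "g \<in> measurable M N2"
  using assms by (auto simp: indep_rv_def)

text \<open>Turns independence of generated sigma-algebras into a product law, the form in which
  Fubini performs the conditioning.\<close>

lemma indep_rv_distr:
  assumes M: "prob_space M" and ind: "indep_rv M N1 f N2 g"
  shows "distr M N1 f \<Otimes>\<^sub>M distr M N2 g = distr M (N1 \<Otimes>\<^sub>M N2) (\<lambda>x. (f x, g x))"
proof -
  interpret prob_space M by fact
  note [measurable] = indep_rv_measurable[OF ind]
  interpret A: prob_space "distr M N1 f" by (rule prob_space_distr) simp
  interpret B: prob_space "distr M N2 g" by (rule prob_space_distr) simp
  show ?thesis
  proof (rule pair_measure_eqI)
    fix A B assume "A \<in> sets (distr M N1 f)" "B \<in> sets (distr M N2 g)"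
    then have [measurable]: "A \<in> sets N1" "B \<in> sets N2" by auto
    have "prob ((f -` A \<inter> space M) \<inter> (g -` B \<inter> space M)) = prob (f -` A \<inter> space M) * prob (g -` B \<inter> space M)"
      using ind by (intro indep_setD) (auto simp: indep_rv_def intro!: in_vimage_algebra)
    moreover have "(\<lambda>x. (f x, g x)) -` (A \<times> B) \<inter> space M = (f -` A \<inter> space M) \<inter> (g -` B \<inter> space M)"
      by auto
    ultimately show "emeasure (distr M N1 f) A * emeasure (distr M N2 g) B =
        emeasure (distr M (N1 \<Otimes>\<^sub>M N2) (\<lambda>x. (f x, g x))) (A \<times> B)"
      by (simp add: emeasure_distr emeasure_eq_measure ennreal_mult)
  qed (auto simp: A.sigma_finite_measure_axioms B.sigma_finite_measure_axioms)
qed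

lemma indep_rv_compose:
  assumes M: "prob_space M" and ind: "indep_rv M N1 f N2 g" and h: "h \<in> measurable N2 N3"
  shows "indep_rv M N1 f N3 (\<lambda>x. h (g x))"
proof -
  interpret prob_space M by fact
  note [measurable] = indep_rv_measurable[OF ind] h
  have gsp: "g \<in> space M \<rightarrow> space N2" using measurable_space[OF indep_rv_measurable(2)[OF ind]] by auto
  have hg: "(\<lambda>x. h (g x)) \<in> measurable M N3" by measurable
  have hgsp: "(\<lambda>x. h (g x)) \<in> space M \<rightarrow> space N3" using measurable_space[OF hg] by auto
  have "sets (vimage_algebra (space M) (\<lambda>x. h (g x)) N3) \<subseteq> sets (vimage_algebra (space M) g N2)"
  proof
    fix S assume "S \<in> sets (vimage_algebra (space M) (\<lambda>x. h (g x)) N3)"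
    then obtain B where B: "B \<in> sets N3" "S = (\<lambda>x. h (g x)) -` B \<inter> space M"
      using sets_vimage_algebra2[OF hgsp] by auto
    have S: "S = g -` (h -` B \<inter> space N2) \<inter> space M" using gsp by (auto simp: B(2))
    show "S \<in> sets (vimage_algebra (space M) g N2)"
      unfolding S using h B(1) by (intro in_vimage_algebra measurable_sets)
  qed
  moreover have "indep_set (sets (vimage_algebra (space M) f N1)) (sets (vimage_algebra (space M) g N2))"
    using ind by (simp add: indep_rv_def)
  ultimately have "indep_set (sets (vimage_algebra (space M) f N1))
      (sets (vimage_algebra (space M) (\<lambda>x. h (g x)) N3))"
    unfolding indep_set_def by (elim indep_sets_mono_sets) (auto split: bool.split)
  then show ?thesis using hg indep_rv_measurable[OF ind] by (simp add: indep_rv_def)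
qed

text \<open>Conditioning on \<open>Y\<close>: a bound for every frozen value \<open>y\<close>
  survives integration over the law of \<open>Y\<close>.\<close>

lemma nn_integral_indep_le:
  assumes M: "prob_space M" and ind: "indep_rv M N1 X N2 Y"
    and F [measurable]: "F \<in> borel_measurable (N1 \<Otimes>\<^sub>M N2)"
    and le: "\<And>y. y \<in> space N2 \<Longrightarrow> (\<integral>\<^sup>+\<omega>. F (X \<omega>, y) \<partial>M) \<le> c"
  shows "(\<integral>\<^sup>+\<omega>. F (X \<omega>, Y \<omega>) \<partial>M) \<le> c"
proof -
  interpret prob_space M by fact
  have [measurable]: "X \<in> measurable M N1" "Y \<in> measurable M N2"
    and eq: "distr M N1 X \<Otimes>\<^sub>M distr M N2 Y = distr M (N1 \<Otimes>\<^sub>M N2) (\<lambda>x. (X x, Y x))"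
    using indep_rv_measurable[OF ind] indep_rv_distr[OF M ind] by auto
  interpret A: prob_space "distr M N1 X" by (rule prob_space_distr) simp
  interpret B: prob_space "distr M N2 Y" by (rule prob_space_distr) simp
  interpret P: pair_sigma_finite "distr M N1 X" "distr M N2 Y" ..
  have "(\<integral>\<^sup>+\<omega>. F (X \<omega>, Y \<omega>) \<partial>M) = (\<integral>\<^sup>+z. F z \<partial>(distr M N1 X \<Otimes>\<^sub>M distr M N2 Y))"
    unfolding eq by (subst nn_integral_distr) auto
  also have "\<dots> = (\<integral>\<^sup>+y. \<integral>\<^sup>+x. F (x, y) \<partial>distr M N1 X \<partial>distr M N2 Y)"
    by (rule P.nn_integral_snd[symmetric]) measurable
  also have "\<dots> \<le> (\<integral>\<^sup>+y. c \<partial>distr M N2 Y)"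
    using le by (intro nn_integral_mono) (simp add: nn_integral_distr)
  also have "\<dots> = c" using B.emeasure_space_1 by simp
  finally show ?thesis .
qed

text \<open>The same conditioning for bounded complex integrands, as needed for characteristic
  functions.\<close>

lemma integral_indep:
  fixes F :: "'b \<times> 'c \<Rightarrow> complex"
  assumes M: "prob_space M" and ind: "indep_rv M N1 X N2 Y"
    and F [measurable]: "F \<in> borel_measurable (N1 \<Otimes>\<^sub>M N2)" and bound: "\<And>z. norm (F z) \<le> C"
    and eq: "\<And>y. y \<in> space N2 \<Longrightarrow> (\<integral>\<omega>. F (X \<omega>, y) \<partial>M) = G y" and G [measurable]: "G \<in> borel_measurable N2"
  shows "(\<integral>\<omega>. F (X \<omega>, Y \<omega>) \<partial>M) = (\<integral>\<omega>. G (Y \<omega>) \<partial>M)"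
proof -
  interpret prob_space M by fact
  have [measurable]: "X \<in> measurable M N1" "Y \<in> measurable M N2"
    and deq: "distr M N1 X \<Otimes>\<^sub>M distr M N2 Y = distr M (N1 \<Otimes>\<^sub>M N2) (\<lambda>x. (X x, Y x))"
    using indep_rv_measurable[OF ind] indep_rv_distr[OF M ind] by auto
  interpret A: prob_space "distr M N1 X" by (rule prob_space_distr) simp
  interpret B: prob_space "distr M N2 Y" by (rule prob_space_distr) simp
  interpret P: pair_prob_space "distr M N1 X" "distr M N2 Y" ..
  have int: "integrable (distr M N1 X \<Otimes>\<^sub>M distr M N2 Y) (\<lambda>(x, y). F (x, y))"
    using bound by (intro P.P.integrable_const_bound[of _ C]) auto
  have "(\<integral>\<omega>. F (X \<omega>, Y \<omega>) \<partial>M) = (\<integral>z. F z \<partial>(distr M N1 X \<Otimes>\<^sub>M distr M N2 Y))"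
    unfolding deq by (subst integral_distr) auto
  also have "\<dots> = (\<integral>y. (\<integral>x. F (x, y) \<partial>distr M N1 X) \<partial>distr M N2 Y)"
    using P.integral_snd[OF int] by simp
  also have "\<dots> = (\<integral>y. G y \<partial>distr M N2 Y)"
    using eq by (intro Bochner_Integration.integral_cong) (simp_all add: integral_distr)
  also have "\<dots> = (\<integral>\<omega>. G (Y \<omega>) \<partial>M)" by (simp add: integral_distr)
  finally show ?thesis .
qed

lemma vecRV_nth: "i < n \<Longrightarrow> vecRV n v i = v i"
  by (simp add: vecRV_def)

lemma borel_measurable_vecRV_nth:
  assumes "(\<lambda>\<omega>. vecRV n (v \<omega>)) \<in> measurable M (vecM n)" "i < n"
  shows "(\<lambda>\<omega>. v \<omega> i) \<in> borel_measurable M"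
proof -
  have "(\<lambda>\<omega>. vecRV n (v \<omega>) i) \<in> borel_measurable M"
    using assms by (intro measurable_compose[OF assms(1) measurable_component_singleton]) auto
  then show ?thesis using assms(2) by (simp add: vecRV_nth)
qed

lemma measurable_vecM_nth: "i < n \<Longrightarrow> (\<lambda>x. x i) \<in> borel_measurable (vecM n)"
  by (rule measurable_component_singleton) simp

text \<open>Given \<open>g\<close> the matrix is fixed, so the exponential moment applies with
  linear term 0, and Markov's inequality gives the tail. Measurability belongs to the conclusion
  because these sets are united over the models later.\<close>

lemma indep_proj_tail:
  assumes M: "prob_space M" and ind: "indep_rv M (vecM n) (\<lambda>\<omega>. vecRV n (\<zeta> \<omega>)) N g"
    and K: "K > 0"
    and mgf: "\<And>a. (\<integral>\<^sup>+\<omega>. ennreal (exp (innern n a (\<zeta> \<omega>))) \<partial>M) \<le> ennreal (exp (K / 2 * sqnorm n a))"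
    and W: "\<And>i j. i < n \<Longrightarrow> j \<in> m \<Longrightarrow> (\<lambda>y. W y i j) \<in> borel_measurable N"
    and fin: "finite m"
  shows "measure M {\<omega>\<in>space M. sqnorm n (proj n (W (g \<omega>)) m (\<zeta> \<omega>)) > t} \<le> sqrt 2 ^ card m * exp (- t / (4 * K))"
    and "{\<omega>\<in>space M. sqnorm n (proj n (W (g \<omega>)) m (\<zeta> \<omega>)) > t} \<in> sets M"
proof -
  interpret prob_space M by fact
  have rv: "(\<lambda>\<omega>. vecRV n (\<zeta> \<omega>)) \<in> measurable M (vecM n)" and g: "g \<in> measurable M N"
    using indep_rv_measurable[OF ind] indep_rv_distr[OF M ind] by auto
  note \<zeta> = borel_measurable_vecRV_nth[OF rv]
  define F where "F = (\<lambda>z. ennreal (exp (sqnorm n (proj n (W (snd z)) m (fst z)) / (4 * K))))"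
  have F: "F \<in> borel_measurable (vecM n \<Otimes>\<^sub>M N)"
  proof -
    have "(\<lambda>z. proj n (W (snd z)) m (fst z) i) \<in> borel_measurable (vecM n \<Otimes>\<^sub>M N)" for i
      using fin by (rule borel_measurable_proj)
        (auto intro!: measurable_compose[OF measurable_snd W] measurable_compose[OF measurable_fst measurable_vecM_nth])
    then show ?thesis unfolding F_def sqnorm_def by measurable
  qed
  have pr: "proj n Z m (vecRV n x) = proj n Z m x" for Z x
    by (rule proj_cong) (auto simp: vecRV_nth)
  have exp_le: "(\<integral>\<^sup>+\<omega>. F (vecRV n (\<zeta> \<omega>), g \<omega>) \<partial>M) \<le> ennreal (sqrt 2 ^ card m)"
  proof (rule nn_integral_indep_le[OF M ind F])
    fix y
    have [simp]: "proj n (W y) m (\<lambda>_. 0) = (\<lambda>_. 0)"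
      using proj_linear[OF fin, of n "W y" 0 _ 0] by simp
    show "(\<integral>\<^sup>+\<omega>. F (vecRV n (\<zeta> \<omega>), y) \<partial>M) \<le> ennreal (sqrt 2 ^ card m)"
      using nn_integral_exp_proj_le[OF M \<zeta> K mgf fin, of "\<lambda>_. 0" "W y"]
      by (simp add: F_def pr resid_def innern_def) (simp add: sqnorm_def)
  qed
  have [measurable]: "(\<lambda>\<omega>. sqnorm n (proj n (W (g \<omega>)) m (\<zeta> \<omega>))) \<in> borel_measurable M"
    unfolding sqnorm_def
    by (intro borel_measurable_sum borel_measurable_power borel_measurable_proj fin \<zeta> measurable_compose[OF g W])
  let ?S = "{\<omega>\<in>space M. sqnorm n (proj n (W (g \<omega>)) m (\<zeta> \<omega>)) > t}"
  show S: "?S \<in> sets M" by measurable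
  \<comment> \<open>Markov's inequality kept as a product, avoiding division in
    \<open>ennreal\<close>.\<close>
  have "ennreal (exp (t / (4 * K))) * emeasure M ?S = (\<integral>\<^sup>+\<omega>. ennreal (exp (t / (4 * K))) * indicator ?S \<omega> \<partial>M)"
    using S by (simp add: nn_integral_cmult_indicator)
  also have "\<dots> \<le> (\<integral>\<^sup>+\<omega>. F (vecRV n (\<zeta> \<omega>), g \<omega>) \<partial>M)"
    using K by (intro nn_integral_mono)
      (auto simp: F_def pr indicator_def intro!: ennreal_leI divide_right_mono)
  also have "\<dots> \<le> ennreal (sqrt 2 ^ card m)" by (rule exp_le)
  finally have "ennreal (exp (t / (4 * K)) * measure M ?S) \<le> ennreal (sqrt 2 ^ card m)"
    by (simp add: emeasure_eq_measure ennreal_mult)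
  then have "exp (t / (4 * K)) * measure M ?S \<le> sqrt 2 ^ card m" by (simp add: ennreal_le_iff)
  then show "measure M ?S \<le> sqrt 2 ^ card m * exp (- t / (4 * K))"
    by (simp add: exp_minus field_simps)
qed

text \<open>Given \<epsilon>, the inner product is a fixed linear combination of the coordinates of
  \<eta>, hence centred normal with variance \<open>v\<close> |\<epsilon>|^2.\<close>

lemma char_innern_indep:
  assumes M: "prob_space M"
    and ind: "indep_rv M (vecM n) (\<lambda>\<omega>. vecRV n (\<eta> \<omega>)) (vecM n) (\<lambda>\<omega>. vecRV n (\<epsilon> \<omega>))"
    and gauss: "gaussian_vec M n (\<lambda>i j. if i = j then v else 0) \<eta>" and v: "v \<ge> 0"
  shows "(\<integral>\<omega>. iexp (t * innern n (\<epsilon> \<omega>) (\<eta> \<omega>)) \<partial>M) =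
    (\<integral>\<omega>. complex_of_real (exp (- (t\<^sup>2 * v * sqnorm n (\<epsilon> \<omega>)) / 2)) \<partial>M)"
proof -
  interpret prob_space M by fact
  have rv: "(\<lambda>\<omega>. vecRV n (\<eta> \<omega>)) \<in> measurable M (vecM n)"
    using indep_rv_measurable[OF ind] indep_rv_distr[OF M ind] by auto
  note \<eta> = borel_measurable_vecRV_nth[OF rv]
  define F where "F = (\<lambda>z. iexp (t * innern n (snd z) (fst z)))"
  define G where "G = (\<lambda>y. complex_of_real (exp (- (t\<^sup>2 * v * sqnorm n y) / 2)))"
  have [measurable]: "(\<lambda>z. innern n (snd z) (fst z)) \<in> borel_measurable (vecM n \<Otimes>\<^sub>M vecM n)"
    unfolding innern_def
    by (intro borel_measurable_sum borel_measurable_times measurable_compose[OF measurable_fst measurable_vecM_nth]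
        measurable_compose[OF measurable_snd measurable_vecM_nth]) auto
  have [measurable]: "sqnorm n \<in> borel_measurable (vecM n)"
    unfolding sqnorm_def by (intro borel_measurable_sum borel_measurable_power measurable_vecM_nth) auto
  have vn: "innern n (vecRV n x) (vecRV n y) = innern n x y" "innern n x (vecRV n y) = innern n x y"
     "innern n (vecRV n x) y = innern n x y"
     "sqnorm n (vecRV n x) = sqnorm n x" for x y
    by (auto intro!: innern_cong sqnorm_cong simp: vecRV_nth)
  have "(\<integral>\<omega>. F (vecRV n (\<eta> \<omega>), vecRV n (\<epsilon> \<omega>)) \<partial>M) = (\<integral>\<omega>. G (vecRV n (\<epsilon> \<omega>)) \<partial>M)"
  proof (rule integral_indep[OF M ind, where C = 1])
    show "F \<in> borel_measurable (vecM n \<Otimes>\<^sub>M vecM n)" unfolding F_def by measurable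
    show "G \<in> borel_measurable (vecM n)" unfolding G_def by measurable
    fix y
    have "(\<Sum>j<n. (if i = j then v else 0) * (t * y j)) = v * (t * y i)" if "i < n" for i
      using that by (simp add: if_distrib[of "\<lambda>x. x * _"] cong: if_cong)
    then have "innern n (\<lambda>i. t * y i) (\<lambda>i. \<Sum>j<n. (if i = j then v else 0) * (t * y j)) = t\<^sup>2 * v * sqnorm n y"
      by (simp add: innern_def sqnorm_def sum_distrib_left power2_eq_square algebra_simps)
    then have law: "distr M borel (\<lambda>\<omega>. innern n (\<lambda>i. t * y i) (\<eta> \<omega>)) = normal_law (t\<^sup>2 * v * sqnorm n y)"
      using gaussian_vec_law[OF M \<eta> gauss] by simp
    show "(\<integral>\<omega>. F (vecRV n (\<eta> \<omega>), y) \<partial>M) = G y"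
      using normal_law_char[OF borel_measurable_innern_gaussian[OF M \<eta> gauss] law] v
      by (simp add: F_def G_def vn innern_scale_left)
  qed (simp add: F_def)
  then show ?thesis by (simp add: F_def G_def vn)
qed

subsection \<open>Rates\<close>

lemma negl_weaken:
  assumes "negl M T k" "\<forall>\<^sub>F n in sequentially. k n \<le> k' n"
  shows "negl M T k'"
  unfolding negl_def
proof (intro allI impI)
  fix e :: real assume e: "e > 0"
  from neglD[OF assms(1) this] show "whp M (\<lambda>n \<omega>. \<bar>T n \<omega>\<bar> \<le> e * k' n)"
  proof (rule whp_mono)
    show "\<forall>\<^sub>F n in sequentially. \<forall>\<omega>\<in>space (M n). \<bar>T n \<omega>\<bar> \<le> e * k n \<longrightarrow> \<bar>T n \<omega>\<bar> \<le> e * k' n"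
      using assms(2) by eventually_elim (meson e less_imp_le mult_left_mono order_trans)
  qed
qed

text \<open>There are at most p^u models of size u, and u <= p makes their number positive, so that
  its logarithm is nonnegative.\<close>

lemma ln_card_subsets_smallo:
  assumes rate: "(\<lambda>n. real (u n) * ln (real (p n))) \<in> o(\<lambda>n. sqrt (real n))"
    and le: "\<forall>\<^sub>F n in sequentially. u n \<le> p n"
  shows "(\<lambda>n. ln (card (subsets (p n) (u n)))) \<in> o(\<lambda>n. sqrt (real n))"
proof -
  have "(\<lambda>n. ln (card (subsets (p n) (u n)))) \<in> O(\<lambda>n. real (u n) * ln (real (p n)))"
  proof (rule bigoI[where c = 1])
    show "\<forall>\<^sub>F n in sequentially. norm (ln (real (card (subsets (p n) (u n))))) \<le> 1 * norm (real (u n) * ln (real (p n)))"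
      using le
    proof eventually_elim
      case (elim n)
      have pos: "(p n choose u n) > 0" using elim by simp
      have le: "real (p n choose u n) \<le> real (p n) ^ u n"
        using binomial_le_pow[OF elim] by (metis of_nat_le_iff of_nat_power)
      then have "ln (real (p n choose u n)) \<le> ln (real (p n) ^ u n)"
        using pos by (subst ln_le_cancel_iff) (auto intro: less_le_trans)
      moreover have "ln (real (p n) ^ u n) = real (u n) * ln (real (p n))"
        using elim by (cases "p n = 0") (auto simp: ln_realpow)
      moreover have "1 \<le> real (p n choose u n)" using pos by linarith
      then have "0 \<le> ln (real (p n choose u n))" by (rule ln_ge_zero)
      ultimately show ?case by (simp add: card_subsets)
    qed
  qed
  then show ?thesis using rate by (rule landau_o.big_small_trans)
qed

text \<open>Needed because each model of size u also costs a factor \<open>sqrt 2 ^ (u + 1)\<close>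
  in the tail bound.\<close>

lemma sparsity_smallo:
  assumes rate: "(\<lambda>n. real (u n) * ln (real (p n))) \<in> o(\<lambda>n. sqrt (real n))"
    and le: "\<forall>\<^sub>F n in sequentially. u n \<le> p n"
  shows "(\<lambda>n. real (u n) + 1) \<in> o(\<lambda>n. sqrt (real n))"
proof -
  have "(\<lambda>n. real (u n) + 1) \<in> O(\<lambda>n. 1 / ln 2 * (real (u n) * ln (real (p n))) + 2)"
  proof (rule bigoI[where c = 1])
    show "\<forall>\<^sub>F n in sequentially. norm (real (u n) + 1) \<le> 1 * norm (1 / ln 2 * (real (u n) * ln (real (p n))) + 2)"
      using le
    proof eventually_elim
      case (elim n)
      show ?case
      proof (cases "p n \<ge> 2")
        case True
        then have "ln 2 \<le> ln (real (p n))" by simp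
        then have "real (u n) * ln 2 \<le> real (u n) * ln (real (p n))" by (intro mult_left_mono) auto
        then have "real (u n) \<le> 1 / ln 2 * (real (u n) * ln (real (p n)))" by (simp add: field_simps)
        then show ?thesis by simp
      next
        case False
        \<comment> \<open>Here ln p gives nothing, but u <= p <= 1, which the additive constant 2
          absorbs.\<close>
        then have "p n = 0 \<or> p n = 1" by linarith
        then show ?thesis using elim by auto
      qed
    qed
  qed
  moreover have "(\<lambda>n. 1 / ln 2 * (real (u n) * ln (real (p n))) + 2) \<in> o(\<lambda>n. sqrt (real n))"
  proof (rule sum_in_smallo)
    show "(\<lambda>n. 1 / ln 2 * (real (u n) * ln (real (p n)))) \<in> o(\<lambda>n. sqrt (real n))"
      using rate by (rule landau_o.small.cmult_in_iff[THEN iffD2, rotated]) simp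
    show "(\<lambda>n. 2 :: real) \<in> o(\<lambda>n. sqrt (real n))" by real_asymp
  qed
  ultimately show ?thesis by (rule landau_o.big_small_trans)
qed

text \<open>The extra 0 keeps \<open>Max\<close> off the empty set and makes the maximum
  nonnegative.\<close>

definition max_augproj :: "nat \<Rightarrow> nat \<Rightarrow> (nat \<Rightarrow> nat \<Rightarrow> real) \<Rightarrow> (nat \<Rightarrow> real) \<Rightarrow> nat \<Rightarrow> (nat \<Rightarrow> real) \<Rightarrow> real" where
  "max_augproj n p Z f u v = Max (insert 0 ((\<lambda>m. augproj n p Z f m v) ` subsets p u))"

lemma augproj_le_max: "m \<in> subsets p u \<Longrightarrow> augproj n p Z f m v \<le> max_augproj n p Z f u v"
  unfolding max_augproj_def by (intro Max_ge) (auto simp: finite_subsets)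

lemma max_augproj_nonneg: "0 \<le> max_augproj n p Z f u v"
  unfolding max_augproj_def by (intro Max_ge) (auto simp: finite_subsets)

lemma max_augproj_gr_iff:
  "t \<ge> 0 \<Longrightarrow> max_augproj n p Z f u v > t \<longleftrightarrow> (\<exists>m\<in>subsets p u. augproj n p Z f m v > t)"
  unfolding max_augproj_def by (subst Max_gr_iff) (auto simp: finite_subsets)

text \<open>The coefficients \<open>c\<close> and \<open>d\<close> cover both signals: 1 and 0 give
  \<nu>, while \<beta> and 1 give \<theta>. The tail exp (-b sqrt n) is opposed by the number of
  models and by \<open>sqrt 2\<close> per column, both of which are exp (o(sqrt n)).\<close>

lemma negl_max_augproj:
  fixes \<zeta> mu nu :: "nat \<Rightarrow> 'a \<Rightarrow> nat \<Rightarrow> real"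
  assumes M: "\<And>n. prob_space (M n)" and K: "K > 0"
    and ind: "\<And>n. indep_rv (M n) (vecM n) (\<lambda>\<omega>. vecRV n (\<zeta> n \<omega>))
          (matM n (p n) \<Otimes>\<^sub>M vecM n \<Otimes>\<^sub>M vecM n)
          (\<lambda>\<omega>. (matRV n (p n) (Z n \<omega>), vecRV n (mu n \<omega>), vecRV n (nu n \<omega>)))"
    and mgf: "\<And>n a. (\<integral>\<^sup>+\<omega>. ennreal (exp (innern n a (\<zeta> n \<omega>))) \<partial>M n) \<le> ennreal (exp (K / 2 * sqnorm n a))"
    and rate: "(\<lambda>n. real (u n) * ln (real (p n))) \<in> o(\<lambda>n. sqrt (real n))"
    and le: "\<forall>\<^sub>F n in sequentially. u n \<le> p n"
  shows "negl M (\<lambda>n \<omega>. max_augproj n (p n) (Z n \<omega>) (\<lambda>i. nu n \<omega> i * c + d * mu n \<omega> i) (u n) (\<zeta> n \<omega>))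
    (\<lambda>n. sqrt (real n))"
  unfolding negl_def
proof (intro allI impI)
  fix e :: real assume e: "e > 0"
  let ?f = "\<lambda>n \<omega> i. nu n \<omega> i * c + d * mu n \<omega> i"
  let ?B = "\<lambda>n \<omega>. max_augproj n (p n) (Z n \<omega>) (?f n \<omega>) (u n) (\<zeta> n \<omega>)"
  define E where "E = (\<lambda>n m. {\<omega>\<in>space (M n). augproj n (p n) (Z n \<omega>) (?f n \<omega>) m (\<zeta> n \<omega>) > e * sqrt (real n)})"
  define b where "b = e / (4 * K)"
  have b: "b > 0" using e K by (simp add: b_def)
  have tail: "measure (M n) (E n m) \<le> sqrt 2 ^ Suc (u n) * exp (- b * sqrt (real n))"
    and meas: "E n m \<in> sets (M n)" if m: "m \<in> subsets (p n) (u n)" for n m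
  proof -
    \<comment> \<open>The augmented matrix as a function of the restricted design variables only, so
      that their independence from the noise applies to it.\<close>
    define W where "W = (\<lambda>(A :: nat \<times> nat \<Rightarrow> real, a :: nat \<Rightarrow> real, b :: nat \<Rightarrow> real) i j.
      if j = p n then b i * c + d * a i else A (i, j))"
    let ?N = "matM n (p n) \<Otimes>\<^sub>M vecM n \<Otimes>\<^sub>M vecM n"
    let ?g = "\<lambda>\<omega>. (matRV n (p n) (Z n \<omega>), vecRV n (mu n \<omega>), vecRV n (nu n \<omega>))"
    have W: "(\<lambda>y. W y i j) \<in> borel_measurable ?N" if "i < n" "j \<in> insert (p n) m" for i j
    proof (cases "j = p n")
      case True
      have "(\<lambda>y. fst (snd y) i) \<in> borel_measurable ?N" "(\<lambda>y. snd (snd y) i) \<in> borel_measurable ?N"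
        using that by (auto intro!: measurable_compose[OF _ measurable_vecM_nth])
      then show ?thesis using True by (simp add: W_def split_beta)
    next
      case False
      then have "(i, j) \<in> {..<n} \<times> {..<p n}" using that m by (auto simp: subsets_def)
      then have "(\<lambda>y. fst y (i, j)) \<in> borel_measurable ?N"
        by (intro measurable_compose[OF measurable_fst measurable_component_singleton]) auto
      then show ?thesis using False by (simp add: W_def split_beta)
    qed
    have pr: "proj n (W (?g \<omega>)) (insert (p n) m) v = proj n (augment (p n) (Z n \<omega>) (?f n \<omega>)) (insert (p n) m) v" for \<omega> v
      using m by (intro proj_cong) (auto simp: W_def augment_def vecRV_def matRV_def subsets_def)
    have fin: "finite m" using m finite_of_subsets by blast
    have card: "card (insert (p n) m) = Suc (u n)" using m fin by (subst card_insert_disjoint) (auto simp: subsets_def)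
    have EE: "E n m = {\<omega>\<in>space (M n). sqnorm n (proj n (W (?g \<omega>)) (insert (p n) m) (\<zeta> n \<omega>)) > e * sqrt (real n)}"
      by (simp add: E_def augproj_def pr)
    show "measure (M n) (E n m) \<le> sqrt 2 ^ Suc (u n) * exp (- b * sqrt (real n))"
      using indep_proj_tail(1)[OF M ind K mgf W, where m = "insert (p n) m" and t = "e * sqrt (real n)"] fin
      unfolding EE card by (simp add: b_def)
    show "E n m \<in> sets (M n)"
      unfolding EE by (rule indep_proj_tail(2)[OF M ind K mgf W]) (use fin in auto)
  qed
  have bad: "{\<omega>\<in>space (M n). \<not> \<bar>?B n \<omega>\<bar> \<le> e * sqrt (real n)} = (\<Union>m\<in>subsets (p n) (u n). E n m)" for n
    using e by (auto simp: not_le max_augproj_nonneg max_augproj_gr_iff E_def)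
  show "whp M (\<lambda>n \<omega>. \<bar>?B n \<omega>\<bar> \<le> e * sqrt (real n))"
  proof (rule whpI, unfold bad)
    show "\<forall>\<^sub>F n in sequentially. (\<Union>m\<in>subsets (p n) (u n). E n m) \<in> sets (M n)"
      using meas finite_subsets by (intro always_eventually allI sets.finite_UN) auto
    \<comment> \<open>Each of the two o(sqrt n) terms takes a quarter of \<open>b\<close>, leaving
      half of the tail exponent.\<close>
    have L: "\<forall>\<^sub>F n in sequentially. \<bar>ln (card (subsets (p n) (u n)))\<bar> \<le> b / 4 * sqrt (real n)"
      using landau_o.smallD[OF ln_card_subsets_smallo[OF rate le], of "b / 4"] b by simp
    have U: "\<forall>\<^sub>F n in sequentially. \<bar>real (u n) + 1\<bar> \<le> b / 4 * sqrt (real n)"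
      using landau_o.smallD[OF sparsity_smallo[OF rate le], of "b / 4"] b by simp
    have "\<forall>\<^sub>F n in sequentially. measure (M n) (\<Union>m\<in>subsets (p n) (u n). E n m) \<le> exp (- (b / 2) * sqrt (real n))"
      using L U
    proof eventually_elim
      case (elim n)
      let ?c = "real (card (subsets (p n) (u n)))"
      have "measure (M n) (\<Union>m\<in>subsets (p n) (u n). E n m) \<le> (\<Sum>m\<in>subsets (p n) (u n). measure (M n) (E n m))"
        using meas by (intro measure_UNION_le finite_subsets)
      also have "\<dots> \<le> ?c * (sqrt 2 ^ Suc (u n) * exp (- b * sqrt (real n)))"
        by (intro sum_bounded_above tail)
      also have "\<dots> \<le> exp (ln ?c) * (exp (real (u n) + 1) * exp (- b * sqrt (real n)))"
      proof (intro mult_mono)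
        show "?c \<le> exp (ln ?c)" by (cases "?c = 0") auto
        have "sqrt 2 \<le> exp 1"
          using exp_ge_add_one_self[of 1] real_sqrt_le_mono[of 2 4] by simp
        then have "sqrt 2 ^ Suc (u n) \<le> exp 1 ^ Suc (u n)" by (intro power_mono) auto
        also have "\<dots> = exp (real (u n) + 1)" by (simp flip: exp_of_nat_mult add: exp_add)
        finally show "sqrt 2 ^ Suc (u n) \<le> exp (real (u n) + 1)" .
      qed auto
      also have "\<dots> = exp (ln ?c + (real (u n) + 1) - b * sqrt (real n))"
        by (simp flip: exp_add)
      also have "\<dots> \<le> exp (- (b / 2) * sqrt (real n))"
        using elim by (simp add: field_simps)
      finally show ?case .
    qed
    moreover have "(\<lambda>n. exp (- (b / 2) * sqrt (real n))) \<longlonglongrightarrow> 0"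
      using b by real_asymp
    ultimately show "(\<lambda>n. measure (M n) (\<Union>m\<in>subsets (p n) (u n). E n m)) \<longlonglongrightarrow> 0"
      by - (rule Lim_null_comparison, simp_all)
  qed
qed

lemma extend_subsets:
  assumes "S \<in> subsets p s" "s \<le> u" "u \<le> p"
  obtains S' where "S' \<in> subsets p u" "S \<subseteq> S'"
proof -
  have "\<exists>S'. S \<subseteq> S' \<and> S' \<subseteq> {..<p} \<and> card S' = u"
    using assms by (intro exists_subset_between) (auto simp: subsets_def)
  then show ?thesis using that by (auto simp: subsets_def)
qed

text \<open>\<open>B\<close> dominates the augmented projections of the noise \<open>\<xi>\<close>
  in \<open>V\<close> and, for the second claim, those of the vector \<open>\<zeta>\<close> tested
  against the error. One bound with 13 \<open>B\<close> serves both claims.\<close>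

lemma negl_fhat_error:
  fixes B :: "nat \<Rightarrow> 'a \<Rightarrow> real"
  assumes M: "\<And>n. prob_space (M n)" and \<alpha>: "\<alpha> > 0"
    and V: "\<And>n \<omega>. V n \<omega> = (\<lambda>i. f n \<omega> i + \<xi> n \<omega> i)"
    and B: "negl M B (\<lambda>n. sqrt (real n))"
    and \<xi>: "\<And>n \<omega> m. m \<in> subsets (p n) (u n) \<Longrightarrow> augproj n (p n) (Z n \<omega>) (f n \<omega>) m (\<xi> n \<omega>) \<le> B n \<omega>"
    and sparse: "weakly_sparse M p Z f s (\<lambda>n. sqrt (real n))"
    and Z: "\<And>n i j. i < n \<Longrightarrow> j < p n \<Longrightarrow> (\<lambda>\<omega>. Z n \<omega> i j) \<in> borel_measurable (M n)"
    and f: "\<And>n i. i < n \<Longrightarrow> (\<lambda>\<omega>. f n \<omega> i) \<in> borel_measurable (M n)"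
    and su: "\<forall>\<^sub>F n in sequentially. s n \<le> u n" and up: "\<forall>\<^sub>F n in sequentially. u n \<le> p n"
    and rate: "(\<lambda>n. real (u n) * ln (real (p n))) \<in> o(\<lambda>n. sqrt (real n))"
  shows "negl M (\<lambda>n \<omega>. sqnorm n (\<lambda>i. f n \<omega> i - fhat n (p n) (Z n \<omega>) (u n) \<alpha> (V n \<omega>) i)) (\<lambda>n. sqrt (real n))"
    and "(\<And>n \<omega> m. m \<in> subsets (p n) (u n) \<Longrightarrow> augproj n (p n) (Z n \<omega>) (f n \<omega>) m (\<zeta> n \<omega>) \<le> B n \<omega>) \<Longrightarrow>
      negl M (\<lambda>n \<omega>. innern n (\<zeta> n \<omega>) (\<lambda>i. f n \<omega> i - fhat n (p n) (Z n \<omega>) (u n) \<alpha> (V n \<omega>) i)) (\<lambda>n. sqrt (real n))"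
proof -
  obtain S where S: "\<forall>\<^sub>F n in sequentially. S n \<in> subsets (p n) (s n)"
    and small: "smallOp M (\<lambda>n \<omega>. sqnorm n (resid n (Z n \<omega>) (S n) (f n \<omega>))) (\<lambda>n. sqrt (real n))"
    using sparse by (auto simp: weakly_sparse_def)
  define D where "D = (\<lambda>n \<omega>. sqnorm n (resid n (Z n \<omega>) (S n) (f n \<omega>)))"
  have "\<forall>\<^sub>F n in sequentially. D n \<in> borel_measurable (M n)"
    using S
  proof eventually_elim
    case (elim n)
    then have "finite (S n)" "S n \<subseteq> {..<p n}" by (auto simp: subsets_def intro: finite_subset)
    then show ?case unfolding D_def sqnorm_def resid_def
      by (intro borel_measurable_sum borel_measurable_power borel_measurable_diff borel_measurable_proj f Z) auto
  qed
  then have D: "negl M D (\<lambda>n. sqrt (real n))"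
    using small by (intro negl_of_smallOp) (simp_all add: D_def)
  let ?L = "\<lambda>n. ln (card (subsets (p n) (u n)))"
  have L: "negl M (\<lambda>n \<omega>. ?L n) (\<lambda>n. sqrt (real n))"
    by (rule negl_of_smallo[OF ln_card_subsets_smallo[OF rate up]]) simp
  have bound: "negl M (\<lambda>n \<omega>. (3 * D n \<omega> + 13 * B n \<omega>) + (2 * \<alpha>) * ?L n) (\<lambda>n. sqrt (real n))"
    by (intro negl_add M negl_cmult D B L)
  \<comment> \<open>The sparse set has size \<open>s n\<close>, the models have size
    \<open>u n\<close>; enlarging the set does not increase the residual, and the choice is the same
    for all \<open>\<omega>\<close>.\<close>
  have ev: "\<forall>\<^sub>F n in sequentially. \<exists>S'. S' \<in> subsets (p n) (u n) \<and> (\<forall>\<omega>. sqnorm n (resid n (Z n \<omega>) S' (f n \<omega>)) \<le> D n \<omega>)"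
    using S su up
  proof eventually_elim
    case (elim n)
    obtain S' where S': "S' \<in> subsets (p n) (u n)" "S n \<subseteq> S'"
      using extend_subsets[OF elim] .
    then show ?case
      using finite_of_subsets by (intro exI[of _ S']) (auto simp: D_def intro!: sqnorm_resid_antimono)
  qed
  show "negl M (\<lambda>n \<omega>. sqnorm n (\<lambda>i. f n \<omega> i - fhat n (p n) (Z n \<omega>) (u n) \<alpha> (V n \<omega>) i)) (\<lambda>n. sqrt (real n))"
    using bound
  proof (rule negl_mono)
    show "\<forall>\<^sub>F n in sequentially. \<forall>\<omega>\<in>space (M n).
      \<bar>sqnorm n (\<lambda>i. f n \<omega> i - fhat n (p n) (Z n \<omega>) (u n) \<alpha> (V n \<omega>) i)\<bar> \<le> (3 * D n \<omega> + 13 * B n \<omega>) + (2 * \<alpha>) * ?L n"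
      using ev
    proof eventually_elim
      case (elim n)
      then obtain S' where S': "S' \<in> subsets (p n) (u n)" "\<And>\<omega>. sqnorm n (resid n (Z n \<omega>) S' (f n \<omega>)) \<le> D n \<omega>"
        by auto
      show ?case
      proof
        fix \<omega>
        \<comment> \<open>Allows 11 \<open>B\<close> to be replaced by 13 \<open>B\<close>. Any
          model gives the sign, and \<open>S'\<close> is one.\<close>
        have "0 \<le> B n \<omega>" using \<xi>[OF S'(1)] augproj_nonneg order_trans by blast
        moreover have "sqnorm n (\<lambda>i. f n \<omega> i - fhat n (p n) (Z n \<omega>) (u n) \<alpha> (V n \<omega>) i)
          \<le> 3 * D n \<omega> + 11 * B n \<omega> + 2 * \<alpha> * ?L n"
          by (rule sqnorm_diff_fhat_le[OF V \<alpha> S'], rule \<xi>)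
        ultimately show "\<bar>sqnorm n (\<lambda>i. f n \<omega> i - fhat n (p n) (Z n \<omega>) (u n) \<alpha> (V n \<omega>) i)\<bar>
          \<le> (3 * D n \<omega> + 13 * B n \<omega>) + (2 * \<alpha>) * ?L n"
          by simp
      qed
    qed
  qed
  assume \<zeta>: "\<And>n \<omega> m. m \<in> subsets (p n) (u n) \<Longrightarrow> augproj n (p n) (Z n \<omega>) (f n \<omega>) m (\<zeta> n \<omega>) \<le> B n \<omega>"
  show "negl M (\<lambda>n \<omega>. innern n (\<zeta> n \<omega>) (\<lambda>i. f n \<omega> i - fhat n (p n) (Z n \<omega>) (u n) \<alpha> (V n \<omega>) i)) (\<lambda>n. sqrt (real n))"
    using bound
  proof (rule negl_mono)
    show "\<forall>\<^sub>F n in sequentially. \<forall>\<omega>\<in>space (M n).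
      \<bar>innern n (\<zeta> n \<omega>) (\<lambda>i. f n \<omega> i - fhat n (p n) (Z n \<omega>) (u n) \<alpha> (V n \<omega>) i)\<bar>
        \<le> (3 * D n \<omega> + 13 * B n \<omega>) + (2 * \<alpha>) * ?L n"
      using ev
    proof eventually_elim
      case (elim n)
      then obtain S' where S': "S' \<in> subsets (p n) (u n)" "\<And>\<omega>. sqnorm n (resid n (Z n \<omega>) S' (f n \<omega>)) \<le> D n \<omega>"
        by auto
      show ?case
      proof
        fix \<omega>
        have "2 * \<bar>innern n (\<zeta> n \<omega>) (\<lambda>i. f n \<omega> i - fhat n (p n) (Z n \<omega>) (u n) \<alpha> (V n \<omega>) i)\<bar>
          \<le> 3 * D n \<omega> + 13 * B n \<omega> + 2 * \<alpha> * ?L n"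
          by (rule innern_diff_fhat_le[OF V \<alpha> S'], rule \<xi>, assumption, rule \<zeta>)
        then show "\<bar>innern n (\<zeta> n \<omega>) (\<lambda>i. f n \<omega> i - fhat n (p n) (Z n \<omega>) (u n) \<alpha> (V n \<omega>) i)\<bar>
          \<le> (3 * D n \<omega> + 13 * B n \<omega>) + (2 * \<alpha>) * ?L n"
          by linarith
      qed
    qed
  qed
qed

text \<open>Chebyshev: the mean square deviation is at most 2 n K^2 through the Frobenius norm, so
  any scale \<open>k\<close> with n / k^2 tending to 0 works. It is applied with n^(3/4) for \<eta>
  and with n for \<epsilon>.\<close>

lemma negl_gaussian_sqnorm:
  assumes M: "\<And>n. prob_space (M n)"
    and X: "\<And>n i. i < n \<Longrightarrow> (\<lambda>\<omega>. X n \<omega> i) \<in> borel_measurable (M n)"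
    and gauss: "\<And>n. gaussian_vec (M n) n (Sig n) (X n)"
    and sym: "\<And>n i j. i < n \<Longrightarrow> j < n \<Longrightarrow> Sig n i j = Sig n j i"
    and K: "\<And>n. opnorm n (Sig n) \<le> K"
    and tr: "\<forall>\<^sub>F n in sequentially. trace_n n (Sig n) \<ge> 0"
    and k: "(\<lambda>n. real n / (k n)\<^sup>2) \<longlonglongrightarrow> 0" "\<forall>\<^sub>F n in sequentially. k n > 0"
  shows "negl M (\<lambda>n \<omega>. sqnorm n (X n \<omega>) - trace_n n (Sig n)) k"
  unfolding negl_def
proof (intro allI impI whpI)
  fix e :: real assume e: "e > 0"
  let ?T = "\<lambda>n \<omega>. sqnorm n (X n \<omega>) - trace_n n (Sig n)"
  have meas [measurable]: "?T n \<in> borel_measurable (M n)" for n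
    unfolding sqnorm_def by (intro borel_measurable_diff borel_measurable_sum borel_measurable_power X) auto
  show "\<forall>\<^sub>F n in sequentially. {\<omega>\<in>space (M n). \<not> \<bar>?T n \<omega>\<bar> \<le> e * k n} \<in> sets (M n)"
    using meas by (intro always_eventually allI) measurable
  have "\<forall>\<^sub>F n in sequentially. measure (M n) {\<omega>\<in>space (M n). \<not> \<bar>?T n \<omega>\<bar> \<le> e * k n} \<le> 2 * K\<^sup>2 / e\<^sup>2 * (real n / (k n)\<^sup>2)"
    using tr k(2)
  proof eventually_elim
    case (elim n)
    interpret prob_space "M n" by (rule M)
    have ek: "e * k n > 0" using e elim by simp
    have "measure (M n) {\<omega>\<in>space (M n). \<not> \<bar>?T n \<omega>\<bar> \<le> e * k n} \<le> measure (M n) {\<omega>\<in>space (M n). \<bar>?T n \<omega>\<bar> \<ge> e * k n}"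
      using meas[of n] by (intro finite_measure_mono) auto
    also have "\<dots> \<le> 2 * (\<Sum>i<n. \<Sum>j<n. (Sig n i j)\<^sup>2) / (e * k n)\<^sup>2"
      by (rule gaussian_sqnorm_concentration[OF M X gauss sym elim(1) ek])
    also have "\<dots> \<le> 2 * (real n * K\<^sup>2) / (e * k n)\<^sup>2"
    proof (intro divide_right_mono mult_left_mono)
      have "(\<Sum>i<n. \<Sum>j<n. (Sig n i j)\<^sup>2) \<le> real n * (opnorm n (Sig n))\<^sup>2" by (rule sum_squares_le_opnorm)
      also have "\<dots> \<le> real n * K\<^sup>2"
        using K[of n] opnorm_nonneg[of n "Sig n"] by (intro mult_left_mono power_mono) auto
      finally show "(\<Sum>i<n. \<Sum>j<n. (Sig n i j)\<^sup>2) \<le> real n * K\<^sup>2" .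
    qed auto
    also have "\<dots> = 2 * K\<^sup>2 / e\<^sup>2 * (real n / (k n)\<^sup>2)" by (simp add: power_mult_distrib)
    finally show ?case .
  qed
  moreover have "(\<lambda>n. 2 * K\<^sup>2 / e\<^sup>2 * (real n / (k n)\<^sup>2)) \<longlonglongrightarrow> 2 * K\<^sup>2 / e\<^sup>2 * 0"
    by (intro tendsto_intros k(1))
  ultimately show "(\<lambda>n. measure (M n) {\<omega>\<in>space (M n). \<not> \<bar>?T n \<omega>\<bar> \<le> e * k n}) \<longlonglongrightarrow> 0"
    by - (rule Lim_null_comparison, simp_all)
qed

subsection \<open>The partially linear model\<close>

lemma opnorm_scalar_le:
  assumes "v \<ge> 0"
  shows "opnorm n (\<lambda>i j. if i = j then v else 0) \<le> v"
  unfolding opnorm_def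
proof (rule cSUP_least)
  show "{a. sqnorm n a \<le> 1} \<noteq> {}" by (auto simp: sqnorm_def intro!: exI[of _ "\<lambda>_. 0"])
  fix a assume a: "a \<in> {a. sqnorm n a \<le> 1}"
  have "(\<Sum>j<n. (if i = j then v else 0) * a j) = v * a i" if "i < n" for i
    using that by (simp add: if_distrib[of "\<lambda>x. x * _"] cong: if_cong)
  then have "sqnorm n (\<lambda>i. \<Sum>j<n. (if i = j then v else 0) * a j) = sqnorm n (\<lambda>i. v * a i)"
    by (intro sqnorm_cong) auto
  also have "\<dots> = v\<^sup>2 * sqnorm n a" by (rule sqnorm_scale)
  also have "\<dots> \<le> v\<^sup>2 * 1" using a by (intro mult_left_mono) auto
  finally show "sqrt (sqnorm n (\<lambda>i. \<Sum>j<n. (if i = j then v else 0) * a j)) \<le> v"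
    using assms by (intro real_le_lsqrt) auto
qed

text \<open>Read \<open>x\<close> as n, \<open>s\<close> as the variance of \<eta>, \<open>N\<close>
  as the denominator, \<open>E\<close> as <\<epsilon>, \<eta>>, \<open>R\<close> as the remainder
  and \<open>k\<close> as n^(3/4). Replacing \<open>N\<close> by \<open>x * s\<close> costs |E| |N -
  x s| / (N s sqrt x). Both factors of the numerator are bounded in terms of \<open>k\<close>, and
  k^2 = x sqrt x matches the denominator, so that smallness of \<open>d2\<close> suffices.\<close>

lemma ratio_bound:
  fixes x s N R E k C d1 d2 :: real
  assumes x: "x > 0" and s: "s > 0" and C: "C \<ge> 0" and k: "k \<ge> 0" "k\<^sup>2 = x * sqrt x"
    and N: "\<bar>N - x * s\<bar> \<le> s / 2 * x" and N2: "\<bar>N - x * s\<bar> \<le> d2 * k"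
    and R: "\<bar>R\<bar> \<le> d1 * sqrt x" and E: "\<bar>E\<bar> \<le> C * k"
  shows "\<bar>sqrt x * ((E + R) / N) - E / (sqrt x * s)\<bar> \<le> 2 * d1 / s + 2 * C * d2 / s\<^sup>2"
proof -
  have xs: "x * s > 0" using x s by simp
  have "s / 2 * x = x * s / 2" by simp
  \<comment> \<open>Keeps \<open>N\<close> away from 0, at the price of the factors 2 in the
    bound.\<close>
  then have Nge: "N \<ge> x * s / 2" using N by linarith
  then have Npos: "N > 0" using xs by linarith
  have sq: "sqrt x * sqrt x = x" using x by simp
  have sx: "sqrt x > 0" using x by simp
  have eq: "sqrt x * ((E + R) / N) - E / (sqrt x * s) = sqrt x * R / N + E * (x * s - N) / (N * (sqrt x * s))"
    using Npos sx s by (simp add: field_simps)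
  have 1: "\<bar>sqrt x * R / N\<bar> \<le> 2 * d1 / s"
  proof -
    have "\<bar>sqrt x * R / N\<bar> = sqrt x * \<bar>R\<bar> / N" using Npos x by (simp add: abs_mult)
    also have "\<dots> \<le> sqrt x * (d1 * sqrt x) / (x * s / 2)"
      using Nge xs R x by (intro frac_le mult_left_mono) (auto intro: order_trans[OF abs_ge_zero])
    also have "\<dots> = 2 * d1 / s" using x s sq by (simp add: field_simps)
    finally show ?thesis .
  qed
  have 2: "\<bar>E * (x * s - N) / (N * (sqrt x * s))\<bar> \<le> 2 * C * d2 / s\<^sup>2"
  proof -
    have num: "\<bar>E\<bar> * \<bar>N - x * s\<bar> \<le> (C * k) * (d2 * k)"
      using E N2 C k by (intro mult_mono) auto
    have "\<bar>E * (x * s - N) / (N * (sqrt x * s))\<bar> = \<bar>E\<bar> * \<bar>N - x * s\<bar> / (N * (sqrt x * s))"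
      using Npos x s by (simp add: abs_mult abs_minus_commute)
    also have "\<dots> \<le> (C * k) * (d2 * k) / ((x * s / 2) * (sqrt x * s))"
      using num Nge xs sx s by (intro frac_le mult_right_mono) (auto intro: order_trans[OF _ num])
    also have "(C * k) * (d2 * k) = C * d2 * k\<^sup>2" by (simp add: power2_eq_square)
    also have "C * d2 * k\<^sup>2 / ((x * s / 2) * (sqrt x * s)) = 2 * C * d2 / s\<^sup>2"
      using x s sx unfolding k(2) by (simp add: field_simps power2_eq_square)
    finally show ?thesis .
  qed
  show ?thesis unfolding eq by (rule order_trans[OF abs_triangle_ineq add_mono[OF 1 2]])
qed

lemma norm_iexp_diff_le: "norm (iexp x - iexp y) \<le> \<bar>x - y\<bar>"
proof -
  have "iexp x - iexp y = iexp y * (iexp (x - y) - 1)"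
    by (simp add: algebra_simps flip: exp_add)
  then have "norm (iexp x - iexp y) = norm (iexp (x - y) - 1)" by (simp add: norm_mult)
  also have "\<dots> \<le> \<bar>x - y\<bar>" using iexp_approx1[of "x - y" 0] by simp
  finally show ?thesis .
qed

lemma exp_neg_diff_le:
  fixes x y :: real
  assumes "x \<ge> 0" "y \<ge> 0"
  shows "\<bar>exp (- x) - exp (- y)\<bar> \<le> \<bar>x - y\<bar>"
proof -
  have *: "exp (- x) - exp (- y) \<le> y - x" if "x \<ge> 0" "x \<le> y" for x y :: real
  proof -
    have "exp (- x) - exp (- y) = exp (- x) * (1 - exp (- (y - x)))"
      by (simp add: algebra_simps flip: exp_add)
    also have "\<dots> \<le> 1 * (y - x)"
    proof (rule mult_mono)
      show "1 - exp (- (y - x)) \<le> y - x" using exp_ge_add_one_self[of "- (y - x)"] by linarith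
    qed (use that in auto)
    finally show ?thesis by simp
  qed
  show ?thesis
    using *[of x y] *[of y x] assms by (cases "x \<le> y") (auto simp: abs_if)
qed

lemma char_normal_law: "char (normal_law v) t = complex_of_real (exp (- (t\<^sup>2 * \<bar>v\<bar>) / 2))"
proof -
  have "char (normal_law v) t = char std_normal_distribution (t * sqrt \<bar>v\<bar>)"
    unfolding normal_law_conv_std_normal char_def by (simp add: integral_distr mult.assoc)
  then show ?thesis by (simp add: char_std_normal_distribution power_mult_distrib)
qed

text \<open>One \<open>K\<close> bounds the covariance norm of \<epsilon> and the variance of
  \<eta>, so both noises share one exponential moment bound.\<close>

locale partially_linear_model =
  fixes M :: "nat \<Rightarrow> 'a measure" and p :: "nat \<Rightarrow> nat"
    and Z :: "nat \<Rightarrow> 'a \<Rightarrow> nat \<Rightarrow> nat \<Rightarrow> real"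
    and mu nu eta eps :: "nat \<Rightarrow> 'a \<Rightarrow> nat \<Rightarrow> real"
    and Sig :: "nat \<Rightarrow> nat \<Rightarrow> nat \<Rightarrow> real"
    and beta sig2 dbar alphaY alphaX K :: real
    and s_d s_t u_d u_t :: "nat \<Rightarrow> nat"
  assumes prob: "\<And>n. prob_space (M n)"
    and sig2_pos: "sig2 > 0"
    and eta_gauss: "\<And>n. gaussian_vec (M n) n (\<lambda>i j. if i = j then sig2 else 0) (eta n)"
    and eta_indep: "\<And>n. indep_rv (M n) (vecM n) (\<lambda>\<omega>. vecRV n (eta n \<omega>))
          (matM n (p n) \<Otimes>\<^sub>M vecM n \<Otimes>\<^sub>M vecM n \<Otimes>\<^sub>M vecM n)
          (\<lambda>\<omega>. (matRV n (p n) (Z n \<omega>), vecRV n (mu n \<omega>), vecRV n (nu n \<omega>), vecRV n (eps n \<omega>)))"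
    and Sig_sym: "\<And>n i j. i < n \<Longrightarrow> j < n \<Longrightarrow> Sig n i j = Sig n j i"
    and eps_gauss: "\<And>n. gaussian_vec (M n) n (Sig n) (eps n)"
    and eps_indep: "\<And>n. indep_rv (M n) (vecM n) (\<lambda>\<omega>. vecRV n (eps n \<omega>))
          (matM n (p n) \<Otimes>\<^sub>M vecM n \<Otimes>\<^sub>M vecM n)
          (\<lambda>\<omega>. (matRV n (p n) (Z n \<omega>), vecRV n (mu n \<omega>), vecRV n (nu n \<omega>)))"
    and Sig_le: "\<And>n. opnorm n (Sig n) \<le> K" and sig2_le: "sig2 \<le> K"
    and Sig_trace: "(\<lambda>n. trace_n n (Sig n) / real n) \<longlonglongrightarrow> dbar"
    and dbar_pos: "dbar > 0"
    and sparse_nu: "weakly_sparse M p Z nu s_d (\<lambda>n. sqrt (real n))"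
    and sparse_theta: "weakly_sparse M p Z (\<lambda>n \<omega> i. nu n \<omega> i * beta + mu n \<omega> i) s_t (\<lambda>n. sqrt (real n))"
    and su_d: "\<forall>\<^sub>F n in sequentially. s_d n \<le> u_d n" and su_t: "\<forall>\<^sub>F n in sequentially. s_t n \<le> u_t n"
    and up_d: "\<forall>\<^sub>F n in sequentially. u_d n \<le> p n" and up_t: "\<forall>\<^sub>F n in sequentially. u_t n \<le> p n"
    and rate_d: "(\<lambda>n. real (u_d n) * ln (real (p n))) \<in> o(\<lambda>n. sqrt (real n))"
    and rate_t: "(\<lambda>n. real (u_t n) * ln (real (p n))) \<in> o(\<lambda>n. sqrt (real n))"
    and alphaY: "alphaY > 0" and alphaX: "alphaX > 0"
begin

abbreviation X where "X n \<omega> \<equiv> (\<lambda>i. nu n \<omega> i + eta n \<omega> i)"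
abbreviation theta where "theta n \<omega> \<equiv> (\<lambda>i. nu n \<omega> i * beta + mu n \<omega> i)"
abbreviation Y where "Y n \<omega> \<equiv> (\<lambda>i. theta n \<omega> i + (beta * eta n \<omega> i + eps n \<omega> i))"
abbreviation DX where "DX n \<omega> \<equiv> (\<lambda>i. nu n \<omega> i - fhat n (p n) (Z n \<omega>) (u_d n) alphaX (X n \<omega>) i)"
abbreviation DY where "DY n \<omega> \<equiv> (\<lambda>i. theta n \<omega> i - fhat n (p n) (Z n \<omega>) (u_t n) alphaY (Y n \<omega>) i)"
abbreviation rX where "rX n \<omega> \<equiv> (\<lambda>i. eta n \<omega> i + DX n \<omega> i)"
abbreviation rY where "rY n \<omega> \<equiv> (\<lambda>i. (beta * eta n \<omega> i + eps n \<omega> i) + DY n \<omega> i)"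
abbreviation rt :: "nat \<Rightarrow> real" where "rt \<equiv> (\<lambda>n. sqrt (real n))"
text \<open>This is n^(3/4): large enough for Chebyshev on |\<eta>|^2, whose variance is of order n,
  and small enough that its square is only n sqrt n.\<close>

abbreviation rt34 :: "nat \<Rightarrow> real" where "rt34 \<equiv> (\<lambda>n. sqrt (real n * sqrt (real n)))"

section \<open>Measurability, independence and exponential moments of the noises\<close>

lemma K_pos: "K > 0"
  using sig2_pos sig2_le by linarith

lemma meas_eta: "i < n \<Longrightarrow> (\<lambda>\<omega>. eta n \<omega> i) \<in> borel_measurable (M n)"
  using borel_measurable_vecRV_nth[OF indep_rv_measurable(1)[OF eta_indep]] .

lemma meas_eps: "i < n \<Longrightarrow> (\<lambda>\<omega>. eps n \<omega> i) \<in> borel_measurable (M n)"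
  using borel_measurable_vecRV_nth[OF indep_rv_measurable(1)[OF eps_indep]] .

lemma meas_mu: "i < n \<Longrightarrow> (\<lambda>\<omega>. mu n \<omega> i) \<in> borel_measurable (M n)"
  using measurable_compose[OF measurable_compose[OF indep_rv_measurable(2)[OF eps_indep] measurable_snd] measurable_fst]
  by (intro borel_measurable_vecRV_nth) auto

lemma meas_nu: "i < n \<Longrightarrow> (\<lambda>\<omega>. nu n \<omega> i) \<in> borel_measurable (M n)"
  using measurable_compose[OF measurable_compose[OF indep_rv_measurable(2)[OF eps_indep] measurable_snd] measurable_snd]
  by (intro borel_measurable_vecRV_nth) auto

lemma meas_Z:
  assumes "i < n" "j < p n"
  shows "(\<lambda>\<omega>. Z n \<omega> i j) \<in> borel_measurable (M n)"
proof -
  have "(\<lambda>\<omega>. matRV n (p n) (Z n \<omega>)) \<in> measurable (M n) (matM n (p n))"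
    using measurable_compose[OF indep_rv_measurable(2)[OF eps_indep] measurable_fst] by simp
  then have "(\<lambda>\<omega>. matRV n (p n) (Z n \<omega>) (i, j)) \<in> borel_measurable (M n)"
    by (rule measurable_compose[OF _ measurable_component_singleton]) (use assms in auto)
  then show ?thesis using assms by (simp add: matRV_def)
qed

lemma eta_indep_design:
  "indep_rv (M n) (vecM n) (\<lambda>\<omega>. vecRV n (eta n \<omega>)) (matM n (p n) \<Otimes>\<^sub>M vecM n \<Otimes>\<^sub>M vecM n)
     (\<lambda>\<omega>. (matRV n (p n) (Z n \<omega>), vecRV n (mu n \<omega>), vecRV n (nu n \<omega>)))"
proof -
  have "(\<lambda>y. (fst y, fst (snd y), fst (snd (snd y)))) \<in>
      (matM n (p n) \<Otimes>\<^sub>M vecM n \<Otimes>\<^sub>M vecM n \<Otimes>\<^sub>M vecM n) \<rightarrow>\<^sub>M (matM n (p n) \<Otimes>\<^sub>M vecM n \<Otimes>\<^sub>M vecM n)"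
    by measurable
  from indep_rv_compose[OF prob eta_indep this] show ?thesis by simp
qed

lemma eta_indep_eps:
  "indep_rv (M n) (vecM n) (\<lambda>\<omega>. vecRV n (eta n \<omega>)) (vecM n) (\<lambda>\<omega>. vecRV n (eps n \<omega>))"
proof -
  have "(\<lambda>y. snd (snd (snd y))) \<in> (matM n (p n) \<Otimes>\<^sub>M vecM n \<Otimes>\<^sub>M vecM n \<Otimes>\<^sub>M vecM n) \<rightarrow>\<^sub>M vecM n"
    by measurable
  from indep_rv_compose[OF prob eta_indep this] show ?thesis by simp
qed

lemma mgf_eta: "(\<integral>\<^sup>+\<omega>. ennreal (exp (innern n a (eta n \<omega>))) \<partial>M n) \<le> ennreal (exp (K / 2 * sqnorm n a))"
  using opnorm_scalar_le[of sig2 n] sig2_pos sig2_le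
  by (intro gaussian_vec_mgf_le[OF prob meas_eta eta_gauss]) auto

lemma mgf_eps: "(\<integral>\<^sup>+\<omega>. ennreal (exp (innern n a (eps n \<omega>))) \<partial>M n) \<le> ennreal (exp (K / 2 * sqnorm n a))"
  by (intro gaussian_vec_mgf_le[OF prob meas_eps eps_gauss] Sig_le)

section \<open>Estimation errors of the two auxiliary regressions\<close>

lemma negl_DX:
  "negl M (\<lambda>n \<omega>. sqnorm n (DX n \<omega>)) rt"
  "negl M (\<lambda>n \<omega>. innern n (eta n \<omega>) (DX n \<omega>)) rt"
  "negl M (\<lambda>n \<omega>. innern n (eps n \<omega>) (DX n \<omega>)) rt"
proof -
  let ?b = "\<lambda>\<zeta> n \<omega>. max_augproj n (p n) (Z n \<omega>) (nu n \<omega>) (u_d n) (\<zeta> n \<omega>)"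
  \<comment> \<open>One bound for both noises: \<eta> is the noise in X, but the error is also
    tested against \<epsilon>.\<close>
  define B where "B = (\<lambda>n \<omega>. ?b eta n \<omega> + ?b eps n \<omega>)"
  have b: "negl M (?b eta) rt" "negl M (?b eps) rt"
    using negl_max_augproj[OF prob K_pos eta_indep_design mgf_eta rate_d up_d, of 1 0]
      negl_max_augproj[OF prob K_pos eps_indep mgf_eps rate_d up_d, of 1 0] by simp_all
  have B: "negl M B rt" unfolding B_def by (intro negl_add prob b)
  have le: "augproj n (p n) (Z n \<omega>) (nu n \<omega>) m (eta n \<omega>) \<le> B n \<omega>"
    "augproj n (p n) (Z n \<omega>) (nu n \<omega>) m (eps n \<omega>) \<le> B n \<omega>" if "m \<in> subsets (p n) (u_d n)" for n \<omega> m
    using augproj_le_max[OF that, of n "Z n \<omega>" "nu n \<omega>"] max_augproj_nonneg[of n "p n" "Z n \<omega>" "nu n \<omega>" "u_d n"]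
    unfolding B_def by (meson add_increasing add_increasing2)+
  note err = negl_fhat_error[OF prob alphaX _ B le(1) sparse_nu meas_Z meas_nu su_d up_d rate_d, where V = X]
  show "negl M (\<lambda>n \<omega>. sqnorm n (DX n \<omega>)) rt" by (rule err(1)) auto
  show "negl M (\<lambda>n \<omega>. innern n (eta n \<omega>) (DX n \<omega>)) rt" by (rule err(2)) (auto intro: le)
  show "negl M (\<lambda>n \<omega>. innern n (eps n \<omega>) (DX n \<omega>)) rt" by (rule err(2)) (auto intro: le)
qed

text \<open>The noise \<open>beta * eta + eps\<close> is handled through its two parts by |P (b v +
  w)|^2 <= 2 b^2 |P v|^2 + 2 |P w|^2, hence the coefficients of \<open>B\<close>; the additional 1
  makes \<open>B\<close> dominate the bound for \<eta> alone.\<close>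

lemma negl_DY:
  "negl M (\<lambda>n \<omega>. sqnorm n (DY n \<omega>)) rt"
  "negl M (\<lambda>n \<omega>. innern n (eta n \<omega>) (DY n \<omega>)) rt"
proof -
  let ?b = "\<lambda>\<zeta> n \<omega>. max_augproj n (p n) (Z n \<omega>) (theta n \<omega>) (u_t n) (\<zeta> n \<omega>)"
  define B where "B = (\<lambda>n \<omega>. (2 * beta\<^sup>2 + 1) * ?b eta n \<omega> + 2 * ?b eps n \<omega>)"
  have b: "negl M (?b eta) rt" "negl M (?b eps) rt"
    using negl_max_augproj[OF prob K_pos eta_indep_design mgf_eta rate_t up_t, of beta 1]
      negl_max_augproj[OF prob K_pos eps_indep mgf_eps rate_t up_t, of beta 1] by simp_all
  have B: "negl M B rt" unfolding B_def by (intro negl_add negl_cmult prob b)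
  have le: "augproj n (p n) (Z n \<omega>) (theta n \<omega>) m (eta n \<omega>) \<le> B n \<omega>"
    "augproj n (p n) (Z n \<omega>) (theta n \<omega>) m (\<lambda>i. beta * eta n \<omega> i + eps n \<omega> i) \<le> B n \<omega>"
    if m: "m \<in> subsets (p n) (u_t n)" for n \<omega> m
  proof -
    let ?a = "augproj n (p n) (Z n \<omega>) (theta n \<omega>) m"
    have eta: "?a (eta n \<omega>) \<le> ?b eta n \<omega>" and eps: "?a (eps n \<omega>) \<le> ?b eps n \<omega>"
      using augproj_le_max[OF m] by auto
    have pos: "?b eta n \<omega> \<ge> 0" "?b eps n \<omega> \<ge> 0" by (rule max_augproj_nonneg)+
    have b2: "2 * beta\<^sup>2 * ?a (eta n \<omega>) \<le> 2 * beta\<^sup>2 * ?b eta n \<omega>" "0 \<le> 2 * beta\<^sup>2 * ?b eta n \<omega>"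
      using eta pos by (auto intro: mult_left_mono)
    have BB: "B n \<omega> = 2 * beta\<^sup>2 * ?b eta n \<omega> + ?b eta n \<omega> + 2 * ?b eps n \<omega>"
      by (simp add: B_def distrib_right)
    show "?a (eta n \<omega>) \<le> B n \<omega>" using eta pos b2 unfolding BB by linarith
    let ?P = "proj n (augment (p n) (Z n \<omega>) (theta n \<omega>)) (insert (p n) m)"
    have "?P (\<lambda>i. beta * eta n \<omega> i + eps n \<omega> i) = (\<lambda>i. beta * ?P (eta n \<omega>) i + ?P (eps n \<omega>) i)"
      using proj_linear[of "insert (p n) m" n _ beta "eta n \<omega>" 1 "eps n \<omega>"] finite_of_subsets[OF m] by simp
    then have "?a (\<lambda>i. beta * eta n \<omega> i + eps n \<omega> i) \<le> 2 * beta\<^sup>2 * ?a (eta n \<omega>) + 2 * ?a (eps n \<omega>)"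
      using innern_le_sqnorm[of n "\<lambda>i. beta * ?P (eta n \<omega>) i" "?P (eps n \<omega>)"]
      by (simp add: augproj_def sqnorm_add sqnorm_scale)
    then show "?a (\<lambda>i. beta * eta n \<omega> i + eps n \<omega> i) \<le> B n \<omega>"
      using eps pos b2 unfolding BB by linarith
  qed
  have meas_theta: "(\<lambda>\<omega>. theta n \<omega> i) \<in> borel_measurable (M n)" if "i < n" for n i
    using that by (intro borel_measurable_add borel_measurable_times meas_nu meas_mu) auto
  note err = negl_fhat_error[OF prob alphaY _ B le(2) sparse_theta meas_Z meas_theta su_t up_t rate_t, where V = Y]
  show "negl M (\<lambda>n \<omega>. sqnorm n (DY n \<omega>)) rt" by (rule err(1)) auto
  show "negl M (\<lambda>n \<omega>. innern n (eta n \<omega>) (DY n \<omega>)) rt" by (rule err(2)) (auto intro: le)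
qed

section \<open>Remainder and denominator of the centred ratio\<close>

definition remainder :: "nat \<Rightarrow> 'a \<Rightarrow> real" where
  "remainder n \<omega> = innern n (rX n \<omega>) (rY n \<omega>) - beta * sqnorm n (rX n \<omega>) - innern n (eps n \<omega>) (eta n \<omega>)"

text \<open>Up to <\<epsilon>, \<eta>>, the remainder is the denominator times the error of the
  estimator. The terms in beta |\<eta>|^2, of order n, cancel, and everything left contains at least
  one estimation error.\<close>

lemma negl_remainder: "negl M remainder rt"
proof -
  have cross: "negl M (\<lambda>n \<omega>. innern n (DX n \<omega>) (DY n \<omega>)) rt"
  proof (rule negl_mono[OF negl_add[OF prob negl_DX(1) negl_DY(1)]], intro always_eventually allI ballI)
    fix n \<omega>
    show "\<bar>innern n (DX n \<omega>) (DY n \<omega>)\<bar> \<le> sqnorm n (DX n \<omega>) + sqnorm n (DY n \<omega>)"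
      using innern_le_sqnorm[of n "DX n \<omega>" "DY n \<omega>"] by linarith
  qed
  have eq: "remainder = (\<lambda>n \<omega>. innern n (eta n \<omega>) (DY n \<omega>) + (- beta) * innern n (eta n \<omega>) (DX n \<omega>)
      + innern n (eps n \<omega>) (DX n \<omega>) + innern n (DX n \<omega>) (DY n \<omega>) + (- beta) * sqnorm n (DX n \<omega>))"
  proof (intro ext)
    fix n \<omega>
    define dx dy where "dx = DX n \<omega>" and "dy = DY n \<omega>"
    have "remainder n \<omega> = innern n (\<lambda>i. eta n \<omega> i + dx i) (\<lambda>i. (beta * eta n \<omega> i + eps n \<omega> i) + dy i)
        - beta * sqnorm n (\<lambda>i. eta n \<omega> i + dx i) - innern n (eps n \<omega>) (eta n \<omega>)"
      by (simp add: remainder_def dx_def dy_def)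
    also have "\<dots> = innern n (eta n \<omega>) dy + (- beta) * innern n (eta n \<omega>) dx
      + innern n (eps n \<omega>) dx + innern n dx dy + (- beta) * sqnorm n dx"
      by (simp add: innern_add_left innern_add_right innern_scale_right sqnorm_add innern_self
          innern_commute[of n dx "eta n \<omega>"] innern_commute[of n dx "eps n \<omega>"]
          innern_commute[of n "eta n \<omega>" "eps n \<omega>"] algebra_simps)
    finally show "remainder n \<omega> = innern n (eta n \<omega>) (DY n \<omega>) + (- beta) * innern n (eta n \<omega>) (DX n \<omega>)
      + innern n (eps n \<omega>) (DX n \<omega>) + innern n (DX n \<omega>) (DY n \<omega>) + (- beta) * sqnorm n (DX n \<omega>)"
      unfolding dx_def dy_def .
  qed
  show ?thesis
    unfolding eq by (intro negl_add negl_cmult prob negl_DX negl_DY cross)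
qed

lemma rt34_facts:
  "\<forall>\<^sub>F n in sequentially. rt34 n > 0" "\<forall>\<^sub>F n in sequentially. rt n \<le> rt34 n"
  "\<forall>\<^sub>F n in sequentially. rt34 n \<le> real n" "(\<lambda>n. real n / (rt34 n)\<^sup>2) \<longlonglongrightarrow> 0"
  by real_asymp+

text \<open>The estimation error contributes only o(sqrt n), below the scale n^(3/4) at which
  |\<eta>|^2 is controlled.\<close>

lemma negl_denominator: "negl M (\<lambda>n \<omega>. sqnorm n (rX n \<omega>) - real n * sig2) rt34"
proof -
  have tr: "trace_n n (\<lambda>i j. if i = j then sig2 else 0) = real n * sig2" for n
    by (simp add: trace_n_def)
  have "negl M (\<lambda>n \<omega>. sqnorm n (eta n \<omega>) - trace_n n (\<lambda>i j. if i = j then sig2 else 0)) rt34"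
    using sig2_pos opnorm_scalar_le[of sig2]
    by (intro negl_gaussian_sqnorm[OF prob meas_eta eta_gauss, where K = sig2] rt34_facts) (auto simp: tr)
  then have 1: "negl M (\<lambda>n \<omega>. sqnorm n (eta n \<omega>) - real n * sig2) rt34" by (simp add: tr)
  have 2: "negl M (\<lambda>n \<omega>. 2 * innern n (eta n \<omega>) (DX n \<omega>) + sqnorm n (DX n \<omega>)) rt34"
    by (rule negl_weaken[OF _ rt34_facts(2)]) (intro negl_add negl_cmult prob negl_DX)
  have eq: "sqnorm n (rX n \<omega>) - real n * sig2 =
      (sqnorm n (eta n \<omega>) - real n * sig2) + (2 * innern n (eta n \<omega>) (DX n \<omega>) + sqnorm n (DX n \<omega>))" for n \<omega>
    using sqnorm_add[of n "eta n \<omega>" "DX n \<omega>"] by simp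
  show ?thesis unfolding eq by (rule negl_add[OF prob 1 2])
qed

lemma negl_sqnorm_eps: "negl M (\<lambda>n \<omega>. sqnorm n (eps n \<omega>) - dbar * real n) real"
proof -
  \<comment> \<open>Positivity of the limit supplies the nonnegative trace that the concentration
    bound asks for.\<close>
  have "\<forall>\<^sub>F n in sequentially. trace_n n (Sig n) / real n > 0"
    using Sig_trace dbar_pos by (rule order_tendstoD(1))
  then have tr: "\<forall>\<^sub>F n in sequentially. trace_n n (Sig n) \<ge> 0"
    by eventually_elim (auto simp: zero_less_divide_iff)
  have 1: "negl M (\<lambda>n \<omega>. sqnorm n (eps n \<omega>) - trace_n n (Sig n)) real"
  proof (rule negl_gaussian_sqnorm[OF prob meas_eps eps_gauss Sig_sym Sig_le tr])
    show "(\<lambda>n. real n / (real n)\<^sup>2) \<longlonglongrightarrow> 0" by real_asymp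
    show "\<forall>\<^sub>F n in sequentially. real n > 0" by real_asymp
  qed
  have "(\<lambda>n. trace_n n (Sig n) / real n - dbar) \<longlonglongrightarrow> dbar - dbar"
    by (intro tendsto_diff Sig_trace tendsto_const)
  moreover have "\<forall>\<^sub>F n in sequentially. trace_n n (Sig n) / real n - dbar = (trace_n n (Sig n) - dbar * real n) / real n"
    using eventually_gt_at_top[of 0] by eventually_elim (simp add: field_simps)
  ultimately have "(\<lambda>n. (trace_n n (Sig n) - dbar * real n) / real n) \<longlonglongrightarrow> 0"
    by (simp add: tendsto_cong)
  then have "(\<lambda>n. trace_n n (Sig n) - dbar * real n) \<in> o(real)"
    by (rule smalloI_tendsto) (use eventually_gt_at_top[of 0] in eventually_elim, simp)
  then have 2: "negl M (\<lambda>n \<omega>. trace_n n (Sig n) - dbar * real n) real"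
    by (rule negl_of_smallo) simp
  show ?thesis using negl_add[OF prob 1 2] by simp
qed

text \<open>The projection tail bound is reused with the single column \<epsilon>: projecting \<eta>
  on it has squared norm <\<epsilon>, \<eta>>^2 / |\<epsilon>|^2. Threshold sqrt n together with
  |\<epsilon>|^2 <= 2 dbar n yields n^(3/4), more than the true order sqrt n but enough.\<close>

lemma whp_innern_eps_eta:
  "whp M (\<lambda>n \<omega>. \<bar>innern n (eps n \<omega>) (eta n \<omega>)\<bar> \<le> sqrt (2 * dbar) * rt34 n)"
proof -
  \<comment> \<open>Constant in \<open>j\<close>; only column 0 is selected below.\<close>
  define W :: "(nat \<Rightarrow> real) \<Rightarrow> nat \<Rightarrow> nat \<Rightarrow> real" where "W = (\<lambda>y i j. y i)"
  have W: "(\<lambda>y. W y i j) \<in> borel_measurable (vecM n)" if "i < n" for n i j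
    using measurable_vecM_nth[OF that] by (simp add: W_def)
  let ?S = "\<lambda>n \<omega>. sqnorm n (proj n (W (vecRV n (eps n \<omega>))) {0} (eta n \<omega>))"
  have S: "?S n \<omega> = (innern n (eps n \<omega>) (eta n \<omega>))\<^sup>2 / sqnorm n (eps n \<omega>)" for n \<omega>
  proof -
    define r where "r = resid n (W (vecRV n (eps n \<omega>))) {} (zcol n (W (vecRV n (eps n \<omega>))) 0)"
    have r: "r i = eps n \<omega> i" if "i < n" for i
      using that by (simp add: r_def resid_def proj_empty zcol_def W_def vecRV_nth)
    show ?thesis
      using sqnorm_proj_insert[OF _ _ r_def, of "eta n \<omega>"]
        sqnorm_cong[of n r, OF r] innern_cong[of n r _ "eta n \<omega>" "eta n \<omega>", OF r]
      by (simp add: proj_empty) (simp add: sqnorm_def)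
  qed
  have "whp M (\<lambda>n \<omega>. ?S n \<omega> \<le> rt n)"
  proof (rule whpI, unfold not_le)
    show "\<forall>\<^sub>F n in sequentially. {\<omega>\<in>space (M n). rt n < ?S n \<omega>} \<in> sets (M n)"
      by (intro always_eventually allI indep_proj_tail(2)[OF prob eta_indep_eps K_pos mgf_eta W]) auto
    have "\<forall>\<^sub>F n in sequentially. norm (measure (M n) {\<omega>\<in>space (M n). rt n < ?S n \<omega>}) \<le> sqrt 2 * exp (- rt n / (4 * K))"
    proof (intro always_eventually allI)
      fix n
      have "measure (M n) {\<omega>\<in>space (M n). rt n < ?S n \<omega>} \<le> sqrt 2 ^ card {0 :: nat} * exp (- rt n / (4 * K))"
        by (rule indep_proj_tail(1)[OF prob eta_indep_eps K_pos mgf_eta W]) auto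
      then show "norm (measure (M n) {\<omega>\<in>space (M n). rt n < ?S n \<omega>}) \<le> sqrt 2 * exp (- rt n / (4 * K))"
        by simp
    qed
    moreover have "(\<lambda>n. sqrt 2 * exp (- rt n / (4 * K))) \<longlonglongrightarrow> 0" using K_pos by real_asymp
    ultimately show "(\<lambda>n. measure (M n) {\<omega>\<in>space (M n). rt n < ?S n \<omega>}) \<longlonglongrightarrow> 0"
      by (rule Lim_null_comparison)
  qed
  then have "whp M (\<lambda>n \<omega>. ?S n \<omega> \<le> rt n \<and> \<bar>sqnorm n (eps n \<omega>) - dbar * real n\<bar> \<le> dbar * real n)"
    by (rule whp_conj[OF prob]) (use neglD[OF negl_sqnorm_eps dbar_pos] in simp)
  then show ?thesis
  proof (rule whp_mono, intro always_eventually allI ballI impI, elim conjE)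
    fix n \<omega>
    let ?I = "innern n (eps n \<omega>) (eta n \<omega>)"
    assume 1: "?S n \<omega> \<le> rt n" and 2: "\<bar>sqnorm n (eps n \<omega>) - dbar * real n\<bar> \<le> dbar * real n"
    have "?I\<^sup>2 \<le> rt n * sqnorm n (eps n \<omega>)"
    proof (cases "sqnorm n (eps n \<omega>) = 0")
      case True
      then show ?thesis using innern_Cauchy_Schwarz[of n "eps n \<omega>" "eta n \<omega>"] by simp
    next
      case False
      then have "sqnorm n (eps n \<omega>) > 0" by (metis sqnorm_nonneg less_eq_real_def)
      then show ?thesis using 1 unfolding S by (simp add: field_simps)
    qed
    also have "\<dots> \<le> rt n * (2 * dbar * real n)" using 2 by (intro mult_left_mono) auto
    also have "\<dots> = 2 * dbar * (real n * rt n)" by simp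
    finally have "sqrt (?I\<^sup>2) \<le> sqrt (2 * dbar * (real n * rt n))" by (rule real_sqrt_le_mono)
    then show "\<bar>?I\<bar> \<le> sqrt (2 * dbar) * rt34 n" by (simp add: real_sqrt_mult)
  qed
qed

section \<open>Asymptotic normality of the standardised estimator\<close>

definition stat :: "nat \<Rightarrow> 'a \<Rightarrow> real" where
  "stat n \<omega> = rt n * (innern n (rX n \<omega>) (rY n \<omega>) / sqnorm n (rX n \<omega>) - beta)"

definition lead :: "nat \<Rightarrow> 'a \<Rightarrow> real" where
  "lead n \<omega> = innern n (eps n \<omega>) (eta n \<omega>) / (rt n * sig2)"

lemma whp_stat_lead:
  assumes e: "e > 0"
  shows "whp M (\<lambda>n \<omega>. \<bar>stat n \<omega> - lead n \<omega>\<bar> \<le> e)"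
proof -
  define C where "C = sqrt (2 * dbar)"
  have C: "C > 0" using dbar_pos by (simp add: C_def)
  \<comment> \<open>\<open>d1\<close> and \<open>d2\<close> make each of the two error terms of
    \<open>ratio_bound\<close> equal to \<open>e / 2\<close>.\<close>
  define d1 where "d1 = e * sig2 / 4"
  define d2 where "d2 = e * sig2\<^sup>2 / (4 * C)"
  have d: "d1 > 0" "d2 > 0" using e sig2_pos C by (auto simp: d1_def d2_def)
  have "whp M (\<lambda>n \<omega>. (\<bar>remainder n \<omega>\<bar> \<le> d1 * rt n \<and> \<bar>innern n (eps n \<omega>) (eta n \<omega>)\<bar> \<le> C * rt34 n) \<and>
      (\<bar>sqnorm n (rX n \<omega>) - real n * sig2\<bar> \<le> d2 * rt34 n \<and> \<bar>sqnorm n (rX n \<omega>) - real n * sig2\<bar> \<le> sig2 / 2 * real n))"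
  proof (intro whp_conj prob)
    show "whp M (\<lambda>n \<omega>. \<bar>remainder n \<omega>\<bar> \<le> d1 * rt n)" by (rule neglD[OF negl_remainder d(1)])
    show "whp M (\<lambda>n \<omega>. \<bar>innern n (eps n \<omega>) (eta n \<omega>)\<bar> \<le> C * rt34 n)"
      unfolding C_def by (rule whp_innern_eps_eta)
    show "whp M (\<lambda>n \<omega>. \<bar>sqnorm n (rX n \<omega>) - real n * sig2\<bar> \<le> d2 * rt34 n)"
      by (rule neglD[OF negl_denominator d(2)])
    show "whp M (\<lambda>n \<omega>. \<bar>sqnorm n (rX n \<omega>) - real n * sig2\<bar> \<le> sig2 / 2 * real n)"
      using sig2_pos by (intro neglD[OF negl_weaken[OF negl_denominator rt34_facts(3)]]) simp
  qed
  then show ?thesis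
  proof (rule whp_mono)
    show "\<forall>\<^sub>F n in sequentially. \<forall>\<omega>\<in>space (M n).
      (\<bar>remainder n \<omega>\<bar> \<le> d1 * rt n \<and> \<bar>innern n (eps n \<omega>) (eta n \<omega>)\<bar> \<le> C * rt34 n) \<and>
      (\<bar>sqnorm n (rX n \<omega>) - real n * sig2\<bar> \<le> d2 * rt34 n \<and> \<bar>sqnorm n (rX n \<omega>) - real n * sig2\<bar> \<le> sig2 / 2 * real n)
      \<longrightarrow> \<bar>stat n \<omega> - lead n \<omega>\<bar> \<le> e"
      using eventually_gt_at_top[of 0]
    proof (eventually_elim, intro ballI impI, elim conjE)
      fix n :: nat and \<omega>
      assume n: "n > 0" and R: "\<bar>remainder n \<omega>\<bar> \<le> d1 * rt n"
        and E: "\<bar>innern n (eps n \<omega>) (eta n \<omega>)\<bar> \<le> C * rt34 n"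
        and N2: "\<bar>sqnorm n (rX n \<omega>) - real n * sig2\<bar> \<le> d2 * rt34 n"
        and N: "\<bar>sqnorm n (rX n \<omega>) - real n * sig2\<bar> \<le> sig2 / 2 * real n"
      have x: "real n > 0" using n by simp
      \<comment> \<open>A nonzero denominator is required to bring \<beta> under the
        quotient.\<close>
      have "\<bar>sqnorm n (rX n \<omega>) - real n * sig2\<bar> < real n * sig2" using N x sig2_pos
        by (smt (verit) mult.commute mult_pos_pos field_sum_of_halves times_divide_eq_left)
      then have N0: "sqnorm n (rX n \<omega>) \<noteq> 0" by auto
      have "stat n \<omega> = rt n * ((innern n (eps n \<omega>) (eta n \<omega>) + remainder n \<omega>) / sqnorm n (rX n \<omega>))"
        using N0 by (simp add: stat_def remainder_def field_simps)
      then have "\<bar>stat n \<omega> - lead n \<omega>\<bar> \<le> 2 * d1 / sig2 + 2 * C * d2 / sig2\<^sup>2"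
        unfolding lead_def using ratio_bound[OF x sig2_pos less_imp_le[OF C] _ _ N N2 R E] by simp
      also have "\<dots> = e" using C sig2_pos by (simp add: d1_def d2_def field_simps)
      finally show "\<bar>stat n \<omega> - lead n \<omega>\<bar> \<le> e" .
    qed
  qed
qed

lemma meas_innern_eps_eta [measurable]: "(\<lambda>\<omega>. innern n (eps n \<omega>) (eta n \<omega>)) \<in> borel_measurable (M n)"
  unfolding innern_def by (intro borel_measurable_sum borel_measurable_times meas_eps meas_eta) auto

lemma meas_sqnorm_eps [measurable]: "(\<lambda>\<omega>. sqnorm n (eps n \<omega>)) \<in> borel_measurable (M n)"
  unfolding sqnorm_def by (intro borel_measurable_sum borel_measurable_power meas_eps) auto

lemma meas_fhat:
  assumes V: "\<And>i. i < n \<Longrightarrow> (\<lambda>\<omega>. V \<omega> i) \<in> borel_measurable (M n)"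
  shows "(\<lambda>\<omega>. fhat n (p n) (Z n \<omega>) u \<alpha> (V \<omega>) i) \<in> borel_measurable (M n)"
proof -
  have pr: "(\<lambda>\<omega>. proj n (Z n \<omega>) m (V \<omega>) i) \<in> borel_measurable (M n)" if "m \<in> subsets (p n) u" for m i
    using that finite_of_subsets[OF that] by (intro borel_measurable_proj meas_Z V) (auto simp: subsets_def)
  have sq: "(\<lambda>\<omega>. sqnorm n (resid n (Z n \<omega>) m (V \<omega>))) \<in> borel_measurable (M n)" if "m \<in> subsets (p n) u" for m
    unfolding sqnorm_def resid_def
    by (intro borel_measurable_sum borel_measurable_power borel_measurable_diff V pr that) auto
  have ex: "(\<lambda>\<omega>. exp (- sqnorm n (resid n (Z n \<omega>) m (V \<omega>)) / \<alpha>)) \<in> borel_measurable (M n)" if "m \<in> subsets (p n) u" for m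
    using sq[OF that] by measurable
  show ?thesis unfolding fhat_def expweight_def
    by (intro borel_measurable_sum borel_measurable_times borel_measurable_divide ex pr)
qed

lemma meas_stat [measurable]: "stat n \<in> borel_measurable (M n)"
proof -
  have x: "(\<lambda>\<omega>. rX n \<omega> i) \<in> borel_measurable (M n)" if "i < n" for i
    using that by (intro borel_measurable_add borel_measurable_diff meas_fhat meas_eta meas_nu)
  have y: "(\<lambda>\<omega>. rY n \<omega> i) \<in> borel_measurable (M n)" if "i < n" for i
    using that by (intro borel_measurable_add borel_measurable_diff borel_measurable_times borel_measurable_const
        meas_fhat meas_eta meas_eps meas_nu meas_mu)
  have "(\<lambda>\<omega>. innern n (rX n \<omega>) (rY n \<omega>)) \<in> borel_measurable (M n)" "(\<lambda>\<omega>. sqnorm n (rX n \<omega>)) \<in> borel_measurable (M n)"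
    unfolding innern_def sqnorm_def
    by (intro borel_measurable_sum borel_measurable_times borel_measurable_power x y; simp)+
  then show ?thesis unfolding stat_def[abs_def] by measurable
qed

lemma meas_lead [measurable]: "lead n \<in> borel_measurable (M n)"
  unfolding lead_def[abs_def] by measurable

text \<open>Conditioning on \<epsilon> turns the left side into the mean of exp (-c |\<epsilon>|^2 /
  n), and |\<epsilon>|^2 / n tends to dbar in probability. The integrand is bounded, so its mean
  converges.\<close>

lemma char_lead_tendsto:
  "(\<lambda>n. \<integral>\<omega>. iexp (t * lead n \<omega>) \<partial>M n) \<longlonglongrightarrow> complex_of_real (exp (- (t\<^sup>2 * (dbar / sig2)) / 2))"
proof -
  \<comment> \<open>From (t / (sqrt n sig2))^2 sig2 |\<epsilon>|^2 / 2 = c |\<epsilon>|^2 /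
    n.\<close>
  define c where "c = t\<^sup>2 / (2 * sig2)"
  have c: "c \<ge> 0" using sig2_pos by (simp add: c_def)
  define g where "g = (\<lambda>n \<omega>. complex_of_real (exp (- (c * (sqnorm n (eps n \<omega>) / real n)))))"
  define g0 where "g0 = complex_of_real (exp (- (c * dbar)))"
  have eq: "(\<integral>\<omega>. iexp (t * lead n \<omega>) \<partial>M n) = (\<integral>\<omega>. g n \<omega> \<partial>M n)" for n
  proof -
    have "(\<integral>\<omega>. iexp (t * lead n \<omega>) \<partial>M n) = (\<integral>\<omega>. iexp (t / (rt n * sig2) * innern n (eps n \<omega>) (eta n \<omega>)) \<partial>M n)"
      by (simp add: lead_def)
    also have "\<dots> = (\<integral>\<omega>. complex_of_real (exp (- ((t / (rt n * sig2))\<^sup>2 * sig2 * sqnorm n (eps n \<omega>)) / 2)) \<partial>M n)"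
      by (rule char_innern_indep[OF prob eta_indep_eps eta_gauss]) (use sig2_pos in simp)
    also have "\<dots> = (\<integral>\<omega>. g n \<omega> \<partial>M n)"
    proof -
      have "(t / (rt n * sig2))\<^sup>2 * sig2 * x / 2 = c * (x / real n)" for x
        using sig2_pos by (simp add: c_def power_divide power_mult_distrib power2_eq_square[of sig2])
      then show ?thesis by (simp add: g_def)
    qed
    finally show ?thesis .
  qed
  have gm [measurable]: "g n \<in> borel_measurable (M n)" for n unfolding g_def by measurable
  have g1: "norm (g n \<omega>) \<le> 1" for n \<omega> using c by (simp add: g_def)
  have "(\<lambda>n. \<integral>\<omega>. g n \<omega> - g0 \<partial>M n) \<longlonglongrightarrow> 0"
  proof (rule whp_integral_tendsto_0[OF prob])
    show "(\<lambda>\<omega>. g n \<omega> - g0) \<in> borel_measurable (M n)" for n by measurable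
    show "norm (g n \<omega> - g0) \<le> 2" for n \<omega>
    proof -
      have "norm g0 \<le> 1" using c dbar_pos by (simp add: g0_def)
      then show ?thesis using g1[of n \<omega>] norm_triangle_ineq4[of "g n \<omega>" g0] by linarith
    qed
    fix e :: real assume e: "e > 0"
    \<comment> \<open>The \<open>+ 1\<close> covers \<open>t = 0\<close>, where \<open>c\<close>
      vanishes.\<close>
    have "whp M (\<lambda>n \<omega>. \<bar>sqnorm n (eps n \<omega>) - dbar * real n\<bar> \<le> e / (c + 1) * real n)"
      using e c by (intro neglD[OF negl_sqnorm_eps]) auto
    then show "whp M (\<lambda>n \<omega>. norm (g n \<omega> - g0) \<le> e)"
    proof (rule whp_mono)
      show "\<forall>\<^sub>F n in sequentially. \<forall>\<omega>\<in>space (M n).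
        \<bar>sqnorm n (eps n \<omega>) - dbar * real n\<bar> \<le> e / (c + 1) * real n \<longrightarrow> norm (g n \<omega> - g0) \<le> e"
        using eventually_gt_at_top[of 0]
      proof (eventually_elim, intro ballI impI)
        fix n :: nat and \<omega>
        assume n: "n > 0" and *: "\<bar>sqnorm n (eps n \<omega>) - dbar * real n\<bar> \<le> e / (c + 1) * real n"
        have "norm (g n \<omega> - g0) = \<bar>exp (- (c * (sqnorm n (eps n \<omega>) / real n))) - exp (- (c * dbar))\<bar>"
          unfolding g_def g0_def by (simp only: norm_of_real flip: of_real_diff)
        also have "\<dots> \<le> \<bar>c * (sqnorm n (eps n \<omega>) / real n) - c * dbar\<bar>"
          using c dbar_pos by (intro exp_neg_diff_le) auto
        also have "\<dots> = c * (\<bar>sqnorm n (eps n \<omega>) - dbar * real n\<bar> / real n)"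
        proof -
          have "c * (sqnorm n (eps n \<omega>) / real n) - c * dbar = c * ((sqnorm n (eps n \<omega>) - dbar * real n) / real n)"
            using n by (simp add: field_simps)
          then show ?thesis using c by (simp add: abs_mult)
        qed
        also have "\<dots> \<le> c * (e / (c + 1))"
          using * n c by (intro mult_left_mono) (auto simp: divide_le_eq)
        also have "\<dots> \<le> e" using c e by (simp add: field_simps)
        finally show "norm (g n \<omega> - g0) \<le> e" .
      qed
    qed
  qed
  moreover have "(\<integral>\<omega>. g n \<omega> - g0 \<partial>M n) = (\<integral>\<omega>. g n \<omega> \<partial>M n) - g0" for n
  proof -
    interpret prob_space "M n" by (rule prob)
    have "integrable (M n) (g n)" using g1 by (intro integrable_const_bound[of _ 1]) auto
    then show ?thesis by (simp add: prob_space)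
  qed
  ultimately have "(\<lambda>n. \<integral>\<omega>. g n \<omega> \<partial>M n) \<longlonglongrightarrow> g0" by (simp add: LIM_zero_iff)
  moreover have "g0 = complex_of_real (exp (- (t\<^sup>2 * (dbar / sig2)) / 2))"
    by (simp add: g0_def c_def)
  ultimately show ?thesis by (simp only: eq)
qed

text \<open>Levy's continuity theorem: replacing \<open>stat\<close> by \<open>lead\<close> changes
  the integrand of the characteristic function by at most |t| times their distance and never by more
  than 2, so bounded convergence in probability removes the difference.\<close>

lemma stat_weak_conv:
  "weak_conv_m (\<lambda>n. distr (M n) borel (stat n)) (density lborel (normal_density 0 (sqrt (dbar / sig2))))"
proof -
  have v: "dbar / sig2 > 0" using dbar_pos sig2_pos by simp
  then have nl: "density lborel (normal_density 0 (sqrt (dbar / sig2))) = normal_law (dbar / sig2)"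
    unfolding normal_law_def by (metis less_irrefl)
  show ?thesis
  proof (rule levy_continuity)
    show "real_distribution (distr (M n) borel (stat n))" for n
      by (rule prob_space.real_distribution_distr[OF prob meas_stat])
    have "prob_space (density lborel (normal_density 0 (sqrt (dbar / sig2))))"
      using v by (intro prob_space_normal_density) simp
    then show "real_distribution (density lborel (normal_density 0 (sqrt (dbar / sig2))))"
      by (simp add: real_distribution_def real_distribution_axioms_def)
    fix t
    have diff: "(\<lambda>n. \<integral>\<omega>. iexp (t * stat n \<omega>) - iexp (t * lead n \<omega>) \<partial>M n) \<longlonglongrightarrow> 0"
    proof (rule whp_integral_tendsto_0[OF prob])
      show "(\<lambda>\<omega>. iexp (t * stat n \<omega>) - iexp (t * lead n \<omega>)) \<in> borel_measurable (M n)" for n by measurable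
      show "norm (iexp (t * stat n \<omega>) - iexp (t * lead n \<omega>)) \<le> 2" for n \<omega>
        by (rule order_trans[OF norm_triangle_ineq4]) simp
      fix e :: real assume e: "e > 0"
      have "whp M (\<lambda>n \<omega>. \<bar>stat n \<omega> - lead n \<omega>\<bar> \<le> e / (\<bar>t\<bar> + 1))"
        using e by (intro whp_stat_lead) simp
      then show "whp M (\<lambda>n \<omega>. norm (iexp (t * stat n \<omega>) - iexp (t * lead n \<omega>)) \<le> e)"
      proof (rule whp_mono, intro always_eventually allI ballI impI)
        fix n \<omega> assume *: "\<bar>stat n \<omega> - lead n \<omega>\<bar> \<le> e / (\<bar>t\<bar> + 1)"
        have "norm (iexp (t * stat n \<omega>) - iexp (t * lead n \<omega>)) \<le> \<bar>t * stat n \<omega> - t * lead n \<omega>\<bar>"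
          by (rule norm_iexp_diff_le)
        also have "\<dots> = \<bar>t\<bar> * \<bar>stat n \<omega> - lead n \<omega>\<bar>" by (simp add: abs_mult flip: right_diff_distrib)
        also have "\<dots> \<le> \<bar>t\<bar> * (e / (\<bar>t\<bar> + 1))" using * by (intro mult_left_mono) auto
        also have "\<dots> \<le> e" using e by (simp add: field_simps)
        finally show "norm (iexp (t * stat n \<omega>) - iexp (t * lead n \<omega>)) \<le> e" .
      qed
    qed
    have "char (distr (M n) borel (stat n)) t =
        (\<integral>\<omega>. iexp (t * stat n \<omega>) - iexp (t * lead n \<omega>) \<partial>M n) + (\<integral>\<omega>. iexp (t * lead n \<omega>) \<partial>M n)" for n
    proof -
      interpret prob_space "M n" by (rule prob)
      have "integrable (M n) (\<lambda>\<omega>. iexp (t * stat n \<omega>))" "integrable (M n) (\<lambda>\<omega>. iexp (t * lead n \<omega>))"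
        by (intro integrable_const_bound[of _ 1]; simp)+
      then have "(\<integral>\<omega>. iexp (t * stat n \<omega>) - iexp (t * lead n \<omega>) \<partial>M n) =
          (\<integral>\<omega>. iexp (t * stat n \<omega>) \<partial>M n) - (\<integral>\<omega>. iexp (t * lead n \<omega>) \<partial>M n)"
        by (rule Bochner_Integration.integral_diff)
      then show ?thesis by (simp add: char_def integral_distr)
    qed
    then show "(\<lambda>n. char (distr (M n) borel (stat n)) t) \<longlonglongrightarrow>
        char (density lborel (normal_density 0 (sqrt (dbar / sig2)))) t"
      using tendsto_add[OF diff char_lead_tendsto[of t]] dbar_pos sig2_pos
      unfolding nl char_normal_law by simp
  qed
qed

end

theorem mainTheorem9:
  fixes M :: "nat \<Rightarrow> 'a measure"
    and p :: "nat \<Rightarrow> nat"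
    and Z :: "nat \<Rightarrow> 'a \<Rightarrow> nat \<Rightarrow> nat \<Rightarrow> real"
    and Y X mu nu eta eps :: "nat \<Rightarrow> 'a \<Rightarrow> nat \<Rightarrow> real"
    and Sig :: "nat \<Rightarrow> nat \<Rightarrow> nat \<Rightarrow> real"
    and beta sig2 dbar alphaY alphaX :: real
    and s_g s_d s_t u_g u_d u_t :: "nat \<Rightarrow> nat"
  assumes prob: "\<And>n. prob_space (M n)"
    and model_Y: "\<And>n \<omega> i. Y n \<omega> i = X n \<omega> i * beta + mu n \<omega> i + eps n \<omega> i"
    and model_X: "\<And>n \<omega> i. X n \<omega> i = nu n \<omega> i + eta n \<omega> i"
    \<comment> \<open>(A1)\<close>
    and A1_mu: "bigOp M (\<lambda>n \<omega>. sqnorm n (mu n \<omega>)) (\<lambda>n. real n)"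
    and A1_nu: "bigOp M (\<lambda>n \<omega>. sqnorm n (nu n \<omega>)) (\<lambda>n. real n)"
    \<comment> \<open>(A2*)\<close>
    and sig2_pos: "sig2 > 0"
    and eta_gauss: "\<And>n. gaussian_vec (M n) n (\<lambda>i j. if i = j then sig2 else 0) (eta n)"
    and eta_indep: "\<And>n. indep_rv (M n)
          (vecM n) (\<lambda>\<omega>. vecRV n (eta n \<omega>))
          (matM n (p n) \<Otimes>\<^sub>M vecM n \<Otimes>\<^sub>M vecM n \<Otimes>\<^sub>M vecM n)
          (\<lambda>\<omega>. (matRV n (p n) (Z n \<omega>), vecRV n (mu n \<omega>), vecRV n (nu n \<omega>), vecRV n (eps n \<omega>)))"
    and Sig_sym: "\<And>n i j. i < n \<Longrightarrow> j < n \<Longrightarrow> Sig n i j = Sig n j i"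
    and eps_gauss: "\<And>n. gaussian_vec (M n) n (Sig n) (eps n)"
    and eps_indep: "\<And>n. indep_rv (M n)
          (vecM n) (\<lambda>\<omega>. vecRV n (eps n \<omega>))
          (matM n (p n) \<Otimes>\<^sub>M vecM n \<Otimes>\<^sub>M vecM n)
          (\<lambda>\<omega>. (matRV n (p n) (Z n \<omega>), vecRV n (mu n \<omega>), vecRV n (nu n \<omega>)))"
    and Sig_bdd: "\<exists>C. \<forall>n. opnorm n (Sig n) \<le> C"
    and Sig_trace: "(\<lambda>n. trace_n n (Sig n) / real n) \<longlonglongrightarrow> dbar"
    and dbar_pos: "dbar > 0"
    \<comment> \<open>(A3)\<close>
    and sparse_mu: "weakly_sparse M p Z mu s_g (\<lambda>n. sqrt (real n))"
    and sparse_nu: "weakly_sparse M p Z nu s_d (\<lambda>n. sqrt (real n))"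
    and sparse_theta: "weakly_sparse M p Z (\<lambda>n \<omega> i. nu n \<omega> i * beta + mu n \<omega> i) s_t (\<lambda>n. sqrt (real n))"
    and u_ge: "\<forall>\<^sub>F n in sequentially. s_g n \<le> u_g n \<and> s_d n \<le> u_d n \<and> s_t n \<le> u_t n"
    and u_le_p: "\<forall>\<^sub>F n in sequentially. u_g n \<le> p n \<and> u_d n \<le> p n \<and> u_t n \<le> p n"
    and u_rate: "(\<lambda>n. real (max (u_g n) (max (u_d n) (u_t n))) * ln (real (p n)))
                   \<in> o(\<lambda>n. sqrt (real n))"
    \<comment> \<open>tuning parameters\<close>
    and alphaY: "alphaY > 4 * (beta\<^sup>2 * sig2 + (SUP n. opnorm n (Sig n)))"
    and alphaX: "alphaX > 4 * sig2"
  shows "weak_conv_m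
     (\<lambda>n. distr (M n) borel (\<lambda>\<omega>.
        let rX = (\<lambda>i. X n \<omega> i - fhat n (p n) (Z n \<omega>) (u_d n) alphaX (X n \<omega>) i);
            rY = (\<lambda>i. Y n \<omega> i - fhat n (p n) (Z n \<omega>) (u_t n) alphaY (Y n \<omega>) i);
            betahat = innern n rX rY / sqnorm n rX
        in sqrt (real n) * (betahat - beta)))
     (density lborel (normal_density 0 (sqrt (dbar / sig2))))"
proof -
  obtain C where C: "\<And>n. opnorm n (Sig n) \<le> C" using Sig_bdd by blast
  \<comment> \<open>\<open>C\<close> bounds the covariance norms of \<epsilon>, and \<eta> has
    covariance norm at most \<open>sig2\<close>.\<close>
  define K where "K = max C sig2"
  have smaller_rate: "(\<lambda>n. real (u n) * ln (real (p n))) \<in> o(\<lambda>n. sqrt (real n))"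
    if "\<And>n. u n \<le> max (u_g n) (max (u_d n) (u_t n))" for u
  proof -
    have "(\<lambda>n. real (u n) * ln (real (p n)))
        \<in> O(\<lambda>n. real (max (u_g n) (max (u_d n) (u_t n))) * ln (real (p n)))"
    proof (rule bigoI[where c = 1], intro always_eventually allI)
      fix n
      have "real (u n) \<le> real (max (u_g n) (max (u_d n) (u_t n)))" using that[of n] by linarith
      then show "norm (real (u n) * ln (real (p n)))
          \<le> 1 * norm (real (max (u_g n) (max (u_d n) (u_t n))) * ln (real (p n)))"
        by (simp only: norm_mult mult_1) (intro mult_right_mono, auto)
    qed
    then show ?thesis using u_rate by (rule landau_o.big_small_trans)
  qed
  \<comment> \<open>Boundedness makes the \<open>SUP\<close> an upper bound of nonnegative norms, so
    the threshold for \<open>alphaY\<close> is nonnegative and \<open>alphaY\<close>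
    positive.\<close>
  have "0 \<le> opnorm 0 (Sig 0)" by (rule opnorm_nonneg)
  also have "\<dots> \<le> (SUP n. opnorm n (Sig n))"
    using C by (intro cSUP_upper bdd_aboveI2) auto
  finally have "0 \<le> 4 * (beta\<^sup>2 * sig2 + (SUP n. opnorm n (Sig n)))" using sig2_pos by simp
  then have aY: "alphaY > 0" using alphaY by linarith
  interpret PLM: partially_linear_model M p Z mu nu eta eps Sig beta sig2 dbar alphaY alphaX K s_d s_t u_d u_t
  proof (rule partially_linear_model.intro)
    show "\<And>n. opnorm n (Sig n) \<le> K" unfolding K_def using C by (simp add: le_max_iff_disj)
    show "sig2 \<le> K" by (simp add: K_def)
    show "\<forall>\<^sub>F n in sequentially. s_d n \<le> u_d n" "\<forall>\<^sub>F n in sequentially. s_t n \<le> u_t n"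
      using u_ge by (auto elim: eventually_mono)
    show "\<forall>\<^sub>F n in sequentially. u_d n \<le> p n" "\<forall>\<^sub>F n in sequentially. u_t n \<le> p n"
      using u_le_p by (auto elim: eventually_mono)
    show "(\<lambda>n. real (u_d n) * ln (real (p n))) \<in> o(\<lambda>n. sqrt (real n))"
      "(\<lambda>n. real (u_t n) * ln (real (p n))) \<in> o(\<lambda>n. sqrt (real n))"
      by (rule smaller_rate, simp)+
    show "alphaX > 0" using alphaX sig2_pos by linarith
  qed (fact assms aY)+
  have X: "X n \<omega> = PLM.X n \<omega>" for n \<omega>
    by (rule ext) (simp add: model_X)
  \<comment> \<open>Inserting the equation of X moves \<beta> \<nu> into the signal \<theta> and
    \<beta> \<eta> into the noise.\<close>
  have Y: "Y n \<omega> = PLM.Y n \<omega>" for n \<omega>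
    by (rule ext) (simp add: model_Y model_X algebra_simps)
  have rX: "(\<lambda>i. X n \<omega> i - fhat n (p n) (Z n \<omega>) (u_d n) alphaX (X n \<omega>) i) = PLM.rX n \<omega>"
    and rY: "(\<lambda>i. Y n \<omega> i - fhat n (p n) (Z n \<omega>) (u_t n) alphaY (Y n \<omega>) i) = PLM.rY n \<omega>" for n \<omega>
    unfolding X Y by (auto simp: fun_eq_iff)
  show ?thesis
    using PLM.stat_weak_conv unfolding rX rY Let_def PLM.stat_def[abs_def] .
qed

end
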